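(* Let $\alpha,\alpha',\beta,\beta',\gamma,\rho,p,b,c\in\mathbb{C}$ be such that $\kappa:=p+\frac{b+1}{2}\notin\{0,-1,-2,\ldots\}$. Suppose that $\operatorname{Re}(\gamma)>0$ and $\operatorname{Re}(\rho-p)<1+\min\{\operatorname{Re}(-\beta),\operatorname{Re}(\alpha+\alpha'-\gamma),\operatorname{Re}(\alpha+\beta'-\gamma)\}$, and that none of $p-\rho+1$, $\alpha+\alpha'+\beta'+p-\gamma-\rho+1$, $\alpha-\beta+p-\rho+1$ is zero or a negative integer. Then for every $x>0$, $$\left(I_{0,-}^{\alpha,\alpha',\beta,\beta',\gamma}\,t^{\rho-1}\mathcal{W}_{p,b,c}(1/t)\right)(x)=\frac{x^{\rho-p-\alpha-\alpha'+\gamma-1}}{2^{p}}\,\frac{\Gamma(\alpha+\alpha'+p-\gamma-\rho+1)\,\Gamma(\alpha+\beta'-\gamma+p-\rho+1)\,\Gamma(-\beta+p-\rho+1)}{\Gamma(p-\rho+1)\,\Gamma(\kappa)\,\Gamma(\alpha+\alpha'+\beta'+p-\gamma-\rho+1)\,\Gamma(\alpha-\beta+p-\rho+1)}$$ $$\times\,{}_6F_7\left[\begin{array}{c}\frac{\alpha+\alpha'+p-\gamma-\rho+1}{2},\ \frac{\alpha+\alpha'+p-\gamma-\rho+2}{2},\ \frac{\alpha+\beta'+p-\gamma-\rho+1}{2},\ \frac{\alpha+\beta'+p-\gamma-\rho+2}{2},\ \frac{-\beta+p-\rho+1}{2},\ \frac{-\beta+p-\rho+2}{2}\\ \kappa,\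 \frac{p-\rho+1}{2},\ \frac{p-\rho+2}{2},\ \frac{\alpha+\alpha'+\beta'+p-\gamma-\rho+1}{2},\ \frac{\alpha+\alpha'+\beta'+p-\gamma-\rho+2}{2},\ \frac{\alpha-\beta+p-\rho+1}{2},\ \frac{\alpha-\beta+p-\rho+2}{2}\end{array}\bigg|-\frac{c}{4x^2}\right].$$
   Context: Complex powers of positive reals are $y^{a}=\exp(a\log y)$. $(a)_n=a(a+1)\cdots(a+n-1)$, $(a)_0=1$. Appell's third function (Horn's function) is $F_3(\alpha,\alpha',\beta,\beta';\gamma;u,v)=\sum_{m,n\ge0}\frac{(\alpha)_m(\alpha')_n(\beta)_m(\beta')_n}{(\gamma)_{m+n}\,m!\,n!}u^mv^n$ for $|u|,|v|<1$, extended by analytic continuation in $v$; explicitly, for $|u|<1$ and real $v<1$, $F_3=\sum_{m\ge0}\frac{(\alpha)_m(\beta)_m}{(\gamma)_m m!}u^m\,{}_2F_1(\alpha',\beta';\gamma+m;v)$, where ${}_2F_1$ is the Gauss hypergeometric function continued analytically to $\mathbb{C}\setminus[1,\infty)$. For $\operatorname{Re}(\gamma)>0$ and $x>0$, $$\left(I_{0,-}^{\alpha,\alpha',\beta,\beta',\gamma}f\right)(x)=\frac{x^{-\alpha'}}{\Gamma(\gamma)}\int_x^\infty(t-x)^{\gamma-1}t^{-\alpha}F_3\left(\alpha,\alpha',\beta,\beta';\gamma;1-\frac{x}{t},1-\frac{t}{x}\right)f(t)\,dt.$$ An expression in $t$ after the operator denotes the function $f(t)$ to which it is applied. The generalized Bessel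 function of the first kind is $\mathcal{W}_{p,b,c}(z)=\sum_{k=0}^\infty\frac{(-1)^kc^k}{\Gamma(p+\frac{b+1}{2}+k)\,k!}\left(\frac z2\right)^{2k+p}$. The generalized hypergeometric function is ${}_rF_q\left[\begin{array}{c}a_1,\ldots,a_r\\c_1,\ldots,c_q\end{array}\Big|z\right]=\sum_{k=0}^\infty\frac{(a_1)_k\cdots(a_r)_k}{(c_1)_k\cdots(c_q)_k\,k!}z^k$, where none of the $c_j$ is zero or a negative integer. *)

theory Defs
  imports "HOL-Complex_Analysis.Complex_Analysis"
begin

(* The last argument of fps_hypergeo only rescales the variable. *)
definition hypergeo :: "complex list \<Rightarrow> complex list \<Rightarrow> complex \<Rightarrow> complex" where
  "hypergeo as cs z = eval_fps (fps_hypergeo as cs 1) z"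

(* The slit plane is connected, so a continuation from the unit disc to it is unique there;
   on the cut itself the value is unspecified. *)
definition gauss_2F1 :: "complex \<Rightarrow> complex \<Rightarrow> complex \<Rightarrow> complex \<Rightarrow> complex" where
  "gauss_2F1 a b c =
     (SOME g. g holomorphic_on (- complex_of_real ` {1..}) \<and>
              (\<forall>z\<in>ball 0 1. g z = hypergeo [a, b] [c] z))"

(* The double series summed over n first, which gives the continuation in v.
   It is meaningful for norm u < 1 and v off the cut. *)
definition appell_F3 ::
    "complex \<Rightarrow> complex \<Rightarrow> complex \<Rightarrow> complex \<Rightarrow> complex \<Rightarrow> complex \<Rightarrow> complex \<Rightarrow> complex" where
  "appell_F3 \<alpha> \<alpha>' \<beta> \<beta>' \<gamma> u v =
     (\<Sum>m. pochhammer \<alpha> m * pochhammer \<beta> m / (pochhammer \<gamma> m * fact m) * u ^ m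
           * gauss_2F1 \<alpha>' \<beta>' (\<gamma> + of_nat m) v)"

definition saigo_maeda_integrand ::
    "complex \<Rightarrow> complex \<Rightarrow> complex \<Rightarrow> complex \<Rightarrow> complex \<Rightarrow> (real \<Rightarrow> complex) \<Rightarrow> real \<Rightarrow> real \<Rightarrow> complex" where
  "saigo_maeda_integrand \<alpha> \<alpha>' \<beta> \<beta>' \<gamma> f x t =
     of_real (t - x) powr (\<gamma> - 1) * of_real t powr (- \<alpha>)
     * appell_F3 \<alpha> \<alpha>' \<beta> \<beta>' \<gamma> (of_real (1 - x / t)) (of_real (1 - t / x)) * f t"

definition saigo_maeda_minus ::
    "complex \<Rightarrow> complex \<Rightarrow> complex \<Rightarrow> complex \<Rightarrow> complex \<Rightarrow> (real \<Rightarrow> complex) \<Rightarrow> real \<Rightarrow> complex" where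
  "saigo_maeda_minus \<alpha> \<alpha>' \<beta> \<beta>' \<gamma> f x =
     of_real x powr (- \<alpha>') / Gamma \<gamma>
     * (LINT t:{x<..}|lborel. saigo_maeda_integrand \<alpha> \<alpha>' \<beta> \<beta>' \<gamma> f x t)"

(* The power is the principal one; for z > 0 it is exp ((2k + p) log (z/2)). *)
definition gen_bessel_W :: "complex \<Rightarrow> complex \<Rightarrow> complex \<Rightarrow> complex \<Rightarrow> complex" where
  "gen_bessel_W p b c z =
     (\<Sum>k. (- 1) ^ k * c ^ k / (Gamma (p + (b + 1) / 2 + of_nat k) * fact k)
           * (z / 2) powr (2 * of_nat k + p))"

end

theory Submission
  imports Defs "HOL-Real_Asymp.Real_Asymp"
begin

text \<open>
  Put \<open>w = x / t\<close>, so that \<open>0 < w < 1\<close> on the range of integration and the arguments of \<open>F\<^sub>3\<close> are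
  \<open>1 - w\<close> and \<open>1 - 1/w\<close>. Applied to a power of \<open>t\<close>, the operator computes a Mellin transform of a
  fixed kernel in \<open>w\<close>, and the value is, up to elementary factors, a quotient of three Gamma functions by three others
  (\<open>appell_F3_Mellin_ray\<close>). The Bessel function is \<open>t^(- p)\<close> times a power series in \<open>1/t^2\<close>, so that
  the exponent moves in steps of two. Integrating it term by term and rewriting \<open>\<Gamma>(z + 2k)\<close> by the duplication
  formula for Pochhammer symbols turns each of the six Gamma functions into a pair of parameters
  \<open>z/2\<close>, \<open>(z + 1)/2\<close>, and the result is the \<open>\<^sub>6F\<^sub>7\<close>.

  For a single power, expand \<open>F\<^sub>3\<close> in \<open>(1 - w)^m\<close> with coefficients containing the Gauss functions
  \<open>\<^sub>2F\<^sub>1(\<alpha>', \<beta>'; \<gamma> + m; 1 - 1/w)\<close>. Pfaff's transformation makes each of them a power of \<open>w\<close> times a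
  power series in \<open>1 - w\<close>, whose terms integrate to Beta functions; Gauss's theorem at the point 1
  sums the result (\<open>gauss_2F1_Mellin_ray\<close>). A second application of Gauss's theorem sums over \<open>m\<close>.

  The sum over \<open>m\<close> and the integral have to be exchanged, and this is the main difficulty: the
  double series that arises from expanding all Gauss functions at once and integrating every
  term need not converge absolutely if \<open>\<alpha>'\<close> and \<open>\<beta>'\<close> have negative real parts. Therefore the Gauss functions are not
  expanded but estimated, by
  \<open>\<bar>\<^sub>2F\<^sub>1(a, b; c + m; - y)\<bar> \<le> C (1 + y / (m + 1))^(- e)\<close> for all \<open>e < min (Re a) (Re b)\<close>, with \<open>C\<close>
  independent of \<open>m\<close> and of \<open>y \<ge> 0\<close> (\<open>gauss_2F1_uniform_bound_general\<close>). Summation over \<open>m\<close> then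
  gives a bound \<open>C w^e\<close> for the absolute values in the expansion of \<open>F\<^sub>3\<close>, for every \<open>e\<close> below
  \<open>Re \<alpha>'\<close>, \<open>Re \<beta>'\<close> and \<open>Re (\<gamma> - \<alpha> - \<beta>)\<close> (\<open>appell_F3_abs_partial_sum_bound\<close>). These three exponents match
  the three numbers in the hypothesis on \<open>Re (\<rho> - p)\<close>, which says precisely that the corresponding
  majorant is integrable at infinity for a suitable \<open>e\<close>.

  The uniform bound is read off from the Pfaff series if \<open>e \<ge> 0\<close> and \<open>Re b < Re c\<close>. A
  relation that expresses the function through those with lower parameters \<open>c + 1\<close> and \<open>c + 2\<close>
  removes the condition on \<open>c\<close>, and integrating the derivative lowers \<open>a\<close>, \<open>b\<close>, \<open>c\<close> and \<open>e\<close> by one, which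
  reaches the negative \<open>e\<close>.

  The Gauss function is specified as some continuation of its power series to the slit plane, so
  its existence is part of the proof. Euler's integral provides it if \<open>Re b\<close> and \<open>Re (c - b)\<close>
  are large, and the same two ways of lowering parameters provide it in general.
\<close>

section \<open>Growth of Pochhammer symbols\<close>

text \<open>This is the limit formula for \<open>1/\<Gamma>\<close>. The base \<open>n + 1\<close> instead of \<open>n\<close> makes the comparison
  function positive for every \<open>n\<close>, so that the convergent quotient gives bounds without exceptional
  indices.\<close>
lemma pochhammer_asymp:
  fixes a :: complex
  shows "(\<lambda>n. norm (pochhammer a n) / (fact n * (real n + 1) powr (Re a - 1))) \<longlonglongrightarrow> norm (rGamma a)"
proof -
  have "(\<lambda>n. real n powr Re a / ((real n + 1) * (real n + 2) powr (Re a - 1))) \<longlonglongrightarrow> 1"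
    by real_asymp
  hence "(\<lambda>n. norm (rGamma_series a n)
           * (real n powr Re a / ((real n + 1) * (real n + 2) powr (Re a - 1)))) \<longlonglongrightarrow> norm (rGamma a) * 1"
    by (intro tendsto_intros)
  moreover have "\<forall>\<^sub>F n in sequentially. norm (rGamma_series a n)
           * (real n powr Re a / ((real n + 1) * (real n + 2) powr (Re a - 1))) =
         norm (pochhammer a (Suc n)) / (fact (Suc n) * (real (Suc n) + 1) powr (Re a - 1))"
    using eventually_gt_at_top[of 0]
  proof eventually_elim
    case (elim n)
    have "norm (exp (a * of_real (ln (real n)))) = real n powr Re a"
      using elim by (simp add: powr_def norm_exp_eq_Re mult.commute)
    thus ?case using elim
      by (simp add: rGamma_series_def norm_mult norm_divide add_ac)
  qed
  ultimately have "(\<lambda>n. norm (pochhammer a (Suc n)) / (fact (Suc n) * (real (Suc n) + 1) powr (Re a - 1)))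
                     \<longlonglongrightarrow> norm (rGamma a)"
    by (simp add: Lim_transform_eventually)
  thus ?thesis by (subst filterlim_sequentially_Suc [symmetric])
qed

lemma pochhammer_upper_bound:
  fixes a :: complex
  obtains C where "C > 0" "\<And>n. norm (pochhammer a n) \<le> C * fact n * (real n + 1) powr (Re a - 1)"
proof -
  have "Bseq (\<lambda>n. norm (pochhammer a n) / (fact n * (real n + 1) powr (Re a - 1)))"
    using pochhammer_asymp convergentI convergent_imp_Bseq by blast
  then obtain C where C: "C > 0"
      "\<And>n. norm (norm (pochhammer a n) / (fact n * (real n + 1) powr (Re a - 1))) \<le> C"
    by (auto elim: BseqE)
  have "norm (pochhammer a n) \<le> C * fact n * (real n + 1) powr (Re a - 1)" for n
    using C(2)[of n] by (simp add: divide_le_eq abs_mult mult_ac)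
  thus ?thesis using that C(1) by blast
qed

lemma pochhammer_lower_bound:
  fixes c :: complex
  assumes "c \<notin> \<int>\<^sub>\<le>\<^sub>0"
  obtains C where "C > 0" "\<And>n. inverse (norm (pochhammer c n)) \<le> C * (real n + 1) powr (1 - Re c) / fact n"
proof -
  have "(\<lambda>n. inverse (norm (pochhammer c n) / (fact n * (real n + 1) powr (Re c - 1))))
          \<longlonglongrightarrow> inverse (norm (rGamma c))"
    by (intro tendsto_intros pochhammer_asymp) (use assms in \<open>auto simp: rGamma_eq_zero_iff\<close>)
  hence "Bseq (\<lambda>n. inverse (norm (pochhammer c n) / (fact n * (real n + 1) powr (Re c - 1))))"
    using convergentI convergent_imp_Bseq by blast
  then obtain C where C: "C > 0"
      "\<And>n. norm (inverse (norm (pochhammer c n) / (fact n * (real n + 1) powr (Re c - 1)))) \<le> C"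
    by (auto elim: BseqE)
  have "inverse (norm (pochhammer c n)) \<le> C * (real n + 1) powr (1 - Re c) / fact n" for n
  proof -
    have nz: "pochhammer c n \<noteq> 0" using assms pochhammer_eq_0_imp_nonpos_Int by blast
    have p: "(real n + 1) powr (1 - Re c) = inverse ((real n + 1) powr (Re c - 1))"
      by (simp flip: powr_minus)
    show ?thesis
      using C(2)[of n] nz unfolding p by (simp add: field_simps abs_mult)
  qed
  thus ?thesis using that C(1) by blast
qed

lemma summable_Suc_powr:
  assumes "p < -1" shows "summable (\<lambda>n. (real n + 1) powr p)"
  using assms summable_Suc_iff[of "\<lambda>n. real n powr p"] by (simp add: summable_real_powr_iff add_ac)

text \<open>The coefficients of the Gauss series. This is an abbreviation because the same quotient
  occurs literally in the definition of the Appell function.\<close>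
abbreviation gauss_coeff :: "complex \<Rightarrow> complex \<Rightarrow> complex \<Rightarrow> nat \<Rightarrow> complex" where
  "gauss_coeff a b c n \<equiv> pochhammer a n * pochhammer b n / (pochhammer c n * fact n)"

lemma gauss_coeff_bound:
  assumes "c \<notin> \<int>\<^sub>\<le>\<^sub>0"
  obtains C where "C > 0"
    "\<And>n. norm (gauss_coeff a b c n) \<le> C * (real n + 1) powr (Re (a + b - c) - 1)"
proof -
  obtain A where A: "A > 0" "\<And>n. norm (pochhammer a n) \<le> A * fact n * (real n + 1) powr (Re a - 1)"
    using pochhammer_upper_bound[of a] by blast
  obtain B where B: "B > 0" "\<And>n. norm (pochhammer b n) \<le> B * fact n * (real n + 1) powr (Re b - 1)"
    using pochhammer_upper_bound[of b] by blast
  obtain D where D: "D > 0" "\<And>n. inverse (norm (pochhammer c n)) \<le> D * (real n + 1) powr (1 - Re c) / fact n"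
    using pochhammer_lower_bound[OF assms] by blast
  show ?thesis
  proof (rule that[of "A * B * D"])
    fix n
    have "norm (gauss_coeff a b c n)
        = norm (pochhammer a n) * norm (pochhammer b n) * inverse (norm (pochhammer c n)) / fact n"
      by (simp add: norm_mult norm_divide divide_simps)
    also have "\<dots> \<le> (A * fact n * (real n + 1) powr (Re a - 1)) * (B * fact n * (real n + 1) powr (Re b - 1))
                  * (D * (real n + 1) powr (1 - Re c) / fact n) / fact n"
      using A B D by (intro divide_right_mono mult_mono) auto
    also have "\<dots> = A * B * D * ((real n + 1) powr (Re a - 1) * (real n + 1) powr (Re b - 1) * (real n + 1) powr (1 - Re c))"
      by simp
    also have "(real n + 1) powr (Re a - 1) * (real n + 1) powr (Re b - 1) * (real n + 1) powr (1 - Re c)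
                 = (real n + 1) powr (Re (a + b - c) - 1)"
      by (simp flip: powr_add add: algebra_simps)
    finally show "norm (gauss_coeff a b c n) \<le> A * B * D * (real n + 1) powr (Re (a + b - c) - 1)" .
  qed (use A B D in auto)
qed

lemma nonpos_Ints_add_of_nat_cancel:
  fixes z :: complex
  assumes "z \<notin> \<int>\<^sub>\<le>\<^sub>0" shows "z + of_nat n \<notin> \<int>\<^sub>\<le>\<^sub>0"
proof
  assume "z + of_nat n \<in> \<int>\<^sub>\<le>\<^sub>0"
  then obtain k where "z + of_nat n = - of_nat k" by (elim nonpos_Ints_cases')
  hence "z = - of_nat k - of_nat n" by (simp only: eq_diff_eq)
  hence "z = - of_nat (k + n)" by simp
  thus False using assms by (simp only: minus_of_nat_in_nonpos_Ints not_True_eq_False)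
qed

lemma Re_pos_not_nonpos_Int: "Re z > 0 \<Longrightarrow> z \<notin> \<int>\<^sub>\<le>\<^sub>0"
  by (auto elim!: nonpos_Ints_cases')

lemma rGamma_add_of_nat:
  fixes c :: complex
  assumes "c \<notin> \<int>\<^sub>\<le>\<^sub>0"
  shows "rGamma (c + of_nat n) = rGamma c / pochhammer c n"
proof -
  have "pochhammer c n \<noteq> 0" using assms pochhammer_eq_0_imp_nonpos_Int by blast
  thus ?thesis using pochhammer_rGamma[of c n] by (simp add: field_simps)
qed

text \<open>If \<open>c\<close> is not a pole of \<open>\<Gamma>\<close>, the bound is the one for \<open>1 / (c)\<^sub>n\<close>. The functional equation carries
  it from \<open>c + 1\<close> to \<open>c\<close>, and a pole becomes regular after finitely many such steps.\<close>
lemma rGamma_add_of_nat_bound_exists: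
  fixes c :: complex
  shows "\<exists>C>0. \<forall>n. norm (rGamma (c + of_nat n)) \<le> C * (real n + 1) powr (1 - Re c) / fact n"
proof -
  obtain N :: nat where N: "- Re c < real N"
    using reals_Archimedean2 by blast
  hence "c + of_nat N \<notin> \<int>\<^sub>\<le>\<^sub>0" by (intro Re_pos_not_nonpos_Int) auto
  thus ?thesis
  proof (induction N arbitrary: c)
    case 0
    then obtain D where D: "D > 0" "\<And>n. inverse (norm (pochhammer c n)) \<le> D * (real n + 1) powr (1 - Re c) / fact n"
      using pochhammer_lower_bound[of c] by auto
    have "norm (rGamma (c + of_nat n)) \<le> (norm (rGamma c) * D) * (real n + 1) powr (1 - Re c) / fact n" for n
      using mult_left_mono[OF D(2)[of n], of "norm (rGamma c)"] 0
      by (simp add: rGamma_add_of_nat norm_mult norm_inverse divide_inverse mult_ac)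
    moreover have "norm (rGamma c) * D > 0" using D 0 by (simp add: rGamma_eq_zero_iff)
    ultimately show ?case by blast
  next
    case (Suc N)
    have "(c + 1) + of_nat N \<notin> \<int>\<^sub>\<le>\<^sub>0" using Suc.prems by (simp add: add_ac)
    from Suc.IH[OF this] obtain C where C: "C > 0"
      "\<And>n. norm (rGamma (c + 1 + of_nat n)) \<le> C * (real n + 1) powr (1 - Re (c + 1)) / fact n"
      by blast
    have "norm (rGamma (c + of_nat n)) \<le> ((norm c + 1) * C) * (real n + 1) powr (1 - Re c) / fact n" for n
    proof -
      have "rGamma (c + of_nat n) = (c + of_nat n) * rGamma (c + 1 + of_nat n)"
        using rGamma_plus1[of "c + of_nat n"] by (simp add: add_ac)
      hence "norm (rGamma (c + of_nat n)) = norm (c + of_nat n) * norm (rGamma (c + 1 + of_nat n))"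
        by (simp add: norm_mult)
      also have "norm (c + of_nat n) \<le> norm c + real n"
        using norm_triangle_ineq[of c "of_nat n"] by simp
      also have "norm c + real n \<le> (norm c + 1) * (real n + 1)"
        by (simp add: algebra_simps)
      also have "(norm c + 1) * (real n + 1) * norm (rGamma (c + 1 + of_nat n)) \<le>
         (norm c + 1) * (real n + 1) * (C * (real n + 1) powr (1 - Re (c + 1)) / fact n)"
        by (intro mult_left_mono C) auto
      also have "\<dots> = ((norm c + 1) * C) * ((real n + 1) powr 1 * (real n + 1) powr (1 - Re (c + 1))) / fact n"
        by simp
      also have "(real n + 1) powr 1 * (real n + 1) powr (1 - Re (c + 1)) = (real n + 1) powr (1 - Re c)"
        by (subst powr_add [symmetric]) simp
      finally show ?thesis by (simp add: mult_right_mono)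
    qed
    moreover have "(norm c + 1) * C > 0" using C by (intro mult_pos_pos add_nonneg_pos) auto
    ultimately show ?case by blast
  qed
qed

section \<open>Gauss's summation theorem\<close>

text \<open>Gauss's series at 1 divided by \<open>\<Gamma>(c)\<close>. With \<open>1/\<Gamma>\<close> in place of the Pochhammer symbol in the
  denominator, \<open>c\<close> may be any complex number; the value of \<open>c\<close> at which the sum over \<open>m\<close> in \<open>F\<^sub>3\<close>
  needs it can be a nonpositive integer.\<close>
definition regularized_gauss_term :: "complex \<Rightarrow> complex \<Rightarrow> complex \<Rightarrow> nat \<Rightarrow> complex" where
  "regularized_gauss_term a b c n = pochhammer a n * pochhammer b n / fact n * rGamma (c + of_nat n)"

lemma regularized_gauss_term_bound:
  obtains C where "C > 0"
    "\<And>n. norm (regularized_gauss_term a b c n) \<le> C * (real n + 1) powr (Re (a + b - c) - 1)"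
proof -
  obtain A where A: "A > 0" "\<And>n. norm (pochhammer a n) \<le> A * fact n * (real n + 1) powr (Re a - 1)"
    using pochhammer_upper_bound[of a] by blast
  obtain B where B: "B > 0" "\<And>n. norm (pochhammer b n) \<le> B * fact n * (real n + 1) powr (Re b - 1)"
    using pochhammer_upper_bound[of b] by blast
  obtain D where D: "D > 0" "\<And>n. norm (rGamma (c + of_nat n)) \<le> D * (real n + 1) powr (1 - Re c) / fact n"
    using rGamma_add_of_nat_bound_exists[of c] by blast
  show ?thesis
  proof (rule that[of "A * B * D"])
    fix n
    have "norm (regularized_gauss_term a b c n)
        = norm (pochhammer a n) * norm (pochhammer b n) * norm (rGamma (c + of_nat n)) / fact n"
      by (simp add: regularized_gauss_term_def norm_mult norm_divide)
    also have "\<dots> \<le> (A * fact n * (real n + 1) powr (Re a - 1)) * (B * fact n * (real n + 1) powr (Re b - 1))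
                  * (D * (real n + 1) powr (1 - Re c) / fact n) / fact n"
      using A B D by (intro divide_right_mono mult_mono) auto
    also have "\<dots> = A * B * D * ((real n + 1) powr (Re a - 1) * (real n + 1) powr (Re b - 1) * (real n + 1) powr (1 - Re c))"
      by simp
    also have "(real n + 1) powr (Re a - 1) * (real n + 1) powr (Re b - 1) * (real n + 1) powr (1 - Re c)
                 = (real n + 1) powr (Re (a + b - c) - 1)"
      by (simp flip: powr_add add: algebra_simps)
    finally show "norm (regularized_gauss_term a b c n) \<le> A * B * D * (real n + 1) powr (Re (a + b - c) - 1)" .
  qed (use A B D in auto)
qed

lemma summable_norm_regularized_gauss_term:
  assumes "Re (c - a - b) > 0"
  shows "summable (\<lambda>n. norm (regularized_gauss_term a b c n))"
proof -
  obtain C where C: "C > 0"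
    "\<And>n. norm (regularized_gauss_term a b c n) \<le> C * (real n + 1) powr (Re (a + b - c) - 1)"
    using regularized_gauss_term_bound by blast
  have "summable (\<lambda>n. C * (real n + 1) powr (Re (a + b - c) - 1))"
    using assms by (intro summable_mult summable_Suc_powr) auto
  thus ?thesis by (rule summable_comparison_test[rotated]) (use C in auto)
qed

text \<open>The difference of the two sides telescopes: with \<open>v\<^sub>n = n t\<^sub>n\<close>, where \<open>t\<^sub>n\<close> is the \<open>n\<close>-th term at \<open>c\<close>,
  it is \<open>\<Sum> (v\<^sub>n - v\<^sub>n\<^sub>+\<^sub>1)\<close>, and \<open>v\<close> tends to 0 because \<open>Re (c - a - b)\<close> is positive.\<close>
lemma regularized_gauss_contiguous:
  assumes "Re (c - a - b) > 0"
  shows "(c - a - b) * (\<Sum>n. regularized_gauss_term a b c n) =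
         (c - a) * (c - b) * (\<Sum>n. regularized_gauss_term a b (c + 1) n)"
proof -
  let ?t = "regularized_gauss_term a b"
  define v where "v n = of_nat n * ?t c n" for n
  have tel: "v n - v (Suc n) = (c - a - b) * ?t c n - (c - a) * (c - b) * ?t (c + 1) n" for n
  proof -
    have r: "rGamma (c + of_nat n) = (c + of_nat n) * rGamma (c + 1 + of_nat n)"
      using rGamma_plus1[of "c + of_nat n"] by (simp add: add_ac)
    have r': "rGamma (c + of_nat (Suc n)) = rGamma (c + 1 + of_nat n)"
      by (simp add: add_ac)
    have v1: "v (Suc n) = (a + of_nat n) * (b + of_nat n) * ?t (c + 1) n"
      unfolding v_def regularized_gauss_term_def r'
      by (simp add: pochhammer_Suc fact_Suc mult_ac del: of_nat_Suc)
    have v0: "?t c n = (c + of_nat n) * ?t (c + 1) n"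
      by (simp add: regularized_gauss_term_def r)
    have vn: "v n = of_nat n * ((c + of_nat n) * ?t (c + 1) n)" by (simp only: v_def v0)
    show ?thesis unfolding v1 vn v0 by algebra
  qed
  have v0: "v \<longlonglongrightarrow> 0"
  proof -
    obtain C where C: "C > 0"
      "\<And>n. norm (?t c n) \<le> C * (real n + 1) powr (Re (a + b - c) - 1)"
      using regularized_gauss_term_bound by blast
    have "norm (v n) \<le> C * (real n + 1) powr (Re (a + b - c))" for n
    proof -
      have "norm (v n) = real n * norm (?t c n)" by (simp add: v_def norm_mult)
      also have "\<dots> \<le> (real n + 1) * (C * (real n + 1) powr (Re (a + b - c) - 1))"
        using C by (intro mult_mono) auto
      also have "\<dots> = C * (real n + 1) powr (Re (a + b - c))"
        by (simp add: powr_diff)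
      finally show ?thesis .
    qed
    moreover have "(\<lambda>n. C * (real n + 1) powr (Re (a + b - c))) \<longlonglongrightarrow> 0"
    proof -
      define s where "s = Re (a + b - c)"
      have "s < 0" using assms by (simp add: s_def)
      thus ?thesis unfolding s_def [symmetric] by real_asymp
    qed
    ultimately show ?thesis by (rule Lim_null_comparison[OF always_eventually[OF allI]])
  qed
  have "(\<lambda>n. v n - v (Suc n)) sums (v 0 - 0)"
    using v0 by (rule telescope_sums')
  moreover have "(\<lambda>n. v n - v (Suc n)) sums ((c - a - b) * (\<Sum>n. ?t c n) - (c - a) * (c - b) * (\<Sum>n. ?t (c + 1) n))"
    unfolding tel using assms
    by (intro sums_diff sums_mult summable_sums
          summable_norm_cancel[OF summable_norm_regularized_gauss_term]) auto
  ultimately have "(c - a - b) * (\<Sum>n. ?t c n) - (c - a) * (c - b) * (\<Sum>n. ?t (c + 1) n) = v 0 - 0"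
    by (rule sums_unique2[rotated])
  thus ?thesis by (simp add: v_def)
qed

lemma regularized_gauss_shift:
  assumes "Re (c - a - b) > 0"
  shows "pochhammer (c - a - b) N * (\<Sum>n. regularized_gauss_term a b c n) =
         pochhammer (c - a) N * pochhammer (c - b) N * (\<Sum>n. regularized_gauss_term a b (c + of_nat N) n)"
proof (induction N)
  case (Suc N)
  let ?R = "\<lambda>c. (\<Sum>n. regularized_gauss_term a b c n)"
  have c: "(c + of_nat N - a - b) * ?R (c + of_nat N)
        = (c + of_nat N - a) * (c + of_nat N - b) * ?R (c + of_nat N + 1)"
    by (rule regularized_gauss_contiguous) (use assms in auto)
  have "pochhammer (c - a - b) (Suc N) * ?R c = (c + of_nat N - a - b) * (pochhammer (c - a - b) N * ?R c)"
    by (simp add: pochhammer_Suc algebra_simps)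
  also have "\<dots> = pochhammer (c - a) N * pochhammer (c - b) N * ((c + of_nat N - a - b) * ?R (c + of_nat N))"
    unfolding Suc.IH by (simp add: mult_ac)
  also have "\<dots> = pochhammer (c - a) (Suc N) * pochhammer (c - b) (Suc N) * ?R (c + of_nat (Suc N))"
    unfolding c by (simp add: pochhammer_Suc algebra_simps)
  finally show ?case .
qed auto

lemma norm_pochhammer_ge_pochhammer_Re:
  assumes "Re c > 0" "Re c \<le> Re z"
  shows "pochhammer (Re c) n \<le> norm (pochhammer z n)"
proof -
  have "(\<Prod>i<n. Re c + real i) \<le> (\<Prod>i<n. norm (z + of_nat i))"
  proof (intro prod_mono conjI)
    fix i
    show "Re c + real i \<le> norm (z + of_nat i)"
      using complex_Re_le_cmod[of "z + of_nat i"] assms by simp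
  qed (use assms in auto)
  thus ?thesis by (simp add: pochhammer_prod prod_norm atLeast0LessThan)
qed

text \<open>All terms but the first vanish in the limit, and the terms are dominated by those of the
  convergent series with lower parameter \<open>Re c\<close>.\<close>
lemma gauss_coeff_sum_limit:
  assumes "Re c > 0" "Re (c - a - b) > 0"
  shows "(\<lambda>N. \<Sum>n. gauss_coeff a b (c + of_nat N) n) \<longlonglongrightarrow> 1"
proof -
  (* The dominating series in Tannery's theorem. *)
  define M where "M n = norm (gauss_coeff a b (of_real (Re c)) n)" for n
  have cr: "complex_of_real (Re c) \<notin> \<int>\<^sub>\<le>\<^sub>0" using assms by (intro Re_pos_not_nonpos_Int) auto
  obtain C where C: "C > 0" "\<And>n. M n \<le> C * (real n + 1) powr (Re (a + b - of_real (Re c)) - 1)"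
    using gauss_coeff_bound[OF cr] unfolding M_def by blast
  have "summable (\<lambda>n. C * (real n + 1) powr (Re (a + b - of_real (Re c)) - 1))"
    using assms by (intro summable_mult summable_Suc_powr) auto
  hence M: "summable M"
    by (rule summable_comparison_test[rotated]) (use C in \<open>auto simp: M_def\<close>)
  have bound: "norm (gauss_coeff a b (c + of_nat N) n) \<le> M n" for n N
  proof -
    have p: "pochhammer (Re c) n \<le> norm (pochhammer (c + of_nat N) n)"
      by (rule norm_pochhammer_ge_pochhammer_Re) (use assms in auto)
    have p0: "pochhammer (Re c) n > 0" using assms by (intro pochhammer_pos) auto
    have "norm (pochhammer (complex_of_real (Re c)) n) = pochhammer (Re c) n"
      using p0 by (simp add: pochhammer_of_real)
    thus ?thesis using p p0
      by (simp add: M_def norm_mult norm_divide frac_le)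
  qed
  have lim: "(\<lambda>N. gauss_coeff a b (c + of_nat N) n) \<longlonglongrightarrow> (if n = 0 then 1 else 0)" for n
  proof (cases n)
    case (Suc k)
    have "filterlim (\<lambda>N. pochhammer (c + of_nat N) n * fact n) at_infinity sequentially"
    proof -
      have ge: "real N \<le> norm (pochhammer (c + of_nat N) n * fact n)" if N: "N \<ge> 1" for N
      proof -
        have "pochhammer (Re (of_nat N)) n \<le> norm (pochhammer (c + of_nat N) n)"
          by (rule norm_pochhammer_ge_pochhammer_Re) (use assms N in auto)
        moreover have "real N * 1 \<le> pochhammer (real N) n"
        proof -
          have "(1::real) \<le> (\<Prod>i=0..<k. real N + 1 + real i)"
            using N by (intro prod_ge_1) auto
          thus ?thesis unfolding Suc pochhammer_rec
            by (intro mult_left_mono) (auto simp: pochhammer_prod)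
        qed
        moreover have "norm (pochhammer (c + of_nat N) n) * 1 \<le> norm (pochhammer (c + of_nat N) n) * fact n"
          by (intro mult_left_mono) (auto simp: fact_ge_1)
        ultimately show ?thesis by (simp add: norm_mult)
      qed
      have "filterlim (\<lambda>N. norm (pochhammer (c + of_nat N) n * fact n)) at_top sequentially"
        by (rule filterlim_at_top_mono[OF filterlim_real_sequentially
              eventually_mono[OF eventually_ge_at_top[of 1]]]) (rule ge)
      thus ?thesis by (subst filterlim_at_infinity_conv_norm_at_top)
    qed
    hence "(\<lambda>N. pochhammer a n * pochhammer b n / (pochhammer (c + of_nat N) n * fact n)) \<longlonglongrightarrow> 0"
      by (intro tendsto_divide_0[OF tendsto_const])
    thus ?thesis using Suc by simp
  qed auto
  have "(\<lambda>N. \<Sum>n. gauss_coeff a b (c + of_nat N) n) \<longlonglongrightarrow> (\<Sum>n. if n = 0 then 1 else 0)"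
    by (rule tannerys_theorem[OF lim always_eventually M, THEN conjunct2, THEN conjunct2])
       (auto simp del: norm_divide simp: bound split: prod.split)
  also have "(\<Sum>n. if n = (0::nat) then 1 else 0 :: complex) = 1"
    using suminf_finite[of "{0}" "\<lambda>n. if n = (0::nat) then 1 else 0 :: complex"] by auto
  finally show ?thesis .
qed

text \<open>Under the balance condition \<open>u + v = w + z\<close> the powers of \<open>N\<close> in the limit formula for \<open>1/\<Gamma>\<close>
  cancel.\<close>
lemma pochhammer_ratio_limit:
  fixes u v w z :: complex
  assumes "u + v = w + z" "w \<notin> \<int>\<^sub>\<le>\<^sub>0" "z \<notin> \<int>\<^sub>\<le>\<^sub>0"
  shows "(\<lambda>N. pochhammer u (Suc N) * pochhammer v (Suc N) / (pochhammer w (Suc N) * pochhammer z (Suc N)))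
           \<longlonglongrightarrow> rGamma u * rGamma v / (rGamma w * rGamma z)"
proof -
  have "(\<lambda>N. rGamma_series u N * rGamma_series v N / (rGamma_series w N * rGamma_series z N))
           \<longlonglongrightarrow> rGamma u * rGamma v / (rGamma w * rGamma z)"
    using assms by (intro tendsto_intros) (auto simp: rGamma_eq_zero_iff)
  moreover have "rGamma_series u N * rGamma_series v N / (rGamma_series w N * rGamma_series z N) =
      pochhammer u (Suc N) * pochhammer v (Suc N) / (pochhammer w (Suc N) * pochhammer z (Suc N))" for N
  proof -
    let ?E = "\<lambda>z. exp (z * of_real (ln (real N))) :: complex"
    have e: "?E u * ?E v = ?E w * ?E z"
      by (simp only: exp_add [symmetric] distrib_right [symmetric] assms(1))
    have "rGamma_series u N * rGamma_series v N / (rGamma_series w N * rGamma_series z N)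
        = (pochhammer u (Suc N) * pochhammer v (Suc N) / (pochhammer w (Suc N) * pochhammer z (Suc N))) *
          ((?E w * ?E z) / (?E u * ?E v))"
      by (simp add: rGamma_series_def divide_simps)
    thus ?thesis unfolding e by simp
  qed
  ultimately show ?thesis by simp
qed

text \<open>The contiguous relation replaces \<open>c\<close> by \<open>c + N\<close> at the price of a quotient of Pochhammer symbols.
  As \<open>N\<close> grows, the series tends to its first term and the quotient to the Gamma factors. The limit
  is taken for \<open>Re c > 0\<close> only; the contiguous relation carries the result to all \<open>c\<close>.\<close>
theorem regularized_gauss_sum:
  assumes "Re (c - a - b) > 0"
  shows "regularized_gauss_term a b c sums (Gamma (c - a - b) * rGamma (c - a) * rGamma (c - b))"
proof -
  let ?R = "\<lambda>c. (\<Sum>n. regularized_gauss_term a b c n)"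
  have main: "?R c = Gamma (c - a - b) * rGamma (c - a) * rGamma (c - b)"
    if c: "Re c > 0" "Re (c - a - b) > 0" for c
  proof -
    have cn: "c \<notin> \<int>\<^sub>\<le>\<^sub>0" and cabn: "c - a - b \<notin> \<int>\<^sub>\<le>\<^sub>0"
      using c by (auto intro!: Re_pos_not_nonpos_Int simp del: minus_complex.sel)
    have R: "?R (c + of_nat N) = rGamma c / pochhammer c N * (\<Sum>n. gauss_coeff a b (c + of_nat N) n)" for N
    proof -
      have cN: "c + of_nat N \<notin> \<int>\<^sub>\<le>\<^sub>0" using cn by (rule nonpos_Ints_add_of_nat_cancel)
      have t: "regularized_gauss_term a b (c + of_nat N) = (\<lambda>n. rGamma (c + of_nat N) * gauss_coeff a b (c + of_nat N) n)"
        by (rule ext) (simp add: regularized_gauss_term_def rGamma_add_of_nat[OF cN] mult_ac)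
      moreover have "summable (gauss_coeff a b (c + of_nat N))"
      proof -
        have "rGamma (c + of_nat N) \<noteq> 0" using cN by (simp add: rGamma_eq_zero_iff)
        moreover have "summable (regularized_gauss_term a b (c + of_nat N))"
          by (rule summable_norm_cancel[OF summable_norm_regularized_gauss_term]) (use c in auto)
        ultimately show ?thesis unfolding t by (simp only: summable_cmult_iff if_False) simp
      qed
      ultimately show ?thesis unfolding t by (simp only: suminf_mult rGamma_add_of_nat[OF cn])
    qed
    define q where "q N = pochhammer (c - a) N * pochhammer (c - b) N / (pochhammer (c - a - b) N * pochhammer c N)" for N
    have Rq: "?R c = rGamma c * q N * (\<Sum>n. gauss_coeff a b (c + of_nat N) n)" for N
    proof -
      have nz: "pochhammer (c - a - b) N \<noteq> 0" "pochhammer c N \<noteq> 0"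
        using cabn cn pochhammer_eq_0_imp_nonpos_Int by blast+
      show ?thesis using regularized_gauss_shift[OF c(2), of N] nz unfolding R q_def
        by (simp add: field_simps)
    qed
    have eq: "(\<lambda>N. rGamma c * q (Suc N) * (\<Sum>n. gauss_coeff a b (c + of_nat (Suc N)) n)) = (\<lambda>_. ?R c)"
      by (rule ext, rule Rq [symmetric])
    have "(\<lambda>N. rGamma c * q (Suc N) * (\<Sum>n. gauss_coeff a b (c + of_nat (Suc N)) n)) \<longlonglongrightarrow>
      rGamma c * (rGamma (c - a) * rGamma (c - b) / (rGamma (c - a - b) * rGamma c)) * 1"
      unfolding q_def using c cn cabn
      by (intro tendsto_intros pochhammer_ratio_limit LIMSEQ_Suc[OF gauss_coeff_sum_limit]) auto
    hence "?R c = rGamma c * (rGamma (c - a) * rGamma (c - b) / (rGamma (c - a - b) * rGamma c)) * 1"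
      unfolding eq by (simp add: tendsto_const_iff)
    thus ?thesis using cn cabn by (simp add: rGamma_eq_zero_iff Gamma_def field_simps)
  qed
  obtain N :: nat where N: "- Re c < real N"
    using reals_Archimedean2 by blast
  have nz: "pochhammer (c - a - b) N \<noteq> 0" "c - a - b \<notin> \<int>\<^sub>\<le>\<^sub>0"
    using assms Re_pos_not_nonpos_Int pochhammer_eq_0_imp_nonpos_Int by blast+
  have "pochhammer (c - a - b) N * ?R c =
          pochhammer (c - a) N * pochhammer (c - b) N * ?R (c + of_nat N)"
    by (rule regularized_gauss_shift[OF assms])
  also have "?R (c + of_nat N) = Gamma (c + of_nat N - a - b) * rGamma (c + of_nat N - a) * rGamma (c + of_nat N - b)"
    by (rule main) (use N assms in auto)
  also have "pochhammer (c - a) N * pochhammer (c - b) N * \<dots> =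
     Gamma (c - a - b + of_nat N) * (pochhammer (c - a) N * rGamma (c - a + of_nat N)) *
      (pochhammer (c - b) N * rGamma (c - b + of_nat N))"
    by (simp add: algebra_simps)
  also have "\<dots> = pochhammer (c - a - b) N * (Gamma (c - a - b) * rGamma (c - a) * rGamma (c - b))"
    using nz by (simp flip: pochhammer_rGamma) (simp add: pochhammer_Gamma Gamma_eq_zero_iff)
  finally have "?R c = Gamma (c - a - b) * rGamma (c - a) * rGamma (c - b)"
    using nz by simp
  thus ?thesis
    using summable_norm_cancel[OF summable_norm_regularized_gauss_term[OF assms]] by (simp add: sums_iff)
qed

section \<open>Beta integrals with complex exponents\<close>

lemma Gamma_integral_scaled:
  assumes "Re z > 0" "r > 0"
  shows "has_bochner_integral lborel
           (\<lambda>u. indicator {0<..} u *\<^sub>R (of_real u powr (z - 1) * of_real (exp (- (r * u)))))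
           (Gamma z * of_real r powr (- z))"
proof -
  let ?g = "\<lambda>u. indicator {0<..} u *\<^sub>R (complex_of_real u powr (z - 1) / of_real (exp u))"
  have m: "?g \<in> borel_measurable borel" by measurable
  have "integrable lebesgue ?g"
    using absolutely_integrable_Gamma_integral'[OF assms(1)] by (simp add: set_integrable_def)
  hence i: "integrable lborel ?g" using m by (simp add: integrable_completion)
  have "(LINT u|lborel. ?g u) = Gamma z"
  proof -
    have "(?g has_integral (LINT u|lborel. ?g u)) UNIV"
      using i by (rule has_integral_integral_lborel)
    moreover have "(?g has_integral Gamma z) UNIV"
    proof -
      have "((\<lambda>u. if u \<in> {0<..} then complex_of_real u powr (z - 1) / of_real (exp u) else 0) has_integral Gamma z) UNIV"
        using Gamma_integral_complex'[OF assms(1)] by (simp only: has_integral_restrict_UNIV)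
      also have "(\<lambda>u. if u \<in> {0<..} then complex_of_real u powr (z - 1) / of_real (exp u) else 0) = ?g"
        by (auto simp: fun_eq_iff)
      finally show ?thesis .
    qed
    ultimately show ?thesis by (rule has_integral_unique)
  qed
  with i have "has_bochner_integral lborel ?g (Gamma z)"
    by (simp add: has_bochner_integral_iff)
  hence "has_bochner_integral lborel (\<lambda>u. ?g (0 + r * u)) (Gamma z /\<^sub>R \<bar>r\<bar>)"
    using assms by (subst (asm) lborel_has_bochner_integral_real_affine_iff[of r _ _ 0]) auto
  hence "has_bochner_integral lborel (\<lambda>u. of_real r powr (1 - z) * ?g (0 + r * u)) (of_real r powr (1 - z) * (Gamma z /\<^sub>R \<bar>r\<bar>))"
    by (rule has_bochner_integral_mult_right)
  also have "(\<lambda>u. of_real r powr (1 - z) * ?g (0 + r * u)) =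
      (\<lambda>u. indicator {0<..} u *\<^sub>R (of_real u powr (z - 1) * of_real (exp (- (r * u)))))"
  proof (rule ext)
    fix u :: real
    show "of_real r powr (1 - z) * ?g (0 + r * u) =
       indicator {0<..} u *\<^sub>R (of_real u powr (z - 1) * of_real (exp (- (r * u))))"
    proof (cases "u > 0")
      case True
      have "complex_of_real (r * u) powr (z - 1) = of_real r powr (z - 1) * of_real u powr (z - 1)"
        using True assms by (simp add: powr_times_real)
      moreover have "complex_of_real r powr (1 - z) * of_real r powr (z - 1) = 1"
        using assms by (simp flip: powr_add)
      ultimately show ?thesis using True assms
        by (simp add: exp_minus field_simps del: of_real_mult)
    next
      case False
      thus ?thesis using assms by (auto simp: zero_less_mult_iff)
    qed
  qed
  also have "of_real r powr (1 - z) * (Gamma z /\<^sub>R \<bar>r\<bar>) = Gamma z * of_real r powr (- z)"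
  proof -
    have "complex_of_real r powr (1 - z) = of_real r * of_real r powr (- z)"
      using assms powr_add[of "complex_of_real r" 1 "-z"] by simp
    thus ?thesis using assms by (simp add: scaleR_conv_of_real field_simps)
  qed
  finally show ?thesis .
qed

lemma Gamma_integral_scaled_translated:
  assumes "Re z > 0" "r > 0"
  shows "has_bochner_integral lborel
           (\<lambda>t. indicator {x<..} t *\<^sub>R (of_real (t - x) powr (z - 1) * of_real (exp (- (r * t)))))
           (of_real (exp (- (r * x))) * Gamma z * of_real r powr (- z))"
proof -
  let ?h = "\<lambda>u. indicator {0<..} u *\<^sub>R (of_real u powr (z - 1) * complex_of_real (exp (- (r * u))))"
  have "has_bochner_integral lborel (\<lambda>t. ?h (- x + 1 * t)) ((Gamma z * of_real r powr (- z)) /\<^sub>R \<bar>1\<bar>)"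
    by (subst lborel_has_bochner_integral_real_affine_iff[of 1 _ _ "-x", symmetric])
       (use Gamma_integral_scaled[OF assms] in auto)
  hence "has_bochner_integral lborel (\<lambda>t. of_real (exp (- (r * x))) * ?h (- x + 1 * t))
     (of_real (exp (- (r * x))) * (Gamma z * of_real r powr (- z) /\<^sub>R \<bar>1\<bar>))"
    by (rule has_bochner_integral_mult_right)
  also have "(\<lambda>t. of_real (exp (- (r * x))) * ?h (- x + 1 * t)) =
      (\<lambda>t. indicator {x<..} t *\<^sub>R (of_real (t - x) powr (z - 1) * of_real (exp (- (r * t)))))"
  proof (rule ext)
    fix t :: real
    have "exp (- (r * x)) * exp (- (r * (t - x))) = exp (- (r * t))"
      by (subst exp_add [symmetric]) (simp add: algebra_simps)
    hence "complex_of_real (exp (- (r * x))) * of_real (exp (- (r * (t - x)))) = of_real (exp (- (r * t)))"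
      by (simp flip: of_real_mult)
    thus "of_real (exp (- (r * x))) * ?h (- x + 1 * t) =
      indicator {x<..} t *\<^sub>R (of_real (t - x) powr (z - 1) * of_real (exp (- (r * t))))"
      by (cases "t > x") (simp_all add: mult_ac)
  qed
  finally show ?thesis by (simp add: mult_ac)
qed

text \<open>Insert \<open>\<Gamma>(a + b) t^(- a - b) = \<integral> y^(a + b - 1) exp (- t y) dy\<close> and interchange the integrals: the
  integral over \<open>t\<close> is then a translated Gamma integral, and so is the remaining one over \<open>y\<close>.\<close>
lemma Beta_integral_ray:
  assumes "Re a > 0" "Re b > 0" "x > 0"
  shows "has_bochner_integral lborel
           (\<lambda>t. indicator {x<..} t *\<^sub>R (of_real (t - x) powr (a - 1) * of_real t powr (- a - b)))
           (of_real x powr (- b) * (Gamma a * Gamma b * rGamma (a + b)))"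
proof -
  define h where "h y t = indicator {0<..} y *\<^sub>R (indicator {x<..} t *\<^sub>R
      (of_real y powr (a + b - 1) * (of_real (t - x) powr (a - 1) * complex_of_real (exp (- (y * t))))))" for y t :: real
  have inner_t: "has_bochner_integral lborel (\<lambda>t. h y t)
     (indicator {0<..} y *\<^sub>R (Gamma a * (of_real y powr (b - 1) * of_real (exp (- (x * y))))))" for y
  proof (cases "y > 0")
    case True
    have "complex_of_real y powr (a + b - 1) * of_real y powr (- a) = of_real y powr (b - 1)"
      by (simp flip: powr_add)
    hence e: "indicator {0<..} y *\<^sub>R (Gamma a * (of_real y powr (b - 1) * of_real (exp (- (x * y))))) =
       of_real y powr (a + b - 1) * (complex_of_real (exp (- (y * x))) * Gamma a * of_real y powr (- a))"
      using True by (simp add: mult_ac)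
    have "has_bochner_integral lborel (\<lambda>t. of_real y powr (a + b - 1) * (indicator {x<..} t *\<^sub>R
            (of_real (t - x) powr (a - 1) * complex_of_real (exp (- (y * t))))))
        (of_real y powr (a + b - 1) * (complex_of_real (exp (- (y * x))) * Gamma a * of_real y powr (- a)))"
      by (intro has_bochner_integral_mult_right Gamma_integral_scaled_translated assms True)
    thus ?thesis unfolding e using True by (simp add: h_def mult_ac)
  qed (simp add: h_def has_bochner_integral_zero)
  have inner_y: "has_bochner_integral lborel (\<lambda>y. h y t)
     (Gamma (a + b) * (indicator {x<..} t *\<^sub>R (of_real (t - x) powr (a - 1) * of_real t powr (- a - b))))" for t
  proof (cases "t > x")
    case True
    hence "t > 0" using assms by simp
    have "has_bochner_integral lborel (\<lambda>y. of_real (t - x) powr (a - 1) * (indicator {0<..} y *\<^sub>R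
            (of_real y powr (a + b - 1) * complex_of_real (exp (- (t * y))))))
        (of_real (t - x) powr (a - 1) * (Gamma (a + b) * of_real t powr (- (a + b))))"
      by (intro has_bochner_integral_mult_right Gamma_integral_scaled) (use assms \<open>t > 0\<close> in auto)
    thus ?thesis using True by (simp add: h_def mult_ac)
  qed (simp add: h_def has_bochner_integral_zero)
  have hm: "(\<lambda>p. h (fst p) (snd p)) \<in> borel_measurable (lborel \<Otimes>\<^sub>M lborel)"
    unfolding h_def by measurable
  have norm_t: "has_bochner_integral lborel (\<lambda>t. norm (h y t))
     (indicator {0<..} y *\<^sub>R (Gamma (Re a) * (y powr (Re b - 1) * exp (- (x * y)))))" for y
  proof (cases "y > 0")
    case True
    have "has_bochner_integral lborel (\<lambda>t. y powr Re (a + b - 1) * Re (indicator {x<..} t *\<^sub>R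
            (of_real (t - x) powr (of_real (Re a) - 1) * complex_of_real (exp (- (y * t))))))
        (y powr Re (a + b - 1) * Re (complex_of_real (exp (- (y * x))) * Gamma (of_real (Re a)) * of_real y powr (- of_real (Re a))))"
      by (intro has_bochner_integral_mult_right has_bochner_integral_Re Gamma_integral_scaled_translated)
         (use assms True in auto)
    also have "(\<lambda>t. y powr Re (a + b - 1) * Re (indicator {x<..} t *\<^sub>R
            (of_real (t - x) powr (of_real (Re a) - 1) * complex_of_real (exp (- (y * t)))))) = (\<lambda>t. norm (h y t))"
    proof (rule ext)
      fix t
      show "y powr Re (a + b - 1) * Re (indicator {x<..} t *\<^sub>R
            (of_real (t - x) powr (of_real (Re a) - 1) * complex_of_real (exp (- (y * t))))) = norm (h y t)"
      proof (cases "t > x")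
        case t: True
        have "complex_of_real (t - x) powr (of_real (Re a) - 1) = of_real ((t - x) powr (Re a - 1))"
          using t powr_of_real[of "t - x" "Re a - 1"] by simp
        thus ?thesis using t True
          by (simp add: h_def norm_mult norm_powr_real_powr del: of_real_diff)
      qed (simp add: h_def)
    qed
    also have "y powr Re (a + b - 1) * Re (complex_of_real (exp (- (y * x))) * Gamma (of_real (Re a)) * of_real y powr (- of_real (Re a)))
       = indicator {0<..} y *\<^sub>R (Gamma (Re a) * (y powr (Re b - 1) * exp (- (x * y))))"
    proof -
      have "complex_of_real y powr (- of_real (Re a)) = of_real (y powr (- Re a))"
        using True powr_of_real[of y "- Re a"] by simp
      moreover have "y powr Re (a + b - 1) * y powr (- Re a) = y powr (Re b - 1)"
        by (simp flip: powr_add)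
      ultimately show ?thesis using True by (simp add: Gamma_complex_of_real mult_ac)
    qed
    finally show ?thesis .
  qed (simp add: h_def has_bochner_integral_zero)
  have "integrable lborel (\<lambda>y. Re (Gamma (Re a) *\<^sub>R (indicator {0<..} y *\<^sub>R
           (of_real y powr (of_real (Re b) - 1) * complex_of_real (exp (- (x * y)))))))"
    using Gamma_integral_scaled[of "of_real (Re b)" x] assms
    by (intro integrable_Re integrable_scaleR_right) (auto simp: has_bochner_integral_iff)
  also have "(\<lambda>y. Re (Gamma (Re a) *\<^sub>R (indicator {0<..} y *\<^sub>R
           (of_real y powr (of_real (Re b) - 1) * complex_of_real (exp (- (x * y))))))) =
        (\<lambda>y. LINT t|lborel. norm (h y t))"
  proof (rule ext)
    fix y
    have "complex_of_real y powr (of_real (Re b) - 1) = of_real (y powr (Re b - 1))" if "y > 0"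
      using that powr_of_real[of y "Re b - 1"] by simp
    thus "Re (Gamma (Re a) *\<^sub>R (indicator {0<..} y *\<^sub>R
           (of_real y powr (of_real (Re b) - 1) * complex_of_real (exp (- (x * y)))))) =
           (LINT t|lborel. norm (h y t))"
      unfolding has_bochner_integral_integral_eq[OF norm_t] by (cases "y > 0") simp_all
  qed
  finally have int: "integrable (lborel \<Otimes>\<^sub>M lborel) (\<lambda>p. h (fst p) (snd p))"
    using hm inner_t by (intro lborel_pair.Fubini_integrable) (auto simp: has_bochner_integral_iff)
  hence int': "integrable (lborel \<Otimes>\<^sub>M lborel) (case_prod h)"
    by (simp add: case_prod_beta')
  define k where "k t = indicator {x<..} t *\<^sub>R (of_real (t - x) powr (a - 1) * complex_of_real t powr (- a - b))" for t
  have G0: "Gamma (a + b) \<noteq> 0"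
    using assms by (simp add: Gamma_eq_zero_iff Re_pos_not_nonpos_Int)
  have ky: "Gamma (a + b) * k t = (LINT y|lborel. h y t)" for t
    using has_bochner_integral_integral_eq[OF inner_y[of t]] by (simp add: k_def)
  have "integrable lborel (\<lambda>t. Gamma (a + b) * k t)"
    unfolding ky using lborel_pair.integrable_snd[OF int'] by simp
  hence "integrable lborel (\<lambda>t. inverse (Gamma (a + b)) * (Gamma (a + b) * k t))"
    by (rule integrable_mult_right)
  hence ik: "integrable lborel k" using G0 by (simp flip: mult.assoc)
  have "Gamma (a + b) * (LINT t|lborel. k t) = (LINT t|lborel. (LINT y|lborel. h y t))"
    unfolding ky [symmetric] by simp
  also have "\<dots> = (LINT y|lborel. (LINT t|lborel. h y t))"
    by (rule lborel_pair.Fubini_integral[OF int'])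
  also have "\<dots> = (LINT y|lborel. Gamma a * (indicator {0<..} y *\<^sub>R (of_real y powr (b - 1) * of_real (exp (- (x * y))))))"
    by (intro Bochner_Integration.integral_cong refl)
       (simp add: has_bochner_integral_integral_eq[OF inner_t] del: of_real_exp)
  also have "\<dots> = Gamma a * (Gamma b * of_real x powr (- b))"
    using has_bochner_integral_mult_right[OF Gamma_integral_scaled[of b x], of "Gamma a"] assms
    by (intro has_bochner_integral_integral_eq) auto
  finally have "(LINT t|lborel. k t) = of_real x powr (- b) * (Gamma a * Gamma b * rGamma (a + b))"
    using G0 by (simp add: rGamma_inverse_Gamma field_simps)
  with ik show ?thesis by (simp add: has_bochner_integral_iff k_def [abs_def])
qed

lemma Beta_integral_complex_integrable:
  assumes "Re p > 0" "Re q > 0"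
  shows "set_integrable lborel {0..1} (\<lambda>u. of_real u powr (p - 1) * complex_of_real (1 - u) powr (q - 1))"
  unfolding set_integrable_def
proof (rule integrable_norm_cancel)
  have "integrable lborel (\<lambda>u. indicator {0..1} u *\<^sub>R (u powr (Re p - 1) * (1 - u) powr (Re q - 1)))"
    using integrable_Beta[of "Re p" "Re q"] assms by (simp add: set_integrable_def)
  also have "(\<lambda>u. indicator {0..1} u *\<^sub>R (u powr (Re p - 1) * (1 - u) powr (Re q - 1))) =
     (\<lambda>u. norm (indicator {0..1} u *\<^sub>R (of_real u powr (p - 1) * complex_of_real (1 - u) powr (q - 1))))"
    by (auto simp: fun_eq_iff norm_mult norm_powr_real_powr indicator_def simp del: of_real_diff)
  finally show "integrable lborel \<dots>" .
qed measurable

text \<open>This is the integral over the ray from 1 under the substitution \<open>u = 1 - 1/t\<close>.\<close>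
lemma Beta_integral_complex:
  assumes "Re p > 0" "Re q > 0"
  shows "integral {0..1} (\<lambda>u. of_real u powr (p - 1) * complex_of_real (1 - u) powr (q - 1)) =
           Gamma p * Gamma q * rGamma (p + q)"
proof -
  define f where "f u = of_real u powr (p - 1) * complex_of_real (1 - u) powr (q - 1)" for u
  (* The substitution, with derivative g'; the transformed integrand h is that of the ray. *)
  define g where "g t = 1 - 1 / t" for t :: real
  define g' where "g' t = 1 / t ^ 2" for t :: real
  define h where "h t = of_real (t - 1) powr (p - 1) * complex_of_real t powr (- p - q)" for t
  have fint: "set_integrable lborel {0..1} f"
    using Beta_integral_complex_integrable[OF assms] by (simp add: f_def [abs_def])
  have gf: "g' t *\<^sub>R f (g t) = h t" if "t > 1" for t
  proof -
    have "complex_of_real (1 - 1 / t) = of_real (t - 1) * of_real (1 / t)"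
      using that by (simp add: field_simps)
    hence e1: "complex_of_real (1 - 1 / t) powr (p - 1) = of_real (t - 1) powr (p - 1) * of_real (1 / t) powr (p - 1)"
      using that by (simp add: powr_times_real del: of_real_diff of_real_divide)
    have e2: "complex_of_real (1 / t) powr z = of_real t powr (- z)" for z
      using that by (simp add: powr_def Ln_of_real ln_div del: of_real_divide)
    have e3: "complex_of_real t powr (-2) = of_real (1 / t ^ 2)"
      using that powr_of_int[of "complex_of_real t" "-2"]
      by (simp add: power_int_minus field_simps)
    have "complex_of_real t powr (1 - p) * of_real t powr (1 - q) * of_real t powr (-2) = of_real t powr (- p - q)"
      by (simp flip: powr_add add: algebra_simps)
    thus ?thesis
      unfolding f_def g_def g'_def h_def e1 e2 scaleR_conv_of_real e3 [symmetric]
      by (simp add: e2 mult_ac del: of_real_divide)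
  qed
  have B: "has_bochner_integral lborel (\<lambda>t. indicator {1<..} t *\<^sub>R h t) (Gamma p * Gamma q * rGamma (p + q))"
    using Beta_integral_ray[OF assms, of 1] by (simp add: h_def)
  have I: "einterval 1 \<infinity> = {1<..}" "einterval 0 1 = {0<..<1}"
    by (auto simp: einterval_def one_ereal_def zero_ereal_def)
  have "(LBINT x=0..1. f x) = (LBINT x=1..\<infinity>. g' x *\<^sub>R f (g x))"
  proof (rule interval_integral_substitution_integrable)
    show "((ereal \<circ> g \<circ> real_of_ereal) \<longlongrightarrow> 0) (at_right 1)"
      unfolding one_ereal_def zero_ereal_def ereal_tendsto_simps g_def by real_asymp
    show "((ereal \<circ> g \<circ> real_of_ereal) \<longlongrightarrow> 1) (at_left \<infinity>)"
      unfolding one_ereal_def ereal_tendsto_simps g_def by real_asymp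
    show "set_integrable lborel (einterval 1 \<infinity>) (\<lambda>x. g' x *\<^sub>R f (g x))"
    proof -
      have "indicator {1<..} t *\<^sub>R (g' t *\<^sub>R f (g t)) = indicator {1<..} t *\<^sub>R h t" for t
        using gf[of t] by (cases "t > 1") auto
      thus ?thesis using B unfolding I set_integrable_def by (simp add: has_bochner_integral_iff)
    qed
    show "set_integrable lborel (einterval 0 1) f"
      unfolding I by (rule set_integrable_subset[OF fint]) auto
    show "isCont f (g x)" if "1 < ereal x" for x
    proof -
      have "0 < g x" "g x < 1" using that by (auto simp: g_def one_ereal_def field_simps)
      thus ?thesis unfolding f_def
        by (intro continuous_intros) (auto simp: complex_nonpos_Reals_iff)
    qed
  qed (auto simp: g_def g'_def one_ereal_def power2_eq_square intro!: derivative_eq_intros)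
  also have "(LBINT x=1..\<infinity>. g' x *\<^sub>R f (g x)) = (LINT t:{1<..}|lborel. h t)"
    unfolding interval_lebesgue_integral_def I
    using gf by (auto intro!: set_lebesgue_integral_cong)
  also have "\<dots> = Gamma p * Gamma q * rGamma (p + q)"
    using B by (simp add: set_lebesgue_integral_def has_bochner_integral_iff)
  also have "(LBINT x=0..1. f x) = integral {0..1} f"
    using interval_integral_eq_integral[of 0 1 f] fint by (simp add: zero_ereal_def one_ereal_def)
  finally show ?thesis by (simp add: f_def [abs_def])
qed

section \<open>Power series of the Gauss function and its continuation\<close>

definition slit_plane :: "complex set" where
  "slit_plane = - complex_of_real ` {1..}"

lemma slit_plane_iff: "z \<in> slit_plane \<longleftrightarrow> 1 - z \<notin> \<real>\<^sub>\<le>\<^sub>0"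
proof -
  have "z \<in> complex_of_real ` {1..} \<longleftrightarrow> Im z = 0 \<and> Re z \<ge> 1"
  proof
    assume "Im z = 0 \<and> Re z \<ge> 1"
    hence "z = complex_of_real (Re z)" "Re z \<in> {1..}" by (auto simp: complex_eq_iff)
    thus "z \<in> complex_of_real ` {1..}" by blast
  qed auto
  thus ?thesis by (auto simp: slit_plane_def complex_nonpos_Reals_iff)
qed

lemma slit_plane_altdef: "slit_plane = (\<lambda>z. 1 - z) -` (- \<real>\<^sub>\<le>\<^sub>0)"
  by (auto simp: slit_plane_iff)

lemma open_slit_plane: "open slit_plane"
  unfolding slit_plane_altdef by (intro open_vimage continuous_intros) auto

lemma Re_less_1_slit_plane: "Re z < 1 \<Longrightarrow> z \<in> slit_plane"
  by (auto simp: slit_plane_iff complex_nonpos_Reals_iff)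

lemma slit_plane_scale:
  assumes "z \<in> slit_plane" "0 \<le> t" "t \<le> 1"
  shows "z * of_real t \<in> slit_plane"
proof (cases "Im z = 0")
  case True
  hence "Re z < 1" using assms by (auto simp: slit_plane_iff complex_nonpos_Reals_iff)
  hence "Re z * t < 1"
    using assms by (smt (verit) mult_left_le mult_nonneg_nonneg mult_nonpos_nonneg)
  thus ?thesis by (intro Re_less_1_slit_plane) auto
next
  case False
  show ?thesis
  proof (cases "t = 0")
    case t: False
    thus ?thesis using \<open>Im z \<noteq> 0\<close> by (auto simp: slit_plane_iff complex_nonpos_Reals_iff)
  qed (auto simp: Re_less_1_slit_plane)
qed

lemma starlike_slit_plane: "starlike slit_plane"
proof -
  have "closed_segment 0 z \<subseteq> slit_plane" if z: "z \<in> slit_plane" for z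
  proof
    fix w assume "w \<in> closed_segment 0 z"
    then obtain t where "0 \<le> t" "t \<le> 1" "w = z * of_real t"
      by (auto simp: in_segment scaleR_conv_of_real mult.commute)
    thus "w \<in> slit_plane" using slit_plane_scale z by auto
  qed
  moreover have "0 \<in> slit_plane" by (simp add: Re_less_1_slit_plane)
  ultimately show ?thesis unfolding starlike_def by blast
qed

lemma connected_slit_plane: "connected slit_plane"
  by (rule starlike_imp_connected [OF starlike_slit_plane])

lemma ball_subset_slit_plane: "ball 0 1 \<subseteq> slit_plane"
proof
  fix z :: complex assume "z \<in> ball 0 1"
  thus "z \<in> slit_plane" using complex_Re_le_cmod[of z] by (intro Re_less_1_slit_plane) auto
qed

text \<open>All identities between continuations are proved in this way: compare power series at 0, then
  use the identity theorem.\<close>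
lemma fps_expansion_identity:
  fixes f g :: "complex \<Rightarrow> complex"
  assumes "open S" "connected S" "0 \<in> S" "f holomorphic_on S" "g holomorphic_on S"
    and "f has_fps_expansion F" "g has_fps_expansion F" "z \<in> S"
  shows "f z = g z"
proof -
  have "\<forall>\<^sub>F w in nhds 0. eval_fps F w = f w" "\<forall>\<^sub>F w in nhds 0. eval_fps F w = g w"
    using assms by (auto simp: has_fps_expansion_def)
  hence "\<forall>\<^sub>F w in nhds 0. f w = g w" by eventually_elim auto
  moreover have "\<forall>\<^sub>F w in nhds 0. w \<in> S" using assms by (intro eventually_nhds_in_open) auto
  ultimately have "\<forall>\<^sub>F w in nhds 0. w \<in> S \<and> f w = g w" by eventually_elim auto
  then obtain U where U: "open U" "0 \<in> U" "\<And>w. w \<in> U \<Longrightarrow> w \<in> S \<and> f w = g w"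
    by (auto simp: eventually_nhds)
  show ?thesis
    by (rule analytic_continuation_open[of U S f g]) (use U assms in auto)
qed

definition gauss_fps :: "complex \<Rightarrow> complex \<Rightarrow> complex \<Rightarrow> complex fps" where
  "gauss_fps a b c = Abs_fps (gauss_coeff a b c)"

lemma hypergeo_2F1_eq_eval_fps: "hypergeo [a, b] [c] z = eval_fps (gauss_fps a b c) z"
  by (simp add: hypergeo_def eval_fps_def gauss_fps_def)

lemma gauss_fps_conv_radius:
  assumes "c \<notin> \<int>\<^sub>\<le>\<^sub>0"
  shows "fps_conv_radius (gauss_fps a b c) \<ge> 1"
  unfolding fps_conv_radius_def
proof (rule conv_radius_geI_ex')
  fix r :: real assume r: "0 < r" "ereal r < 1"
  obtain C where C: "C > 0"
    "\<And>n. norm (gauss_coeff a b c n) \<le> C * (real n + 1) powr (Re (a + b - c) - 1)"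
    using gauss_coeff_bound[OF assms] by blast
  define s where "s = Re (a + b - c) - 1"
  have r': "0 < r" "r < 1" using r by auto
  have "(\<lambda>n. C * (real n + 1) powr s * r ^ n) \<in> O(\<lambda>n. (real n + 1) powr (-2))"
    using r' by real_asymp
  hence "summable (\<lambda>n. C * (real n + 1) powr s * r ^ n)"
    by (rule summable_comparison_test_bigo[rotated]) (simp add: summable_Suc_powr)
  thus "summable (\<lambda>n. fps_nth (gauss_fps a b c) n * of_real r ^ n)"
  proof (rule summable_comparison_test[rotated], intro exI allI impI)
    fix n
    show "norm (fps_nth (gauss_fps a b c) n * of_real r ^ n) \<le> C * (real n + 1) powr s * r ^ n"
    proof -
      have "norm (fps_nth (gauss_fps a b c) n * of_real r ^ n) = norm (gauss_coeff a b c n) * r ^ n"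
        unfolding gauss_fps_def fps_nth_Abs_fps norm_mult norm_power using r' by simp
      also have "\<dots> \<le> C * (real n + 1) powr s * r ^ n"
        unfolding s_def using C(2) r' by (intro mult_right_mono) auto
      finally show ?thesis .
    qed
  qed
qed

lemma gauss_fps_has_expansion:
  assumes "c \<notin> \<int>\<^sub>\<le>\<^sub>0"
  shows "eval_fps (gauss_fps a b c) has_fps_expansion gauss_fps a b c"
  by (intro eval_fps_has_fps_expansion less_le_trans[OF _ gauss_fps_conv_radius[OF assms]]) auto

lemma holomorphic_gauss_fps:
  assumes "c \<notin> \<int>\<^sub>\<le>\<^sub>0"
  shows "eval_fps (gauss_fps a b c) holomorphic_on ball 0 1"
proof (rule holomorphic_on_eval_fps)
  show "ball 0 1 \<subseteq> eball (0::complex) (fps_conv_radius (gauss_fps a b c))"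
  proof (rule subsetI)
    fix z :: complex assume "z \<in> ball 0 1"
    hence "ereal (norm z) < 1" by simp
    hence "ereal (norm z) < fps_conv_radius (gauss_fps a b c)"
      using gauss_fps_conv_radius[OF assms] by (rule less_le_trans)
    thus "z \<in> eball 0 (fps_conv_radius (gauss_fps a b c))"
      by (simp add: eball_def)
  qed
qed

text \<open>A continuation is specified by its power series at 0; by the identity theorem this amounts to
  agreement with the series on the whole unit disc.\<close>
definition gauss_continuation :: "complex \<Rightarrow> complex \<Rightarrow> complex \<Rightarrow> (complex \<Rightarrow> complex) \<Rightarrow> bool" where
  "gauss_continuation a b c g \<longleftrightarrow> g holomorphic_on slit_plane \<and> g has_fps_expansion gauss_fps a b c"

text \<open>The operator \<open>1 + (z/c) d/dz\<close> multiplies the \<open>n\<close>-th coefficient by \<open>(c + n) / c\<close>, which is the quotient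
  of \<open>(c + 1)\<^sub>n\<close> by \<open>(c)\<^sub>n\<close>.\<close>
lemma gauss_fps_lower_c:
  assumes "c \<notin> \<int>\<^sub>\<le>\<^sub>0"
  shows "gauss_fps a b c = gauss_fps a b (c + 1) + fps_const (1 / c) * (fps_X * fps_deriv (gauss_fps a b (c + 1)))"
proof (rule fps_ext)
  fix n
  have c: "c \<noteq> 0" using assms by auto
  have nz: "pochhammer c n \<noteq> 0" "pochhammer (c + 1) n \<noteq> 0"
    using assms nonpos_Ints_add_of_nat_cancel[OF assms, of 1] pochhammer_eq_0_imp_nonpos_Int by auto
  have "c * pochhammer (c + 1) n = (c + of_nat n) * pochhammer c n"
    by (metis pochhammer_rec pochhammer_rec')
  hence e: "pochhammer (c + 1) n = (c + of_nat n) * pochhammer c n / c"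
    using c by (simp add: field_simps)
  have x: "fps_nth (fps_X * fps_deriv F) n = of_nat n * fps_nth F n" for F :: "complex fps"
    by (simp only: fps_mult_fps_X_deriv_shift fps_nth_Abs_fps)
  have "c + of_nat n \<noteq> 0" using nz c e by auto
  thus "fps_nth (gauss_fps a b c) n =
     fps_nth (gauss_fps a b (c + 1) + fps_const (1 / c) * (fps_X * fps_deriv (gauss_fps a b (c + 1)))) n"
    unfolding fps_add_nth fps_mult_left_const_nth x gauss_fps_def fps_nth_Abs_fps e
    using c nz(1) by (simp add: divide_simps) (simp add: algebra_simps)
qed

lemma gauss_fps_deriv:
  assumes "c \<notin> \<int>\<^sub>\<le>\<^sub>0"
  shows "fps_deriv (gauss_fps a b c) = fps_const (a * b / c) * gauss_fps (a + 1) (b + 1) (c + 1)"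
proof (rule fps_ext)
  fix n
  have c: "c \<noteq> 0" using assms by auto
  have nz: "pochhammer (c + 1) n \<noteq> 0"
    using nonpos_Ints_add_of_nat_cancel[OF assms, of 1] pochhammer_eq_0_imp_nonpos_Int by auto
  have "of_nat (Suc n) * (x * y / (u * (of_nat (Suc n) * w))) = x * y / (u * w)" for x y u w :: complex
    by (simp add: divide_simps del: of_nat_Suc)
  thus "fps_nth (fps_deriv (gauss_fps a b c)) n = fps_nth (fps_const (a * b / c) * gauss_fps (a + 1) (b + 1) (c + 1)) n"
    by (simp add: gauss_fps_def pochhammer_rec fact_Suc field_simps del: of_nat_Suc)
qed

lemma gauss_continuation_lower_c:
  assumes "c \<notin> \<int>\<^sub>\<le>\<^sub>0" "gauss_continuation a b (c + 1) g"
  shows "gauss_continuation a b c (\<lambda>z. g z + 1 / c * (z * deriv g z))"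
  unfolding gauss_continuation_def
proof
  show "(\<lambda>z. g z + 1 / c * (z * deriv g z)) holomorphic_on slit_plane"
    using assms(2) unfolding gauss_continuation_def
    by (intro holomorphic_intros open_slit_plane) auto
  show "(\<lambda>z. g z + 1 / c * (z * deriv g z)) has_fps_expansion gauss_fps a b c"
    unfolding gauss_fps_lower_c[OF assms(1)]
    using assms(2) unfolding gauss_continuation_def
    by (intro fps_expansion_intros) auto
qed

text \<open>The derivative of the Gauss series is a multiple of the series with all parameters raised by
  one, and a holomorphic function on the starlike slit plane has a primitive.\<close>
lemma gauss_continuation_lower_all:
  assumes "c \<notin> \<int>\<^sub>\<le>\<^sub>0" "gauss_continuation (a + 1) (b + 1) (c + 1) g"
  shows "\<exists>f. gauss_continuation a b c f"
proof -
  have hol: "(\<lambda>z. a * b / c * g z) holomorphic_on slit_plane"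
    using assms(2) unfolding gauss_continuation_def by (intro holomorphic_intros) auto
  obtain G where G: "\<And>z. z \<in> slit_plane \<Longrightarrow> (G has_field_derivative (a * b / c * g z)) (at z)"
    using holomorphic_starlike_primitive[of slit_plane "\<lambda>z. a * b / c * g z" "{}"]
      holomorphic_on_imp_continuous_on[OF hol] holomorphic_on_imp_differentiable_at[OF hol open_slit_plane]
      starlike_slit_plane open_slit_plane by auto
  define f where "f z = G z + (1 - G 0)" for z
  have f': "(f has_field_derivative (a * b / c * g z)) (at z)" if "z \<in> slit_plane" for z
    unfolding f_def using G[OF that] by (auto intro!: derivative_eq_intros)
  have fh: "f holomorphic_on slit_plane"
    using f' by (auto simp: holomorphic_on_open[OF open_slit_plane])
  have 0: "0 \<in> slit_plane" by (simp add: Re_less_1_slit_plane)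
  have exp: "f has_fps_expansion fps_expansion f 0"
    by (rule has_fps_expansion_fps_expansion[OF open_slit_plane 0 fh])
  have d1: "deriv f has_fps_expansion fps_deriv (fps_expansion f 0)"
    by (rule has_fps_expansion_deriv[OF exp])
  have d2: "deriv f has_fps_expansion fps_deriv (gauss_fps a b c)"
    unfolding gauss_fps_deriv[OF assms(1)]
  proof (rule has_fps_expansion_cong[THEN iffD1])
    show "(\<lambda>z. a * b / c * g z) has_fps_expansion fps_const (a * b / c) * gauss_fps (a + 1) (b + 1) (c + 1)"
      using assms(2) unfolding gauss_continuation_def by (intro fps_expansion_intros) auto
    have "\<forall>\<^sub>F z in nhds 0. z \<in> slit_plane"
      by (rule eventually_nhds_in_open[OF open_slit_plane 0])
    thus "\<forall>\<^sub>F z in nhds 0. a * b / c * g z = deriv f z"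
      by eventually_elim (use f' DERIV_imp_deriv in force)
  qed auto
  have "fps_deriv (fps_expansion f 0) = fps_deriv (gauss_fps a b c)"
    using d1 d2 by (rule fps_expansion_unique_complex)
  moreover have "fps_nth (fps_expansion f 0) 0 = fps_nth (gauss_fps a b c) 0"
    by (simp add: fps_expansion_def gauss_fps_def f_def)
  ultimately have "fps_expansion f 0 = gauss_fps a b c"
    by (simp add: fps_deriv_eq_iff)
  thus ?thesis using exp fh unfolding gauss_continuation_def by auto
qed

section \<open>The analytic continuation to the slit plane\<close>

lemma pochhammer_binomial_series:
  fixes a z :: complex
  assumes "norm z < 1"
  shows "(\<lambda>n. pochhammer a n / fact n * z ^ n) sums ((1 - z) powr (- a))"
    and "summable (\<lambda>n. norm (pochhammer a n / fact n * z ^ n))"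
proof -
  have e: "(- a gchoose n) * (- z) ^ n = pochhammer a n / fact n * z ^ n" for n
  proof -
    have "(- z) ^ n = (-1) ^ n * z ^ n" by (rule power_minus)
    moreover have "(-1) ^ n * (-1 :: complex) ^ n = 1" by (simp flip: power_mult_distrib)
    ultimately show ?thesis by (simp add: gbinomial_pochhammer mult_ac)
  qed
  show "(\<lambda>n. pochhammer a n / fact n * z ^ n) sums ((1 - z) powr (- a))"
    using gen_binomial_complex[of "- z" "- a"] assms unfolding e by simp
  have "summable (\<lambda>n. norm (fps_nth (fps_binomial (- a)) n * (- z) ^ n))"
    using assms by (intro norm_summable_fps less_le_trans[OF _ fps_conv_radius_binomial[THEN eq_refl[OF sym], of "-a"]]) auto
  thus "summable (\<lambda>n. norm (pochhammer a n / fact n * z ^ n))"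
    unfolding fps_binomial_nth e .
qed

text \<open>Expanding \<open>(1 - z t)^(- a)\<close> in the Euler integral yields a Beta integral in every term.\<close>
lemma Euler_integral_series:
  assumes "Re b > 0" "Re (c - b) > 0" "norm z < 1"
  shows "(LINT t:{0..1}|lborel. of_real t powr (b - 1) * of_real (1 - t) powr (c - b - 1) * (1 - z * of_real t) powr (- a))
           = Gamma b * Gamma (c - b) * rGamma c * eval_fps (gauss_fps a b c) z"
proof -
  have c: "c \<notin> \<int>\<^sub>\<le>\<^sub>0" and b: "b \<notin> \<int>\<^sub>\<le>\<^sub>0" using assms by (auto intro!: Re_pos_not_nonpos_Int)
  define \<phi> where "\<phi> t = of_real t powr (b - 1) * complex_of_real (1 - t) powr (c - b - 1)" for t
  define u where "u n = pochhammer a n / fact n * z ^ n" for n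
  define f where "f n t = indicator {0..1} t *\<^sub>R (\<phi> t * (u n * of_real t ^ n))" for n and t :: real
  have u: "summable (\<lambda>n. norm (u n))"
    unfolding u_def by (rule pochhammer_binomial_series(2)[OF assms(3)])
  have fB: "f n = (\<lambda>t. u n * (indicator {0..1} t *\<^sub>R (of_real t powr ((b + of_nat n) - 1) * complex_of_real (1 - t) powr (c - b - 1))))" for n
  proof (rule ext)
    fix t :: real
    have "complex_of_real t powr (b + of_nat n - 1) = of_real t powr (b - 1) * of_real t ^ n" if "t \<ge> 0"
    proof (cases "t = 0")
      case False
      have "b + of_nat n - 1 = (b - 1) + of_nat n" by simp
      thus ?thesis using False by (simp only: powr_add powr_nat') (simp add: powr_nat')
    qed auto
    thus "f n t = u n * (indicator {0..1} t *\<^sub>R (of_real t powr ((b + of_nat n) - 1) * complex_of_real (1 - t) powr (c - b - 1)))"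
      by (cases "t \<in> {0..1}") (auto simp: f_def \<phi>_def)
  qed
  have int: "integrable lborel (f n)" for n
    unfolding fB using Beta_integral_complex_integrable[of "b + of_nat n" "c - b"] assms
    by (intro integrable_mult_right) (auto simp: set_integrable_def)
  have val: "(LINT t|lborel. f n t) = Gamma b * Gamma (c - b) * rGamma c * (gauss_coeff a b c n * z ^ n)" for n
  proof -
    have "(LINT t|lborel. f n t) = u n * (LINT t:{0..1}|lborel. (of_real t powr ((b + of_nat n) - 1) * complex_of_real (1 - t) powr (c - b - 1)))"
      unfolding fB set_lebesgue_integral_def by (rule integral_mult_right_zero)
    also have "(LINT t:{0..1}|lborel. (of_real t powr ((b + of_nat n) - 1) * complex_of_real (1 - t) powr (c - b - 1)))
        = Gamma (b + of_nat n) * Gamma (c - b) * rGamma (b + of_nat n + (c - b))"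
      using Beta_integral_complex_integrable[of "b + of_nat n" "c - b"]
        Beta_integral_complex[of "b + of_nat n" "c - b"] assms
      by (subst set_borel_integral_eq_integral(2)) auto
    also have "b + of_nat n + (c - b) = c + of_nat n" by simp
    also have "Gamma (b + of_nat n) = Gamma b * pochhammer b n"
      using b by (simp add: pochhammer_Gamma Gamma_eq_zero_iff)
    finally show ?thesis by (simp add: rGamma_add_of_nat[OF c] u_def mult_ac)
  qed
  have i0: "integrable lborel (\<lambda>t. indicator {0..1} t *\<^sub>R \<phi> t)"
    using Beta_integral_complex_integrable[of b "c - b"] assms
    by (auto simp: set_integrable_def \<phi>_def)
  have fn: "norm (f n t) \<le> norm (u n) * norm (indicator {0..1} t *\<^sub>R \<phi> t)" for n t
  proof (cases "t \<in> {0..1}")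
    case True
    hence "norm (complex_of_real t ^ n) \<le> 1" by (auto simp: norm_power power_le_one)
    hence "norm (u n) * norm (\<phi> t) * norm (complex_of_real t ^ n) \<le> norm (u n) * norm (\<phi> t) * 1"
      by (intro mult_left_mono) auto
    thus ?thesis using True by (simp add: f_def norm_mult mult_ac)
  qed (auto simp: f_def)
  have "(LINT t|lborel. (\<Sum>n. f n t)) = (\<Sum>n. LINT t|lborel. f n t)"
  proof (rule integral_suminf[OF int])
    show "AE t in lborel. summable (\<lambda>n. norm (f n t))"
    proof (rule AE_I2)
      fix t
      show "summable (\<lambda>n. norm (f n t))"
        by (rule summable_comparison_test[rotated, OF summable_mult2[OF u]]) (use fn in auto)
    qed
    show "summable (\<lambda>n. LINT t|lborel. norm (f n t))"
    proof (rule summable_comparison_test[rotated, OF summable_mult2[OF u]], intro exI allI impI)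
      fix n
      have "(LINT t|lborel. norm (f n t)) \<le> (LINT t|lborel. norm (u n) * norm (indicator {0..1} t *\<^sub>R \<phi> t))"
        by (intro integral_mono integrable_norm integrable_mult_right int i0 fn)
      thus "norm (LINT t|lborel. norm (f n t)) \<le> norm (u n) * (LINT t|lborel. norm (indicator {0..1} t *\<^sub>R \<phi> t))"
        by simp
    qed
  qed
  also have "(\<Sum>n. LINT t|lborel. f n t) = Gamma b * Gamma (c - b) * rGamma c * eval_fps (gauss_fps a b c) z"
  proof -
    have "summable (\<lambda>n. fps_nth (gauss_fps a b c) n * z ^ n)"
      using assms(3) by (intro summable_fps less_le_trans[OF _ gauss_fps_conv_radius[OF c]]) auto
    thus ?thesis unfolding val eval_fps_def gauss_fps_def fps_nth_Abs_fps by (rule suminf_mult)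
  qed
  also have "(\<lambda>t. \<Sum>n. f n t) = (\<lambda>t. indicator {0..1} t *\<^sub>R (\<phi> t * (1 - z * of_real t) powr (- a)))"
  proof (rule ext)
   fix t :: real
   show "(\<Sum>n. f n t) = indicator {0..1} t *\<^sub>R (\<phi> t * (1 - z * of_real t) powr (- a))"
  proof (cases "t \<in> {0..1}")
    case True
    have "norm z * t \<le> norm z * 1" using True by (intro mult_left_mono) auto
    hence "norm (z * of_real t) < 1" using True assms(3) by (simp add: norm_mult)
    from sums_mult[OF pochhammer_binomial_series(1)[OF this], of "\<phi> t" a] True show ?thesis
      by (simp add: f_def u_def power_mult_distrib mult_ac sums_iff)
   qed (auto simp: f_def)
  qed
  finally show ?thesis unfolding set_lebesgue_integral_def \<phi>_def .
qed

text \<open>The conditions \<open>Re b > 1\<close> and \<open>Re (c - b) > 1\<close> make the integrand continuous up to both endpoints,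
  so that differentiation under the integral over a compact interval applies.\<close>
lemma Euler_integral_continuation:
  assumes "Re b > 1" "Re (c - b) > 1"
  shows "\<exists>g. gauss_continuation a b c g"
proof -
  have c: "c \<notin> \<int>\<^sub>\<le>\<^sub>0" and b: "b \<notin> \<int>\<^sub>\<le>\<^sub>0" and cb: "c - b \<notin> \<int>\<^sub>\<le>\<^sub>0"
    using assms by (auto intro!: Re_pos_not_nonpos_Int)
  define \<phi> where "\<phi> t = of_real t powr (b - 1) * complex_of_real (1 - t) powr (c - b - 1)" for t
  define K where "K = Gamma b * Gamma (c - b) * rGamma c"
  define g where "g z = integral (cbox 0 1) (\<lambda>t. \<phi> t * (1 - z * of_real t) powr (- a))" for z
  have K: "K \<noteq> 0" using c b cb by (simp add: K_def Gamma_eq_zero_iff rGamma_eq_zero_iff)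
  have [continuous_intros]: "continuous_on {0..1} \<phi>"
    unfolding \<phi>_def using assms by (intro continuous_intros) auto
  have nR: "1 - z * of_real t \<notin> \<real>\<^sub>\<le>\<^sub>0" if "z \<in> slit_plane" "t \<in> {0..1}" for z t
    using slit_plane_scale[OF that(1), of t] that(2) by (simp add: slit_plane_iff)
  have cont: "continuous_on (S \<times> {0..1}) (\<lambda>(z, t). \<psi> t * (1 - z * complex_of_real t) powr e)"
    if "S \<subseteq> slit_plane" "continuous_on {0..1} \<psi>" for S \<psi> e
    unfolding split_def
  proof (intro continuous_intros continuous_on_compose2[OF that(2)])
    fix p assume p: "p \<in> S \<times> {0..1::real}"
    hence n: "1 - fst p * of_real (snd p) \<notin> \<real>\<^sub>\<le>\<^sub>0" using nR[of "fst p" "snd p"] that(1) by auto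
    show "0 < Re e" if "1 - fst p * of_real (snd p) = 0" using n unfolding that by simp
  next
    show "S \<times> {0..1} \<subseteq> {p. 0 \<le> Re (1 - fst p * of_real (snd p)) \<or> Im (1 - fst p * of_real (snd p)) \<noteq> 0}"
      using nR that(1) by (force simp: complex_nonpos_Reals_iff)
  qed auto
  have cont1: "continuous_on {0..1} (\<lambda>t. \<phi> t * (1 - z * of_real t) powr (- a))" if "z \<in> slit_plane" for z
  proof (intro continuous_intros)
    show "0 < Re (- a)" if "t \<in> {0..1}" "1 - z * of_real t = 0" for t
      using nR[OF \<open>z \<in> slit_plane\<close> that(1)] unfolding that(2) by simp
    show "{0..1} \<subseteq> {t. 0 \<le> Re (1 - z * of_real t) \<or> Im (1 - z * of_real t) \<noteq> 0}"
      using nR[OF that] by (force simp: complex_nonpos_Reals_iff)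
  qed
  have "g holomorphic_on ball z0 e" if "ball z0 e \<subseteq> slit_plane" for z0 e
    unfolding g_def
  proof (rule leibniz_rule_holomorphic)
    fix z t assume zt: "z \<in> ball z0 e" "t \<in> cbox (0::real) 1"
    show "((\<lambda>z. \<phi> t * (1 - z * of_real t) powr (- a)) has_field_derivative
            (\<phi> t * a * of_real t) * (1 - z * of_real t) powr (- a - 1)) (at z within ball z0 e)"
      using nR[of z t] zt that
      by (auto intro!: derivative_eq_intros simp: field_simps)
  next
    fix z assume "z \<in> ball z0 e"
    thus "(\<lambda>t. \<phi> t * (1 - z * of_real t) powr (- a)) integrable_on cbox 0 1"
      using cont1 that by (intro integrable_continuous) auto
  next
    show "continuous_on (ball z0 e \<times> cbox 0 1) (\<lambda>(z, t). \<phi> t * a * of_real t * (1 - z * of_real t) powr (- a - 1))"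
      using that by (simp only: cbox_interval, intro cont continuous_intros) auto
  qed auto
  hence "g field_differentiable (at z)" if "z \<in> slit_plane" for z
    using openE[OF open_slit_plane that] by (metis holomorphic_on_imp_differentiable_at open_ball centre_in_ball)
  hence hol: "g holomorphic_on slit_plane"
    by (simp add: holomorphic_on_def field_differentiable_at_within)
  have gz: "g z = K * eval_fps (gauss_fps a b c) z" if "z \<in> ball 0 1" for z
  proof -
    have z: "z \<in> slit_plane" using that ball_subset_slit_plane by blast
    have "set_integrable lborel {0..1} (\<lambda>t. \<phi> t * (1 - z * of_real t) powr (- a))"
      unfolding set_integrable_def using cont1[OF z] by (intro borel_integrable_compact) auto
    from set_borel_integral_eq_integral(2)[OF this]
    have "g z = (LINT t:{0..1}|lborel. \<phi> t * (1 - z * of_real t) powr (- a))"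
      by (simp add: g_def)
    also have "\<dots> = K * eval_fps (gauss_fps a b c) z"
      unfolding \<phi>_def K_def using that assms by (intro Euler_integral_series) auto
    finally show ?thesis .
  qed
  have "gauss_continuation a b c (\<lambda>z. g z / K)"
    unfolding gauss_continuation_def
  proof
    show "(\<lambda>z. g z / K) holomorphic_on slit_plane" using hol K by (intro holomorphic_intros) auto
    have "\<forall>\<^sub>F z in nhds 0. z \<in> ball (0::complex) 1" by (intro eventually_nhds_in_open) auto
    hence "\<forall>\<^sub>F z in nhds 0. eval_fps (gauss_fps a b c) z = g z / K"
      by eventually_elim (use gz K in simp)
    from has_fps_expansion_cong[OF this refl] show "(\<lambda>z. g z / K) has_fps_expansion gauss_fps a b c"
      using gauss_fps_has_expansion[OF c, of a b] by simp
  qed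
  thus ?thesis by blast
qed

text \<open>Raise all parameters by \<open>k\<close>, then the lower one by a further \<open>l\<close>, until Euler's integral applies;
  then descend.\<close>
lemma gauss_continuation_exists:
  assumes "c \<notin> \<int>\<^sub>\<le>\<^sub>0"
  shows "\<exists>g. gauss_continuation a b c g"
proof -
  have lower_c: "\<exists>g. gauss_continuation a b c g"
    if "c \<notin> \<int>\<^sub>\<le>\<^sub>0" "\<exists>g. gauss_continuation a b (c + of_nat l) g" for a b c l
    using that
  proof (induction l arbitrary: c)
    case (Suc l)
    have "\<exists>g. gauss_continuation a b (c + 1) g"
      by (rule Suc.IH) (use Suc.prems nonpos_Ints_add_of_nat_cancel[of c 1] in \<open>auto simp: add_ac\<close>)
    thus ?case using gauss_continuation_lower_c Suc.prems(1) by blast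
  qed auto
  have lower_all: "\<exists>g. gauss_continuation a b c g"
    if "c \<notin> \<int>\<^sub>\<le>\<^sub>0" "\<exists>g. gauss_continuation (a + of_nat k) (b + of_nat k) (c + of_nat k) g" for a b c k
    using that
  proof (induction k arbitrary: a b c)
    case (Suc k)
    have "\<exists>g. gauss_continuation (a + 1) (b + 1) (c + 1) g"
      by (rule Suc.IH) (use Suc.prems nonpos_Ints_add_of_nat_cancel[of c 1] in \<open>auto simp: add_ac\<close>)
    thus ?case using gauss_continuation_lower_all Suc.prems(1) by blast
  qed auto
  obtain k :: nat where k: "1 - Re b < real k" using reals_Archimedean2 by blast
  obtain l :: nat where l: "1 + Re b - Re c < real l" using reals_Archimedean2 by blast
  have "\<exists>g. gauss_continuation (a + of_nat k) (b + of_nat k) (c + of_nat k + of_nat l) g"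
    by (rule Euler_integral_continuation) (use k l in auto)
  hence "\<exists>g. gauss_continuation (a + of_nat k) (b + of_nat k) (c + of_nat k) g"
    using lower_c nonpos_Ints_add_of_nat_cancel[OF assms] by blast
  thus ?thesis using lower_all assms by blast
qed

lemma gauss_continuation_gauss_2F1:
  assumes "c \<notin> \<int>\<^sub>\<le>\<^sub>0"
  shows "gauss_continuation a b c (gauss_2F1 a b c)"
proof -
  have iff: "g holomorphic_on (- complex_of_real ` {1..}) \<and> (\<forall>z\<in>ball 0 1. g z = hypergeo [a, b] [c] z)
               \<longleftrightarrow> gauss_continuation a b c g" for g
  proof
    assume g: "g holomorphic_on (- complex_of_real ` {1..}) \<and> (\<forall>z\<in>ball 0 1. g z = hypergeo [a, b] [c] z)"
    have "\<forall>\<^sub>F z in nhds 0. z \<in> ball (0::complex) 1" by (intro eventually_nhds_in_open) auto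
    hence "\<forall>\<^sub>F z in nhds 0. eval_fps (gauss_fps a b c) z = g z"
      by eventually_elim (use g in \<open>simp add: hypergeo_2F1_eq_eval_fps\<close>)
    from has_fps_expansion_cong[OF this refl] have "g has_fps_expansion gauss_fps a b c"
      using gauss_fps_has_expansion[OF assms, of a b] by simp
    thus "gauss_continuation a b c g" using g by (simp add: gauss_continuation_def slit_plane_def)
  next
    assume g: "gauss_continuation a b c g"
    have "g z = hypergeo [a, b] [c] z" if "z \<in> ball 0 1" for z
      unfolding hypergeo_2F1_eq_eval_fps
      by (rule fps_expansion_identity[of "ball 0 1" _ _ "gauss_fps a b c"])
         (use g that in \<open>auto simp: gauss_continuation_def assms
            intro!: gauss_fps_has_expansion holomorphic_gauss_fps
            intro: holomorphic_on_subset[OF _ ball_subset_slit_plane]\<close>)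
    thus "g holomorphic_on (- complex_of_real ` {1..}) \<and> (\<forall>z\<in>ball 0 1. g z = hypergeo [a, b] [c] z)"
      using g by (simp add: gauss_continuation_def slit_plane_def)
  qed
  show ?thesis
    unfolding gauss_2F1_def iff by (rule someI_ex[OF gauss_continuation_exists[OF assms]])
qed

lemma
  assumes "c \<notin> \<int>\<^sub>\<le>\<^sub>0"
  shows holomorphic_gauss_2F1: "gauss_2F1 a b c holomorphic_on slit_plane"
    and gauss_2F1_has_expansion: "gauss_2F1 a b c has_fps_expansion gauss_fps a b c"
  using gauss_continuation_gauss_2F1[OF assms] by (auto simp: gauss_continuation_def)

lemma gauss_2F1_0: "c \<notin> \<int>\<^sub>\<le>\<^sub>0 \<Longrightarrow> gauss_2F1 a b c 0 = 1"
  using has_fps_expansion_imp_0_eq_fps_nth_0[OF gauss_2F1_has_expansion, of c a b] by (simp add: gauss_fps_def)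

lemma deriv_gauss_2F1:
  assumes "c \<notin> \<int>\<^sub>\<le>\<^sub>0" "z \<in> slit_plane"
  shows "deriv (gauss_2F1 a b c) z = a * b / c * gauss_2F1 (a + 1) (b + 1) (c + 1) z"
proof -
  have c1: "c + 1 \<notin> \<int>\<^sub>\<le>\<^sub>0" using nonpos_Ints_add_of_nat_cancel[OF assms(1), of 1] by simp
  show ?thesis
  proof (rule fps_expansion_identity[OF open_slit_plane connected_slit_plane,
            where f = "deriv (gauss_2F1 a b c)"
              and g = "\<lambda>z. a * b / c * gauss_2F1 (a + 1) (b + 1) (c + 1) z"])
    show "deriv (gauss_2F1 a b c) has_fps_expansion fps_deriv (gauss_fps a b c)"
      by (intro fps_expansion_intros gauss_2F1_has_expansion assms)
    show "(\<lambda>z. a * b / c * gauss_2F1 (a + 1) (b + 1) (c + 1) z) has_fps_expansion fps_deriv (gauss_fps a b c)"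
      unfolding gauss_fps_deriv[OF assms(1)]
      by (intro fps_expansion_intros gauss_2F1_has_expansion c1)
  qed (auto intro!: holomorphic_intros holomorphic_gauss_2F1 open_slit_plane assms c1 Re_less_1_slit_plane)
qed

lemma gauss_2F1_raise_c:
  assumes "c \<notin> \<int>\<^sub>\<le>\<^sub>0" "z \<in> slit_plane"
  shows "gauss_2F1 a b c z = gauss_2F1 a b (c + 1) z
           + z / c * (a * b / (c + 1)) * gauss_2F1 (a + 1) (b + 1) (c + 1 + 1) z"
proof -
  have c1: "c + 1 \<notin> \<int>\<^sub>\<le>\<^sub>0" using nonpos_Ints_add_of_nat_cancel[OF assms(1), of 1] by simp
  have "gauss_2F1 a b c z = gauss_2F1 a b (c + 1) z + 1 / c * (z * deriv (gauss_2F1 a b (c + 1)) z)"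
  proof (rule fps_expansion_identity[OF open_slit_plane connected_slit_plane,
            where f = "gauss_2F1 a b c"
              and g = "\<lambda>z. gauss_2F1 a b (c + 1) z + 1 / c * (z * deriv (gauss_2F1 a b (c + 1)) z)"])
    show "(\<lambda>z. gauss_2F1 a b (c + 1) z + 1 / c * (z * deriv (gauss_2F1 a b (c + 1)) z))
            has_fps_expansion gauss_fps a b c"
      using gauss_continuation_lower_c[OF assms(1) gauss_continuation_gauss_2F1[OF c1]]
      by (simp add: gauss_continuation_def)
  qed (auto intro!: holomorphic_intros holomorphic_gauss_2F1 gauss_2F1_has_expansion open_slit_plane
         assms c1 Re_less_1_slit_plane)
  thus ?thesis by (simp add: deriv_gauss_2F1 c1 assms)
qed

section \<open>Pfaff's transformation\<close>

text \<open>The expansion of \<open>(1 - z)^(- a)\<close> at 0.\<close>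
definition pochhammer_fps :: "complex \<Rightarrow> complex fps" where
  "pochhammer_fps a = Abs_fps (\<lambda>n. pochhammer a n / fact n)"

lemma pochhammer_fps_conv_compose: "pochhammer_fps a = fps_compose (fps_binomial (- a)) (- fps_X)"
proof (rule fps_ext)
  fix n
  have m: "(-1) ^ n * (-1 :: complex) ^ n = 1" by (simp flip: power_mult_distrib)
  show "fps_nth (pochhammer_fps a) n = fps_nth (fps_compose (fps_binomial (- a)) (- fps_X)) n"
    using m by (simp add: fps_compose_uminus' pochhammer_fps_def gbinomial_pochhammer)
qed

lemma pochhammer_fps_add: "pochhammer_fps a * pochhammer_fps b = pochhammer_fps (a + b)"
proof -
  have "pochhammer_fps a * pochhammer_fps b =
          fps_compose (fps_binomial (- a) * fps_binomial (- b)) (- fps_X)"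
    unfolding pochhammer_fps_conv_compose by (rule fps_compose_mult_distrib [symmetric]) auto
  also have "fps_binomial (- a) * fps_binomial (- b) = fps_binomial (- a + - b)"
    by (rule fps_binomial_add_mult [symmetric])
  finally show ?thesis by (simp add: pochhammer_fps_conv_compose)
qed

lemma pochhammer_fps_power: "pochhammer_fps a ^ i = pochhammer_fps (of_nat i * a)"
proof (induction i)
  case 0
  show ?case by (rule fps_ext) (auto simp: pochhammer_fps_def pochhammer_0_left)
next
  case (Suc i)
  thus ?case by (simp add: pochhammer_fps_add algebra_simps)
qed

lemma pochhammer_fps_has_expansion: "(\<lambda>z. (1 - z) powr (- a)) has_fps_expansion pochhammer_fps a"
proof -
  have "((\<lambda>z. (1 + z) powr (- a)) \<circ> (\<lambda>z. - z)) has_fps_expansion fps_compose (fps_binomial (- a)) (- fps_X)"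
    by (rule has_fps_expansion_compose) (auto intro!: fps_expansion_intros)
  thus ?thesis by (simp add: o_def pochhammer_fps_conv_compose)
qed

lemma pochhammer_minus_of_nat:
  assumes "i \<le> N"
  shows "pochhammer (- of_nat N) i = ((-1) ^ i * fact N / fact (N - i) :: complex)"
proof -
  have "pochhammer (- of_nat N) i = (-1) ^ i * pochhammer (of_nat N - of_nat i + 1 :: complex) i"
    by (rule pochhammer_minus)
  also have "(of_nat N - of_nat i + 1 :: complex) = 1 + of_nat (N - i)"
    using assms by (simp add: of_nat_diff)
  also have "pochhammer (1 + of_nat (N - i)) i = (fact N / fact (N - i) :: complex)"
    using pochhammer_product'[of "1 :: complex" "N - i" i] assms
    by (simp add: pochhammer_fact [symmetric] field_simps)
  finally show ?thesis by simp
qed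

text \<open>Here \<open>- X (1 - X)^(- 1)\<close> is the expansion of \<open>z / (z - 1)\<close>. Comparing coefficients of \<open>X^N\<close> leaves a
  terminating Gauss sum with upper parameter \<open>- N\<close>, which is the Chu-Vandermonde sum.\<close>
lemma Pfaff_fps:
  assumes "c \<notin> \<int>\<^sub>\<le>\<^sub>0"
  shows "pochhammer_fps a * fps_compose (gauss_fps a (c - b) c) (- (fps_X * pochhammer_fps 1)) = gauss_fps a b c"
proof (rule fps_ext)
  fix N
  let ?Z = "- (fps_X * pochhammer_fps 1)"
  let ?H = "fps_nth (gauss_fps a (c - b) c)"
  have pow: "?Z ^ i * pochhammer_fps a = fps_const ((-1) ^ i) * (fps_X ^ i * pochhammer_fps (a + of_nat i))" for i
    by (simp add: power_minus[of "fps_X * _"] power_mult_distrib pochhammer_fps_power pochhammer_fps_add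
          mult.assoc add.commute fps_const_power[symmetric] fps_const_neg[symmetric] del: fps_const_power fps_const_neg)
  have powN: "fps_nth (?Z ^ i * pochhammer_fps a) N = (if i \<le> N then (-1) ^ i * (pochhammer (a + of_nat i) (N - i) / fact (N - i)) else 0)" for i
    unfolding pow fps_mult_left_const_nth fps_X_power_mult_nth by (auto simp: pochhammer_fps_def)
  have Z0: "fps_nth (?Z ^ i) j = 0" if "j < i" for i j
    using startsby_zero_power_prefix[of ?Z i] that by auto
  have "fps_nth (pochhammer_fps a * fps_compose (gauss_fps a (c - b) c) ?Z) N =
        fps_nth (fps_compose (gauss_fps a (c - b) c) ?Z * pochhammer_fps a) N"
    by (simp only: mult.commute)
  also have "\<dots> = (\<Sum>j=0..N. (\<Sum>i=0..j. ?H i * fps_nth (?Z ^ i) j) * fps_nth (pochhammer_fps a) (N - j))"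
    by (simp add: fps_mult_nth fps_compose_nth)
  also have "\<dots> = (\<Sum>j=0..N. (\<Sum>i=0..N. ?H i * fps_nth (?Z ^ i) j) * fps_nth (pochhammer_fps a) (N - j))"
  proof (intro sum.cong refl)
    fix j assume j: "j \<in> {0..N}"
    have "?H i * fps_nth (?Z ^ i) j = 0" if "i \<in> {0..N} - {0..j}" for i
      using Z0[of j i] that by simp
    hence "(\<Sum>i=0..j. ?H i * fps_nth (?Z ^ i) j) = (\<Sum>i=0..N. ?H i * fps_nth (?Z ^ i) j)"
      using j by (intro sum.mono_neutral_left) auto
    thus "(\<Sum>i=0..j. ?H i * fps_nth (?Z ^ i) j) * fps_nth (pochhammer_fps a) (N - j) =
          (\<Sum>i=0..N. ?H i * fps_nth (?Z ^ i) j) * fps_nth (pochhammer_fps a) (N - j)" by simp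
  qed
  also have "\<dots> = (\<Sum>i=0..N. ?H i * fps_nth (?Z ^ i * pochhammer_fps a) N)"
    unfolding sum_distrib_right by (subst sum.swap) (simp add: fps_mult_nth sum_distrib_left mult.assoc)
  also have "\<dots> = (\<Sum>i=0..N. pochhammer a N / fact N *
                     (pochhammer (c - b) i * pochhammer (- of_nat N) i / (of_nat (fact i) * pochhammer c i)))"
  proof (intro sum.cong refl)
    fix i assume i: "i \<in> {0..N}"
    have "pochhammer a N = pochhammer a i * pochhammer (a + of_nat i) (N - i)"
      using i by (intro pochhammer_product) auto
    thus "?H i * fps_nth (?Z ^ i * pochhammer_fps a) N = pochhammer a N / fact N *
              (pochhammer (c - b) i * pochhammer (- of_nat N) i / (of_nat (fact i) * pochhammer c i))"
      unfolding powN using i by (simp add: gauss_fps_def pochhammer_minus_of_nat field_simps)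
  qed
  also have "\<dots> = pochhammer a N / fact N * (pochhammer (c - (c - b)) N / pochhammer c N)"
    unfolding sum_distrib_left [symmetric]
    using assms by (subst Vandermonde_pochhammer) auto
  also have "\<dots> = fps_nth (gauss_fps a b c) N" by (simp add: gauss_fps_def)
  finally show "fps_nth (pochhammer_fps a * fps_compose (gauss_fps a (c - b) c) ?Z) N = fps_nth (gauss_fps a b c) N" .
qed

lemma norm_Pfaff_argument_less_1:
  assumes "Re z < 1 / 2"
  shows "norm (z / (z - 1)) < 1"
proof -
  have "(norm z)\<^sup>2 < (norm (z - 1))\<^sup>2"
    using assms unfolding cmod_power2 by (simp add: power2_eq_square algebra_simps)
  hence "norm z < norm (z - 1)" by (rule power2_less_imp_less) auto
  thus ?thesis by (simp add: norm_divide divide_less_eq)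
qed

text \<open>The half-plane \<open>Re z < 1/2\<close> is where \<open>z / (z - 1)\<close> lies in the unit disc; it contains the negative
  real axis, on which the Gauss functions in \<open>F\<^sub>3\<close> are evaluated.\<close>
theorem Pfaff_transformation:
  assumes "c \<notin> \<int>\<^sub>\<le>\<^sub>0" "Re z < 1 / 2"
  shows "gauss_2F1 a b c z = (1 - z) powr (- a) * eval_fps (gauss_fps a (c - b) c) (z / (z - 1))"
proof -
  let ?S = "{z. Re z < 1 / 2}"
  have S: "?S \<subseteq> slit_plane" by (auto intro: Re_less_1_slit_plane)
  show ?thesis
  proof (rule fps_expansion_identity[where S = ?S and f = "gauss_2F1 a b c" and F = "gauss_fps a b c"
             and g = "\<lambda>z. (1 - z) powr (- a) * eval_fps (gauss_fps a (c - b) c) (z / (z - 1))"])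
    show "open ?S" by (rule open_halfspace_Re_lt)
    show "connected ?S" by (intro convex_connected convex_halfspace_Re_lt)
    show "gauss_2F1 a b c holomorphic_on ?S"
      using holomorphic_on_subset[OF holomorphic_gauss_2F1[OF assms(1)] S] .
    show "gauss_2F1 a b c has_fps_expansion gauss_fps a b c"
      by (rule gauss_2F1_has_expansion[OF assms(1)])
    have "(eval_fps (gauss_fps a (c - b) c) \<circ> (\<lambda>z. z / (z - 1))) holomorphic_on ?S"
      by (rule holomorphic_on_compose_gen[OF _ holomorphic_gauss_fps[OF assms(1)]])
         (auto intro!: holomorphic_intros norm_Pfaff_argument_less_1 simp del: norm_divide)
    thus "(\<lambda>z. (1 - z) powr (- a) * eval_fps (gauss_fps a (c - b) c) (z / (z - 1))) holomorphic_on ?S"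
      using S by (intro holomorphic_intros) (auto simp: o_def slit_plane_iff)
    have "(\<lambda>z. - (z * (1 - z) powr (- 1))) has_fps_expansion - (fps_X * pochhammer_fps 1)"
      by (intro fps_expansion_intros pochhammer_fps_has_expansion)
    hence "(eval_fps (gauss_fps a (c - b) c) \<circ> (\<lambda>z. - (z * (1 - z) powr (- 1)))) has_fps_expansion
             fps_compose (gauss_fps a (c - b) c) (- (fps_X * pochhammer_fps 1))"
      by (intro has_fps_expansion_compose gauss_fps_has_expansion[OF assms(1)]) auto
    moreover have "- (z * (1 - z) powr (- 1)) = z / (z - 1)" for z :: complex
      by (cases "z = 1") (simp_all add: powr_minus divide_simps, simp add: algebra_simps)
    ultimately have "(\<lambda>z. eval_fps (gauss_fps a (c - b) c) (z / (z - 1))) has_fps_expansion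
             fps_compose (gauss_fps a (c - b) c) (- (fps_X * pochhammer_fps 1))"
      by (simp add: o_def)
    from has_fps_expansion_mult[OF pochhammer_fps_has_expansion[of a] this]
    show "(\<lambda>z. (1 - z) powr (- a) * eval_fps (gauss_fps a (c - b) c) (z / (z - 1))) has_fps_expansion gauss_fps a b c"
      unfolding Pfaff_fps[OF assms(1)] .
  qed (use assms in auto)
qed

section \<open>A bound for the Gauss function that is uniform in a shifted lower parameter\<close>

text \<open>The weights are at most a constant times the coefficients of the binomial series for
  \<open>(1 - q)^(- r)\<close>.\<close>
lemma binomial_weight_sum_bound:
  fixes r :: real
  assumes "r > 0"
  obtains C where "C > 0"
    "\<And>q. 0 \<le> q \<Longrightarrow> q < 1 \<Longrightarrow> summable (\<lambda>n. (real n + 1) powr (r - 1) * q ^ n)"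
    "\<And>q. 0 \<le> q \<Longrightarrow> q < 1 \<Longrightarrow> (\<Sum>n. (real n + 1) powr (r - 1) * q ^ n) \<le> C * (1 - q) powr (- r)"
proof -
  have "complex_of_real r \<notin> \<int>\<^sub>\<le>\<^sub>0" using assms by (intro Re_pos_not_nonpos_Int) auto
  from pochhammer_lower_bound[OF this] obtain C where C: "C > 0"
    "\<And>n. inverse (norm (pochhammer (complex_of_real r) n)) \<le> C * (real n + 1) powr (1 - r) / fact n" by auto
  have pos: "pochhammer r n > 0" for n using assms by (rule pochhammer_pos)
  have le: "(real n + 1) powr (r - 1) \<le> C * (pochhammer r n / fact n)" for n
  proof -
    have "norm (pochhammer (complex_of_real r) n) = pochhammer r n"
      using pos[of n] by (simp add: pochhammer_of_real)
    hence "inverse (pochhammer r n) \<le> C * (real n + 1) powr (1 - r) / fact n" using C(2)[of n] by simp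
    moreover have "(real n + 1) powr (1 - r) = inverse ((real n + 1) powr (r - 1))"
      by (simp flip: powr_minus)
    ultimately have "inverse (pochhammer r n) \<le> C * inverse ((real n + 1) powr (r - 1)) / fact n"
      by simp
    hence "(real n + 1) powr (r - 1) * pochhammer r n * inverse (pochhammer r n) \<le>
           (real n + 1) powr (r - 1) * pochhammer r n * (C * inverse ((real n + 1) powr (r - 1)) / fact n)"
      using pos[of n] by (intro mult_left_mono) auto
    also have "\<dots> = C * (pochhammer r n / fact n) * ((real n + 1) powr (r - 1) * inverse ((real n + 1) powr (r - 1)))"
      by simp
    also have "(real n + 1) powr (r - 1) * inverse ((real n + 1) powr (r - 1)) = 1"
      by (intro right_inverse) simp
    finally show ?thesis using pos[of n] by (simp only: mult.assoc right_inverse[OF less_imp_neq[OF pos, symmetric]] mult_1_right)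
  qed
  have sums: "(\<lambda>n. C * (pochhammer r n / fact n * q ^ n)) sums (C * (1 - q) powr (- r))" if q: "0 \<le> q" "q < 1" for q
  proof -
    have "(\<lambda>n. pochhammer (complex_of_real r) n / fact n * of_real q ^ n) sums ((1 - of_real q) powr (- of_real r))"
      by (rule pochhammer_binomial_series) (use q in auto)
    also have "(\<lambda>n. pochhammer (complex_of_real r) n / fact n * of_real q ^ n) = (\<lambda>n. of_real (pochhammer r n / fact n * q ^ n))"
      by (simp add: pochhammer_of_real)
    also have "(1 - of_real q) powr (- complex_of_real r) = of_real ((1 - q) powr (- r))"
      using q powr_of_real[of "1 - q" "- r"] by simp
    finally have "(\<lambda>n. pochhammer r n / fact n * q ^ n) sums ((1 - q) powr (- r))"
      by (simp only: sums_of_real_iff)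
    thus ?thesis by (rule sums_mult)
  qed
  have le': "(real n + 1) powr (r - 1) * q ^ n \<le> C * (pochhammer r n / fact n * q ^ n)" if "0 \<le> q" for q n
    using mult_right_mono[OF le[of n], of "q ^ n"] that by (simp add: mult.assoc)
  have summable: "summable (\<lambda>n. (real n + 1) powr (r - 1) * q ^ n)" if q: "0 \<le> q" "q < 1" for q
    by (rule summable_comparison_test[OF _ sums_summable[OF sums[OF q]]]) (use le' q in auto)
  moreover have "(\<Sum>n. (real n + 1) powr (r - 1) * q ^ n) \<le> C * (1 - q) powr (- r)" if q: "0 \<le> q" "q < 1" for q
    unfolding sums_unique[OF sums[OF q]]
    by (intro suminf_le le' q summable sums_summable[OF sums])
  ultimately show ?thesis using that C(1) by blast
qed

text \<open>Each index \<open>n\<close> is compared with the index \<open>y\<close>: for \<open>n \<ge> y\<close> the weight is at most its value at \<open>y\<close>,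
  and for smaller \<open>n\<close> the quotient \<open>(M + y) / (M + n)\<close> is at most \<open>(1 + y) / (1 + n)\<close> since \<open>M \<ge> 1\<close>.\<close>
lemma shifted_weight_le:
  fixes M y e :: real
  assumes "M \<ge> 1" "y \<ge> 0" "e \<ge> 0"
  shows "(M / (M + real n)) powr e \<le> (1 + y / M) powr (- e) * (1 + ((1 + y) / (real n + 1)) powr e)"
proof -
  define x where "x = inverse (1 + y / M)"
  define w where "w = max 1 ((1 + y) / (real n + 1))"
  have x: "x > 0" using assms by (simp add: x_def add_pos_nonneg)
  have w: "w > 0" by (simp add: w_def)
  have "(M + y) \<le> w * (M + real n)"
  proof (cases "y \<le> real n")
    case True
    hence "1 * (M + y) \<le> w * (M + real n)" using assms by (intro mult_mono) (auto simp: w_def)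
    thus ?thesis by simp
  next
    case False
    have "(M + y) * (real n + 1) \<le> (1 + y) * (M + real n)"
    proof -
      have "0 \<le> (M - 1) * (y - real n)" using assms False by simp
      thus ?thesis by (simp add: algebra_simps)
    qed
    hence "M + y \<le> (1 + y) / (real n + 1) * (M + real n)" by (simp add: field_simps)
    also have "\<dots> \<le> w * (M + real n)" using assms by (intro mult_right_mono) (auto simp: w_def)
    finally show ?thesis .
  qed
  hence "M / (M + real n) \<le> x * w"
    using assms x by (simp add: x_def divide_simps add_pos_nonneg)
  hence "(M / (M + real n)) powr e \<le> (x * w) powr e"
    using assms by (intro powr_mono2) auto
  also have "\<dots> = x powr e * w powr e" using x w by (simp add: powr_mult)
  also have "x powr e = (1 + y / M) powr (- e)"
    using assms by (simp add: x_def powr_minus inverse_powr add_nonneg_nonneg)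
  also have "w powr e \<le> 1 + ((1 + y) / (real n + 1)) powr e"
    using assms by (auto simp: w_def max_def)
  finally show ?thesis by (simp add: mult_left_mono)
qed

text \<open>With \<open>q = y / (1 + y)\<close> the main contribution to the sum comes from indices of size about \<open>1 + y\<close>; the
  factor \<open>(1 + y / M)^(- e)\<close> is the size of the additional weight there. The condition \<open>e < r\<close> keeps
  the smaller indices from dominating.\<close>
lemma shifted_binomial_weight_sum_bound:
  fixes r e :: real
  assumes "0 \<le> e" "e < r"
  obtains C where "C > 0"
    "\<And>M y. M \<ge> 1 \<Longrightarrow> y \<ge> 0 \<Longrightarrow> summable (\<lambda>n. (real n + 1) powr (r - 1) * (M / (M + real n)) powr e * (y / (1 + y)) ^ n)"
    "\<And>M y. M \<ge> 1 \<Longrightarrow> y \<ge> 0 \<Longrightarrow> (\<Sum>n. (real n + 1) powr (r - 1) * (M / (M + real n)) powr e * (y / (1 + y)) ^ n)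
        \<le> C * (1 + y) powr r * (1 + y / M) powr (- e)"
proof -
  from assms have "r > 0" "r - e > 0" by auto
  from binomial_weight_sum_bound[OF this(1)] obtain C1 where C1: "C1 > 0"
    "\<And>q. 0 \<le> q \<Longrightarrow> q < 1 \<Longrightarrow> summable (\<lambda>n. (real n + 1) powr (r - 1) * q ^ n)"
    "\<And>q. 0 \<le> q \<Longrightarrow> q < 1 \<Longrightarrow> (\<Sum>n. (real n + 1) powr (r - 1) * q ^ n) \<le> C1 * (1 - q) powr (- r)" by blast
  from binomial_weight_sum_bound[OF \<open>r - e > 0\<close>] obtain C2 where C2: "C2 > 0"
    "\<And>q. 0 \<le> q \<Longrightarrow> q < 1 \<Longrightarrow> summable (\<lambda>n. (real n + 1) powr (r - e - 1) * q ^ n)"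
    "\<And>q. 0 \<le> q \<Longrightarrow> q < 1 \<Longrightarrow> (\<Sum>n. (real n + 1) powr (r - e - 1) * q ^ n) \<le> C2 * (1 - q) powr (- (r - e))" by blast
  have main: "summable (\<lambda>n. (real n + 1) powr (r - 1) * (M / (M + real n)) powr e * (y / (1 + y)) ^ n) \<and>
     (\<Sum>n. (real n + 1) powr (r - 1) * (M / (M + real n)) powr e * (y / (1 + y)) ^ n)
        \<le> (C1 + C2) * (1 + y) powr r * (1 + y / M) powr (- e)"
    if My: "M \<ge> 1" "y \<ge> 0" for M y
  proof -
    define q where "q = y / (1 + y)"
    have q: "0 \<le> q" "q < 1" "1 - q = 1 / (1 + y)" using My by (auto simp: q_def field_simps)
    have pq: "(1 - q) powr (- s) = (1 + y) powr s" for s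
      using My by (simp add: q(3) powr_divide powr_minus field_simps)
    let ?f = "\<lambda>n. (real n + 1) powr (r - 1) * (M / (M + real n)) powr e * q ^ n"
    let ?g = "\<lambda>n. (1 + y / M) powr (- e) * ((real n + 1) powr (r - 1) * q ^ n + (1 + y) powr e * ((real n + 1) powr (r - e - 1) * q ^ n))"
    have le: "?f n \<le> ?g n" for n
    proof -
      have "?f n \<le> (real n + 1) powr (r - 1) * ((1 + y / M) powr (- e) * (1 + ((1 + y) / (real n + 1)) powr e)) * q ^ n"
        using My assms q by (intro mult_right_mono mult_left_mono shifted_weight_le) auto
      also have "\<dots> = ?g n"
      proof -
        have "(real n + 1) powr (r - 1) * ((1 + y) / (real n + 1)) powr e = (1 + y) powr e * (real n + 1) powr (r - e - 1)"
        proof -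
          have "(real n + 1) powr (r - e - 1) = (real n + 1) powr (r - 1) / (real n + 1) powr e"
            by (subst powr_diff [symmetric]) (simp add: algebra_simps)
          thus ?thesis using My by (simp add: powr_divide)
        qed
        thus ?thesis by (simp add: algebra_simps)
      qed
      finally show ?thesis .
    qed
    have sg: "summable ?g"
      by (intro summable_mult summable_add C1 C2 q)
    have sf: "summable ?f"
      by (rule summable_comparison_test[OF _ sg]) (use le q in auto)
    have "(\<Sum>n. ?f n) \<le> (\<Sum>n. ?g n)" by (intro suminf_le le sf sg)
    also have "\<dots> = (1 + y / M) powr (- e) * ((\<Sum>n. (real n + 1) powr (r - 1) * q ^ n)
                     + (1 + y) powr e * (\<Sum>n. (real n + 1) powr (r - e - 1) * q ^ n))"
      by (rule sums_unique [symmetric], intro sums_mult sums_add summable_sums C1 C2 q)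
    also have "\<dots> \<le> (1 + y / M) powr (- e) * (C1 * (1 + y) powr r + (1 + y) powr e * (C2 * (1 + y) powr (r - e)))"
      using C1(3)[OF q(1,2)] C2(3)[OF q(1,2)] unfolding pq
      by (intro mult_left_mono add_mono) auto
    also have "\<dots> = (C1 + C2) * (1 + y) powr r * (1 + y / M) powr (- e)"
    proof -
      have "(1 + y) powr e * (1 + y) powr (r - e) = (1 + y) powr r" by (simp flip: powr_add)
      thus ?thesis by (simp add: algebra_simps)
    qed
    finally show ?thesis using sf by (simp add: q_def)
  qed
  show ?thesis using main C1(1) C2(1) by (intro that[of "C1 + C2"]) auto
qed

text \<open>For large \<open>m\<close> the function depends on \<open>y\<close> mainly through \<open>y / m\<close>, and for large \<open>y\<close> it is at most
  of the order of the larger one of \<open>y^(- a)\<close> and \<open>y^(- b)\<close>, up to logarithms; hence this shape of the bound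
  and the range \<open>e < min (Re a) (Re b)\<close> in which it will be proved.\<close>
definition gauss_2F1_uniform_bound :: "complex \<Rightarrow> complex \<Rightarrow> complex \<Rightarrow> real \<Rightarrow> bool" where
  "gauss_2F1_uniform_bound a b c e \<longleftrightarrow> (\<exists>C>0. \<forall>m y. y \<ge> 0 \<longrightarrow>
     norm (gauss_2F1 a b (c + of_nat m) (- of_real y)) \<le> C * (1 + y / (real m + 1)) powr (- e))"

text \<open>Writing \<open>(z + m)\<^sub>n = (z)\<^sub>m\<^sub>+\<^sub>n / (z)\<^sub>m\<close> in numerator and denominator reduces the estimate, uniform in
  both indices, to bounds for Pochhammer symbols of fixed argument.\<close>
lemma pochhammer_quotient_bound:
  assumes "c \<notin> \<int>\<^sub>\<le>\<^sub>0" "c - b \<notin> \<int>\<^sub>\<le>\<^sub>0"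
  obtains K where "K > 0" "\<And>m n. norm (pochhammer (c - b + of_nat m) n / pochhammer (c + of_nat m) n)
     \<le> K * ((real m + 1) / (real m + 1 + real n)) powr Re b"
proof -
  obtain C1 where C1: "C1 > 0" "\<And>n. norm (pochhammer (c - b) n) \<le> C1 * fact n * (real n + 1) powr (Re (c - b) - 1)"
    using pochhammer_upper_bound by blast
  obtain C2 where C2: "C2 > 0" "\<And>n. norm (pochhammer c n) \<le> C2 * fact n * (real n + 1) powr (Re c - 1)"
    using pochhammer_upper_bound by blast
  obtain C3 where C3: "C3 > 0" "\<And>n. inverse (norm (pochhammer (c - b) n)) \<le> C3 * (real n + 1) powr (1 - Re (c - b)) / fact n"
    using pochhammer_lower_bound[OF assms(2)] by blast
  obtain C4 where C4: "C4 > 0" "\<And>n. inverse (norm (pochhammer c n)) \<le> C4 * (real n + 1) powr (1 - Re c) / fact n"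
    using pochhammer_lower_bound[OF assms(1)] by blast
  show ?thesis
  proof (rule that[of "C1 * C2 * C3 * C4"])
    fix m n
    let ?p = "real m + 1" and ?q = "real (m + n) + 1"
    have nz: "pochhammer c m \<noteq> 0" "pochhammer (c - b) m \<noteq> 0" "pochhammer c (m + n) \<noteq> 0"
      using assms pochhammer_eq_0_imp_nonpos_Int by blast+
    have nz': "pochhammer (c + of_nat m) n \<noteq> 0" using nz(3) by (simp add: pochhammer_product')
    have "pochhammer (c - b + of_nat m) n / pochhammer (c + of_nat m) n =
       pochhammer (c - b) (m + n) * inverse (pochhammer (c - b) m) * (pochhammer c m * inverse (pochhammer c (m + n)))"
      using nz nz' unfolding pochhammer_product' by (simp add: field_simps)
    hence "norm (pochhammer (c - b + of_nat m) n / pochhammer (c + of_nat m) n) =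
       norm (pochhammer (c - b) (m + n)) * inverse (norm (pochhammer (c - b) m)) *
        (norm (pochhammer c m) * inverse (norm (pochhammer c (m + n))))"
      by (simp add: norm_mult norm_inverse)
    also have "\<dots> \<le> (C1 * fact (m + n) * ?q powr (Re (c - b) - 1)) * (C3 * ?p powr (1 - Re (c - b)) / fact m) *
       ((C2 * fact m * ?p powr (Re c - 1)) * (C4 * ?q powr (1 - Re c) / fact (m + n)))"
      using C1(1) C2(1) C3(1) C4(1)
      by (intro mult_mono C1 C2 C3 C4 mult_nonneg_nonneg) auto
    also have "\<dots> = C1 * C2 * C3 * C4 * ((?q powr (Re (c - b) - 1) * ?q powr (1 - Re c)) * (?p powr (1 - Re (c - b)) * ?p powr (Re c - 1)))"
      by (simp add: field_simps)
    also have "?q powr (Re (c - b) - 1) * ?q powr (1 - Re c) = ?q powr (- Re b)"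
      by (simp flip: powr_add)
    also have "?p powr (1 - Re (c - b)) * ?p powr (Re c - 1) = ?p powr Re b"
      by (simp flip: powr_add)
    also have "?q powr (- Re b) * ?p powr Re b = (?p / (?p + real n)) powr Re b"
      by (simp add: powr_divide powr_minus_divide add_ac)
    finally show "norm (pochhammer (c - b + of_nat m) n / pochhammer (c + of_nat m) n)
      \<le> C1 * C2 * C3 * C4 * (?p / (?p + real n)) powr Re b" .
  qed (use C1 C2 C3 C4 in auto)
qed

text \<open>For \<open>z = - y\<close> the Pfaff series has the argument \<open>y / (1 + y)\<close>, and the absolute values of its terms
  are the weights estimated above. The prefactor \<open>(1 + y)^(- a)\<close> cancels the growth of their sum.\<close>
lemma gauss_2F1_uniform_bound_Pfaff:
  assumes "0 \<le> e" "e < Re a" "e \<le> Re b" "0 < Re c" "Re b < Re c"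
  shows "gauss_2F1_uniform_bound a b c e"
proof -
  have c: "c \<notin> \<int>\<^sub>\<le>\<^sub>0" and cb: "c - b \<notin> \<int>\<^sub>\<le>\<^sub>0" using assms by (auto intro!: Re_pos_not_nonpos_Int)
  obtain A where A: "A > 0" "\<And>n. norm (pochhammer a n) \<le> A * fact n * (real n + 1) powr (Re a - 1)"
    using pochhammer_upper_bound by blast
  obtain K where K: "K > 0" "\<And>m n. norm (pochhammer (c - b + of_nat m) n / pochhammer (c + of_nat m) n)
     \<le> K * ((real m + 1) / (real m + 1 + real n)) powr Re b"
    using pochhammer_quotient_bound[OF c cb] by blast
  obtain S where S: "S > 0"
    "\<And>M y. M \<ge> 1 \<Longrightarrow> y \<ge> 0 \<Longrightarrow> summable (\<lambda>n. (real n + 1) powr (Re a - 1) * (M / (M + real n)) powr e * (y / (1 + y)) ^ n)"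
    "\<And>M y. M \<ge> 1 \<Longrightarrow> y \<ge> 0 \<Longrightarrow> (\<Sum>n. (real n + 1) powr (Re a - 1) * (M / (M + real n)) powr e * (y / (1 + y)) ^ n)
        \<le> S * (1 + y) powr Re a * (1 + y / M) powr (- e)"
    using shifted_binomial_weight_sum_bound[OF assms(1,2)] by blast
  have "norm (gauss_2F1 a b (c + of_nat m) (- of_real y)) \<le> (A * K * S) * (1 + y / (real m + 1)) powr (- e)"
    if y: "y \<ge> 0" for m y
  proof -
    define M where "M = real m + 1"
    define q where "q = y / (1 + y)"
    define w where "w n = (real n + 1) powr (Re a - 1) * (M / (M + real n)) powr e * q ^ n" for n
    have M: "M \<ge> 1" by (simp add: M_def)
    have q: "0 \<le> q" using y by (simp add: q_def)
    have cm: "c + of_nat m \<notin> \<int>\<^sub>\<le>\<^sub>0" by (rule nonpos_Ints_add_of_nat_cancel[OF c])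
    have sw: "summable w" unfolding w_def q_def by (rule S(2)[OF M y])
    have coeff: "norm (fps_nth (gauss_fps a (c + of_nat m - b) (c + of_nat m)) n * of_real q ^ n) \<le> A * K * w n" for n
    proof -
      have eq: "c + of_nat m - b = c - b + of_nat m" by simp
      have "norm (fps_nth (gauss_fps a (c + of_nat m - b) (c + of_nat m)) n * of_real q ^ n) =
         (norm (pochhammer a n) / fact n) * norm (pochhammer (c - b + of_nat m) n / pochhammer (c + of_nat m) n) * q ^ n"
        using q unfolding eq by (simp add: gauss_fps_def norm_mult norm_divide norm_power mult_ac)
      also have "\<dots> \<le> (A * (real n + 1) powr (Re a - 1)) * (K * (M / (M + real n)) powr e) * q ^ n"
      proof (intro mult_right_mono mult_mono)
        show "norm (pochhammer a n) / fact n \<le> A * (real n + 1) powr (Re a - 1)"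
          using A(2)[of n] by (simp add: divide_le_eq mult_ac)
        have "(M / (M + real n)) powr Re b \<le> (M / (M + real n)) powr e"
          using M assms by (intro powr_mono') auto
        thus "norm (pochhammer (c - b + of_nat m) n / pochhammer (c + of_nat m) n) \<le> K * (M / (M + real n)) powr e"
          using order_trans[OF K(2)[of m n] mult_left_mono, of "(M / (M + real n)) powr e"] K(1)
          by (simp add: M_def add_ac)
      qed (use A K q in auto)
      also have "\<dots> = A * K * w n" by (simp add: w_def mult_ac)
      finally show ?thesis .
    qed
    have "norm (eval_fps (gauss_fps a (c + of_nat m - b) (c + of_nat m)) (of_real q)) \<le> (\<Sum>n. A * K * w n)"
      unfolding eval_fps_def by (rule norm_suminf_le[OF coeff summable_mult[OF sw]])
    also have "\<dots> = A * K * (\<Sum>n. w n)" by (rule suminf_mult[OF sw])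
    also have "\<dots> \<le> A * K * (S * (1 + y) powr Re a * (1 + y / M) powr (- e))"
      unfolding w_def q_def using A K by (intro mult_left_mono S(3) M y) auto
    finally have ev: "norm (eval_fps (gauss_fps a (c + of_nat m - b) (c + of_nat m)) (of_real q))
       \<le> A * K * (S * (1 + y) powr Re a * (1 + y / M) powr (- e))" .
    have "- complex_of_real y / (- of_real y - 1) = of_real q"
    proof -
      have "- complex_of_real y / (- of_real y - 1) = of_real (- y / (- y - 1))" by simp
      also have "- y / (- y - 1) = q" using y by (simp add: q_def divide_simps, simp add: algebra_simps)
      finally show ?thesis .
    qed
    hence "gauss_2F1 a b (c + of_nat m) (- of_real y) =
        (1 + of_real y) powr (- a) * eval_fps (gauss_fps a (c + of_nat m - b) (c + of_nat m)) (of_real q)"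
      using Pfaff_transformation[OF cm, of "- of_real y" a b] y by simp
    moreover have "norm ((1 + complex_of_real y) powr (- a)) = (1 + y) powr (- Re a)"
      using norm_powr_real_powr[of "1 + y" "- a"] y by simp
    ultimately have "norm (gauss_2F1 a b (c + of_nat m) (- of_real y)) \<le>
        (1 + y) powr (- Re a) * (A * K * (S * (1 + y) powr Re a * (1 + y / M) powr (- e)))"
      using ev by (simp add: norm_mult mult_left_mono)
    also have "\<dots> = ((1 + y) powr (- Re a) * (1 + y) powr Re a) * (A * K * S * (1 + y / M) powr (- e))"
      by (simp add: mult_ac)
    also have "(1 + y) powr (- Re a) * (1 + y) powr Re a = 1" using y by (simp flip: powr_add)
    finally show ?thesis by (simp add: M_def)
  qed
  moreover have "A * K * S > 0" using A K S by simp
  ultimately show ?thesis unfolding gauss_2F1_uniform_bound_def by blast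
qed

text \<open>The factor \<open>z / (c + m)\<close> in the contiguous relation costs one power of \<open>1 + y / (m + 1)\<close>, and
  raising \<open>a\<close> and \<open>b\<close> by one gains it.\<close>
lemma gauss_2F1_uniform_bound_lower_c:
  assumes "Re c > 0" "gauss_2F1_uniform_bound a b (c + 1) e"
    and "gauss_2F1_uniform_bound (a + 1) (b + 1) (c + 2) (e + 1)"
  shows "gauss_2F1_uniform_bound a b c e"
proof -
  obtain C1 where C1: "C1 > 0" "\<And>m y. y \<ge> 0 \<Longrightarrow>
     norm (gauss_2F1 a b (c + 1 + of_nat m) (- of_real y)) \<le> C1 * (1 + y / (real m + 1)) powr (- e)"
    using assms(2) unfolding gauss_2F1_uniform_bound_def by blast
  obtain C2 where C2: "C2 > 0" "\<And>m y. y \<ge> 0 \<Longrightarrow>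
     norm (gauss_2F1 (a + 1) (b + 1) (c + 2 + of_nat m) (- of_real y)) \<le> C2 * (1 + y / (real m + 1)) powr (- (e + 1))"
    using assms(3) unfolding gauss_2F1_uniform_bound_def by blast
  (* Chosen so that the norm of c + m is at least \<kappa> (m + 1) for every m. *)
  define \<kappa> where "\<kappa> = min 1 (Re c)"
  have \<kappa>: "\<kappa> > 0" using assms by (simp add: \<kappa>_def)
  define D where "D = norm (a * b) / \<kappa>"
  have D: "D \<ge> 0" using \<kappa> by (simp add: D_def)
  have "norm (gauss_2F1 a b (c + of_nat m) (- of_real y)) \<le> (C1 + D * C2) * (1 + y / (real m + 1)) powr (- e)"
    if y: "y \<ge> 0" for m y
  proof -
    define Y where "Y = 1 + y / (real m + 1)"
    have Y: "Y > 0" using y by (auto simp: Y_def intro!: add_pos_nonneg)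
    have cm: "c + of_nat m \<notin> \<int>\<^sub>\<le>\<^sub>0" using assms by (intro Re_pos_not_nonpos_Int) auto
    have zS: "- complex_of_real y \<in> slit_plane" using y by (intro Re_less_1_slit_plane) auto
    have n1: "norm (c + of_nat m) \<ge> \<kappa> * (real m + 1)"
    proof -
      have "\<kappa> * real m \<le> 1 * real m" by (intro mult_right_mono) (auto simp: \<kappa>_def)
      hence "\<kappa> * (real m + 1) \<le> Re c + real m" by (simp add: algebra_simps \<kappa>_def)
      also have "\<dots> \<le> norm (c + of_nat m)" using complex_Re_le_cmod[of "c + of_nat m"] by simp
      finally show ?thesis .
    qed
    have n2: "norm (c + of_nat m + 1) \<ge> 1"
      using complex_Re_le_cmod[of "c + of_nat m + 1"] assms by simp
    have "norm (- of_real y / (c + of_nat m) * (a * b / (c + of_nat m + 1)))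
        = y / norm (c + of_nat m) * (norm (a * b) / norm (c + of_nat m + 1))"
      using y by (simp add: norm_mult norm_divide)
    also have "\<dots> \<le> y / (\<kappa> * (real m + 1)) * (norm (a * b) / 1)"
      using n1 n2 y \<kappa> less_le_trans[OF mult_pos_pos[of \<kappa> "real m + 1"] n1]
      by (intro mult_mono divide_left_mono mult_pos_pos) auto
    also have "\<dots> = D * (y / (real m + 1))" by (simp add: D_def)
    also have "\<dots> \<le> D * Y" using D by (intro mult_left_mono) (auto simp: Y_def)
    finally have co: "norm (- of_real y / (c + of_nat m) * (a * b / (c + of_nat m + 1))) \<le> D * Y" .
    have e1: "c + of_nat m + 1 = c + 1 + of_nat m" and e2: "c + of_nat m + 1 + 1 = c + 2 + of_nat m" by auto
    have "norm (gauss_2F1 a b (c + of_nat m) (- of_real y)) \<le>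
       norm (gauss_2F1 a b (c + 1 + of_nat m) (- of_real y)) +
       norm (- of_real y / (c + of_nat m) * (a * b / (c + of_nat m + 1))) *
         norm (gauss_2F1 (a + 1) (b + 1) (c + 2 + of_nat m) (- of_real y))"
      unfolding gauss_2F1_raise_c[OF cm zS] e2 unfolding e1 norm_mult [symmetric] by (rule norm_triangle_ineq)
    also have "\<dots> \<le> C1 * Y powr (- e) + (D * Y) * (C2 * Y powr (- (e + 1)))"
      using C1(2)[OF y, of m] C2(2)[OF y, of m] co D Y C2(1)
      by (intro add_mono mult_mono) (auto simp: Y_def)
    also have "Y * Y powr (- (e + 1)) = Y powr (- e)"
    proof -
      have "Y powr 1 * Y powr (- (e + 1)) = Y powr (- e)" by (subst powr_add [symmetric]) simp
      thus ?thesis using Y by simp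
    qed
    hence "C1 * Y powr (- e) + (D * Y) * (C2 * Y powr (- (e + 1))) = (C1 + D * C2) * Y powr (- e)"
      by (simp add: algebra_simps)
    finally show ?thesis by (simp add: Y_def)
  qed
  moreover have "C1 + D * C2 > 0" using C1 C2 D by (intro add_pos_nonneg) auto
  ultimately show ?thesis unfolding gauss_2F1_uniform_bound_def by blast
qed

text \<open>The derivative is \<open>O(1 / (m + 1))\<close> times the function with raised parameters, and for negative \<open>e\<close>
  the integral of \<open>(1 + y / (m + 1))^(- e - 1) / (m + 1)\<close> is of the order \<open>(1 + y / (m + 1))^(- e)\<close>.
  For negative \<open>e\<close> this also dominates the value 1 at the origin.\<close>
lemma gauss_2F1_uniform_bound_integrate:
  assumes "Re c > 0" "e < 0" "gauss_2F1_uniform_bound (a + 1) (b + 1) (c + 1) (e + 1)"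
  shows "gauss_2F1_uniform_bound a b c e"
proof -
  obtain C where C: "C > 0" "\<And>m y. y \<ge> 0 \<Longrightarrow>
     norm (gauss_2F1 (a + 1) (b + 1) (c + 1 + of_nat m) (- of_real y)) \<le> C * (1 + y / (real m + 1)) powr (- (e + 1))"
    using assms(3) unfolding gauss_2F1_uniform_bound_def by blast
  define \<kappa> where "\<kappa> = min 1 (Re c)"
  have \<kappa>: "\<kappa> > 0" using assms by (simp add: \<kappa>_def)
  define K where "K = norm (a * b) / \<kappa> * C / (- e)"
  have K: "K \<ge> 0"
    unfolding K_def by (intro divide_nonneg_pos mult_nonneg_nonneg) (use \<kappa> C(1) assms(2) in auto)
  have "norm (gauss_2F1 a b (c + of_nat m) (- of_real y)) \<le> (1 + K) * (1 + y / (real m + 1)) powr (- e)"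
    if y: "y \<ge> 0" for m y
  proof -
    define M where "M = real m + 1"
    have M: "M > 0" by (simp add: M_def)
    have cm: "c + of_nat m \<notin> \<int>\<^sub>\<le>\<^sub>0" using assms by (intro Re_pos_not_nonpos_Int) auto
    let ?F = "gauss_2F1 a b (c + of_nat m)"
    let ?f = "\<lambda>t. ?F (- of_real t)"
    let ?g = "\<lambda>t. K * (1 + t / M) powr (- e)"
    have zS: "- complex_of_real t \<in> slit_plane" if "t \<ge> 0" for t
      using that by (intro Re_less_1_slit_plane) auto
    have n1: "norm (c + of_nat m) \<ge> \<kappa> * M"
    proof -
      have "\<kappa> * real m \<le> 1 * real m" by (intro mult_right_mono) (auto simp: \<kappa>_def)
      hence "\<kappa> * M \<le> Re c + real m" by (simp add: algebra_simps \<kappa>_def M_def)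
      also have "\<dots> \<le> norm (c + of_nat m)" using complex_Re_le_cmod[of "c + of_nat m"] by simp
      finally show ?thesis .
    qed
    have f': "(?f has_vector_derivative - deriv ?F (- of_real t)) (at t)" if t: "t \<ge> 0" for t
    proof -
      have "(?F has_field_derivative deriv ?F (- of_real t)) (at (- of_real t))"
        by (rule holomorphic_derivI[OF holomorphic_gauss_2F1[OF cm] open_slit_plane zS[OF t]])
      moreover have "((\<lambda>t. - complex_of_real t) has_vector_derivative - 1) (at t)"
        by (auto intro!: derivative_eq_intros)
      ultimately show ?thesis
        using field_vector_diff_chain_at[of "\<lambda>t. - complex_of_real t" "-1" t ?F] by (simp add: o_def)
    qed
    have g': "(?g has_vector_derivative (norm (a * b) / \<kappa> * C / M) * (1 + t / M) powr (- (e + 1))) (at t)" if t: "t \<ge> 0" for t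
    proof -
      have pos: "1 + t / M > 0" using t M by (intro add_pos_nonneg) auto
      have "(?g has_real_derivative K * ((1 + t / M) powr (- e - 1) * (- e) * (1 / M))) (at t)"
        using pos M by (auto intro!: derivative_eq_intros simp: powr_diff)
      also have "K * ((1 + t / M) powr (- e - 1) * (- e) * (1 / M)) = (norm (a * b) / \<kappa> * C / M) * (1 + t / M) powr (- (e + 1))"
      proof -
        have "- (e + 1) = - e - 1" by simp
        thus ?thesis using assms(2) by (simp only: K_def) (simp add: field_simps)
      qed
      finally show ?thesis by (simp add: has_real_derivative_iff_has_vector_derivative)
    qed
    have "norm (?f y - ?f 0) \<le> ?g y - ?g 0"
    proof (cases "y = 0")
      case False
      hence y0: "0 < y" using y by simp
      show ?thesis
      proof (rule differentiable_bound_general[OF y0])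
        show "continuous_on {0..y} ?f"
          using f' by (intro continuous_at_imp_continuous_on ballI) (auto intro: has_vector_derivative_continuous)
        show "continuous_on {0..y} ?g"
          using g' by (intro continuous_at_imp_continuous_on ballI) (auto intro: has_vector_derivative_continuous)
      next
        fix t assume t: "0 < t" "t < y"
        show "(?f has_vector_derivative - deriv ?F (- of_real t)) (at t)" using f' t by simp
        show "(?g has_vector_derivative (norm (a * b) / \<kappa> * C / M) * (1 + t / M) powr (- (e + 1))) (at t)"
          using g' t by simp
        have e1: "c + of_nat m + 1 = c + 1 + of_nat m" by simp
        have "norm (- deriv ?F (- of_real t)) =
            norm (a * b) / norm (c + of_nat m) * norm (gauss_2F1 (a + 1) (b + 1) (c + 1 + of_nat m) (- of_real t))"
          using t by (subst deriv_gauss_2F1[OF cm zS]) (simp_all add: norm_mult norm_divide e1)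
        also have "\<dots> \<le> norm (a * b) / (\<kappa> * M) * (C * (1 + t / M) powr (- (e + 1)))"
          using n1 \<kappa> M t C(2)[of t m] less_le_trans[OF mult_pos_pos[of \<kappa> M] n1]
          by (intro mult_mono divide_left_mono mult_pos_pos) (auto simp: M_def)
        finally show "norm (- deriv ?F (- of_real t)) \<le> (norm (a * b) / \<kappa> * C / M) * (1 + t / M) powr (- (e + 1))"
          by simp
      qed
    qed auto
    moreover have "?f 0 = 1" using gauss_2F1_0[OF cm] by simp
    ultimately have "norm (?f y - 1) \<le> ?g y" using K by simp
    moreover have "norm (?f y) \<le> norm (?f y - 1) + 1" using norm_triangle_ineq[of "?f y - 1" 1] by simp
    moreover have "1 \<le> (1 + y / M) powr (- e)" using assms(2) y M by (intro ge_one_powr_ge_zero) auto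
    ultimately show ?thesis by (simp add: M_def algebra_simps)
  qed
  moreover have "1 + K > 0" using K by simp
  ultimately show ?thesis unfolding gauss_2F1_uniform_bound_def by blast
qed

theorem gauss_2F1_uniform_bound_general:
  assumes "Re c > 0" "e < Re a" "e < Re b"
  shows "gauss_2F1_uniform_bound a b c e"
proof -
  have nonneg: "gauss_2F1_uniform_bound a b c e"
    if "0 \<le> e" "e < Re a" "e < Re b" "Re c > 0" "Re b < Re c + real l" for a b c e and l :: nat
    using that
  proof (induction l arbitrary: a b c e)
    case 0
    thus ?case by (intro gauss_2F1_uniform_bound_Pfaff) auto
  next
    case (Suc l)
    show ?case
      by (rule gauss_2F1_uniform_bound_lower_c; (rule Suc.IH)?) (use Suc.prems in auto)
  qed
  have nonneg': "gauss_2F1_uniform_bound a b c e"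
    if "0 \<le> e" "e < Re a" "e < Re b" "Re c > 0" for a b c e
  proof -
    obtain l :: nat where "Re b - Re c < real l" using reals_Archimedean2 by blast
    thus ?thesis using that by (intro nonneg[of e a b c l]) auto
  qed
  obtain j :: nat where "- e < real j" using reals_Archimedean2 by blast
  thus ?thesis using assms
  proof (induction j arbitrary: a b c e)
    case (Suc j)
    show ?case
    proof (cases "e \<ge> 0")
      case False
      show ?thesis
        by (rule gauss_2F1_uniform_bound_integrate; (rule Suc.IH)?) (use Suc.prems False in auto)
    qed (use Suc.prems nonneg' in auto)
  qed (use nonneg' in auto)
qed

section \<open>Size of the Appell function and a Mellin integral of the Gauss function\<close>

lemma powr_times_exp_minus_bounded:
  fixes E :: real
  assumes "E > 0" "u > 0"
  shows "u powr E * exp (- u) \<le> E powr E"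
proof -
  have "u / E \<le> exp (u / E)" using exp_ge_add_one_self[of "u / E"] by linarith
  hence "(u / E) powr E \<le> exp (u / E) powr E" using assms by (intro powr_mono2) auto
  also have "\<dots> = exp u" using assms by (simp add: powr_def)
  finally have "u powr E \<le> E powr E * exp u" using assms by (simp add: powr_divide field_simps)
  thus ?thesis by (simp add: exp_minus field_simps)
qed

text \<open>Since \<open>(1 - w)^m \<le> exp (- w m)\<close>, the exponential decay in \<open>w m\<close> absorbs any power of \<open>1 + w m\<close>.\<close>
lemma powr_times_power_bounded:
  fixes e :: real
  obtains C where "C > 0" "\<And>w m. 0 < w \<Longrightarrow> w \<le> 1 \<Longrightarrow> (1 + w * real m) powr (- e) * (1 - w) ^ m \<le> C"
proof (cases "e \<ge> 0")
  case True
  have "(1 + w * real m) powr (- e) * (1 - w) ^ m \<le> 1 * 1" if w: "0 < w" "w \<le> 1" for w m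
  proof (intro mult_mono)
    have "(1 + w * real m) powr (- e) \<le> (1 + w * real m) powr 0"
      using w True by (intro powr_mono) auto
    also have "(1 + w * real m) powr 0 = 1"
      using w add_pos_nonneg[of 1 "w * real m"] by simp
    finally show "(1 + w * real m) powr (- e) \<le> 1" .
    show "(1 - w) ^ m \<le> 1" using w by (intro power_le_one) auto
  qed (use w in auto)
  thus ?thesis by (intro that[of 1]) auto
next
  case False
  have "(1 + w * real m) powr (- e) * (1 - w) ^ m \<le> (- e) powr (- e) * exp 1" if w: "0 < w" "w \<le> 1" for w m
  proof -
    have u: "1 + w * real m > 0" using w by (intro add_pos_nonneg) auto
    have "(1 - w) ^ m \<le> exp (- w) ^ m"
      using w exp_ge_add_one_self[of "- w"] by (intro power_mono) auto
    also have "\<dots> = exp (- (1 + w * real m)) * exp 1"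
      by (simp flip: exp_of_nat_mult exp_add add: algebra_simps)
    finally have "(1 + w * real m) powr (- e) * (1 - w) ^ m \<le>
        (1 + w * real m) powr (- e) * (exp (- (1 + w * real m)) * exp 1)"
      by (intro mult_left_mono) auto
    also have "\<dots> \<le> (- e) powr (- e) * exp 1"
      using powr_times_exp_minus_bounded[of "- e" "1 + w * real m"] False u by simp
    finally show ?thesis .
  qed
  thus ?thesis using False by (intro that[of "(- e) powr (- e) * exp 1"]) auto
qed

text \<open>With \<open>y = 1/w - 1\<close> one has \<open>1 + y / (m + 1) = (1 + w m) / (w (m + 1))\<close>. So the uniform bound splits
  off \<open>w^e\<close>, the factor \<open>(1 + w m)^(- e) (1 - w)^m\<close> is bounded, and what is left is a convergent series
  of powers of \<open>m + 1\<close>, because \<open>e < Re (\<gamma> - \<alpha> - \<beta>)\<close>.\<close>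
theorem appell_F3_abs_partial_sum_bound:
  fixes \<alpha> \<alpha>' \<beta> \<beta>' \<gamma> :: complex
  assumes "Re \<gamma> > 0" "e < Re \<alpha>'" "e < Re \<beta>'" "e < Re (\<gamma> - \<alpha> - \<beta>)"
  obtains C where "C > 0" "\<And>w M. 0 < w \<Longrightarrow> w \<le> 1 \<Longrightarrow>
     (\<Sum>m<M. norm (gauss_coeff \<alpha> \<beta> \<gamma> m) * (1 - w) ^ m *
       norm (gauss_2F1 \<alpha>' \<beta>' (\<gamma> + of_nat m) (1 - of_real (1 / w)))) \<le> C * w powr e"
proof -
  obtain C1 where C1: "C1 > 0" "\<And>m y. y \<ge> 0 \<Longrightarrow>
     norm (gauss_2F1 \<alpha>' \<beta>' (\<gamma> + of_nat m) (- of_real y)) \<le> C1 * (1 + y / (real m + 1)) powr (- e)"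
    using gauss_2F1_uniform_bound_general[OF assms(1-3)] unfolding gauss_2F1_uniform_bound_def by blast
  have "\<gamma> \<notin> \<int>\<^sub>\<le>\<^sub>0" using assms(1) by (rule Re_pos_not_nonpos_Int)
  from gauss_coeff_bound[OF this] obtain C2 where C2: "C2 > 0"
    "\<And>n. norm (gauss_coeff \<alpha> \<beta> \<gamma> n) \<le> C2 * (real n + 1) powr (Re (\<alpha> + \<beta> - \<gamma>) - 1)" by blast
  obtain C3 where C3: "C3 > 0" "\<And>w m. 0 < w \<Longrightarrow> w \<le> 1 \<Longrightarrow> (1 + w * real m) powr (- e) * (1 - w) ^ m \<le> C3"
    using powr_times_power_bounded by blast
  define r where "r = Re (\<alpha> + \<beta> - \<gamma>) - 1 + e"
  have sr: "summable (\<lambda>m. (real m + 1) powr r)"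
    using assms by (intro summable_Suc_powr) (simp add: r_def)
  define S where "S = (\<Sum>m. (real m + 1) powr r)"
  have S: "S \<ge> 0" unfolding S_def by (intro suminf_nonneg sr) auto
  have "(\<Sum>m<M. norm (gauss_coeff \<alpha> \<beta> \<gamma> m) * (1 - w) ^ m *
       norm (gauss_2F1 \<alpha>' \<beta>' (\<gamma> + of_nat m) (1 - of_real (1 / w)))) \<le> (C1 * C2 * C3 * (S + 1)) * w powr e"
    if w: "0 < w" "w \<le> 1" for w M
  proof -
    have summand: "norm (gauss_coeff \<alpha> \<beta> \<gamma> m) * (1 - w) ^ m *
       norm (gauss_2F1 \<alpha>' \<beta>' (\<gamma> + of_nat m) (1 - of_real (1 / w))) \<le> C1 * C2 * C3 * w powr e * (real m + 1) powr r" for m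
    proof -
      define y where "y = 1 / w - 1"
      have y: "y \<ge> 0" using w by (simp add: y_def)
      have z: "1 - complex_of_real (1 / w) = - of_real y" by (simp add: y_def)
      have "1 + y / (real m + 1) = (1 + w * real m) / (w * (real m + 1))"
        using w by (simp add: y_def divide_simps) (simp add: algebra_simps)
      hence "(1 + y / (real m + 1)) powr (- e) = (1 + w * real m) powr (- e) / (w * (real m + 1)) powr (- e)"
        using w by (simp only: powr_divide)
      also have "\<dots> = (1 + w * real m) powr (- e) * (w * (real m + 1)) powr e"
        by (simp add: powr_minus_divide)
      also have "(w * (real m + 1)) powr e = w powr e * (real m + 1) powr e"
        by (rule powr_mult)
      finally have "(1 + y / (real m + 1)) powr (- e) = (1 + w * real m) powr (- e) * (w powr e * (real m + 1) powr e)" .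
      hence F: "norm (gauss_2F1 \<alpha>' \<beta>' (\<gamma> + of_nat m) (1 - of_real (1 / w))) \<le>
          C1 * ((1 + w * real m) powr (- e) * (w powr e * (real m + 1) powr e))"
        unfolding z using C1(2)[OF y, of m] by simp
      have "norm (gauss_coeff \<alpha> \<beta> \<gamma> m) * (1 - w) ^ m *
          norm (gauss_2F1 \<alpha>' \<beta>' (\<gamma> + of_nat m) (1 - of_real (1 / w))) \<le>
        (C2 * (real m + 1) powr (Re (\<alpha> + \<beta> - \<gamma>) - 1)) * (1 - w) ^ m *
          (C1 * ((1 + w * real m) powr (- e) * (w powr e * (real m + 1) powr e)))"
        using C2 w by (intro mult_mono F mult_nonneg_nonneg) auto
      also have "\<dots> = C1 * C2 * ((1 + w * real m) powr (- e) * (1 - w) ^ m) * w powr e *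
                     ((real m + 1) powr (Re (\<alpha> + \<beta> - \<gamma>) - 1) * (real m + 1) powr e)"
        by (simp add: mult_ac)
      also have "(real m + 1) powr (Re (\<alpha> + \<beta> - \<gamma>) - 1) * (real m + 1) powr e = (real m + 1) powr r"
        unfolding r_def by (rule powr_add [symmetric])
      also have "C1 * C2 * ((1 + w * real m) powr (- e) * (1 - w) ^ m) * w powr e * (real m + 1) powr r \<le>
                 C1 * C2 * C3 * w powr e * (real m + 1) powr r"
        using C3(2)[OF w, of m] C1 C2 by (intro mult_right_mono mult_left_mono) auto
      finally show ?thesis .
    qed
    have "(\<Sum>m<M. norm (gauss_coeff \<alpha> \<beta> \<gamma> m) * (1 - w) ^ m *
       norm (gauss_2F1 \<alpha>' \<beta>' (\<gamma> + of_nat m) (1 - of_real (1 / w)))) \<le>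
        (\<Sum>m<M. C1 * C2 * C3 * w powr e * (real m + 1) powr r)"
      by (intro sum_mono summand)
    also have "\<dots> = C1 * C2 * C3 * w powr e * (\<Sum>m<M. (real m + 1) powr r)"
      by (simp add: sum_distrib_left)
    also have "\<dots> \<le> C1 * C2 * C3 * w powr e * (S + 1)"
    proof -
      have "(\<Sum>m<M. (real m + 1) powr r) \<le> S" unfolding S_def by (intro sum_le_suminf sr) auto
      thus ?thesis using C1 C2 C3 by (intro mult_left_mono) auto
    qed
    finally show ?thesis by (simp add: mult_ac)
  qed
  moreover have "C1 * C2 * C3 * (S + 1) > 0" using C1 C2 C3 S by simp
  ultimately show ?thesis using that by blast
qed

text \<open>The absolute value of the integrand is the integrand with the real parts as parameters.\<close>
lemma Beta_integral_ray_norm: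
  assumes "Re a > 0" "Re b > 0" "x > 0"
  shows "has_bochner_integral lborel
           (\<lambda>t. norm (indicator {x<..} t *\<^sub>R (of_real (t - x) powr (a - 1) * complex_of_real t powr (- a - b))))
           (x powr (- Re b) * norm (Gamma (of_real (Re a)) * Gamma (of_real (Re b)) * rGamma (complex_of_real (Re a + Re b))))"
proof -
  let ?v = "complex_of_real x powr (- of_real (Re b)) * (Gamma (of_real (Re a)) * Gamma (of_real (Re b)) * rGamma (of_real (Re a) + of_real (Re b)))"
  have real_integrand: "indicator {x<..} t *\<^sub>R (of_real (t - x) powr (of_real (Re a) - 1) * complex_of_real t powr (- of_real (Re a) - of_real (Re b)))
     = of_real (norm (indicator {x<..} t *\<^sub>R (of_real (t - x) powr (a - 1) * complex_of_real t powr (- a - b))))" for t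
  proof (cases "t > x")
    case True
    have "of_real (t - x) powr (of_real (Re a) - 1) = complex_of_real ((t - x) powr (Re a - 1))"
      using powr_of_real[of "t - x" "Re a - 1"] True by simp
    moreover have "complex_of_real t powr (- of_real (Re a) - of_real (Re b)) = of_real (t powr (- Re a - Re b))"
      using powr_of_real[of t "- Re a - Re b"] True assms by simp
    ultimately show ?thesis using True assms
      by (simp add: norm_mult norm_powr_real_powr del: of_real_diff)
  qed auto
  have B: "has_bochner_integral lborel (\<lambda>t. complex_of_real (norm (indicator {x<..} t *\<^sub>R (of_real (t - x) powr (a - 1) * complex_of_real t powr (- a - b))))) ?v"
    using Beta_integral_ray[of "of_real (Re a)" "of_real (Re b)" x] assms unfolding real_integrand by simp
  have "Re ?v = x powr (- Re b) * norm (Gamma (of_real (Re a)) * Gamma (of_real (Re b)) * rGamma (complex_of_real (Re a + Re b)))"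
  proof -
    have pos: "Gamma (Re a) > 0" "Gamma (Re b) > 0" "rGamma (Re a + Re b) > 0"
      using assms by (auto intro!: Gamma_real_pos simp: rGamma_inverse_Gamma)
    have "complex_of_real x powr (- of_real (Re b)) = of_real (x powr (- Re b))"
      using powr_of_real[of x "- Re b"] assms by simp
    moreover have "rGamma (complex_of_real (Re a) + of_real (Re b)) = of_real (rGamma (Re a + Re b))"
      using rGamma_complex_of_real[of "Re a + Re b"] by simp
    ultimately show ?thesis using pos
      by (simp add: Gamma_complex_of_real rGamma_complex_of_real norm_mult flip: of_real_add)
  qed
  with has_bochner_integral_Re[OF B] show ?thesis by simp
qed

text \<open>Term by term integration under absolute convergence, which is used three times: for the
  Pfaff series, for \<open>F\<^sub>3\<close> and for the Bessel series.\<close>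
lemma has_bochner_integral_suminf:
  fixes f :: "nat \<Rightarrow> 'a \<Rightarrow> 'b::{banach, second_countable_topology}"
  assumes "\<And>n. has_bochner_integral M (f n) (v n)"
    and "\<And>x. summable (\<lambda>n. norm (f n x))"
    and "summable (\<lambda>n. LINT x|M. norm (f n x))"
  shows "has_bochner_integral M (\<lambda>x. \<Sum>n. f n x) (\<Sum>n. v n)" "summable v"
proof -
  have int: "integrable M (f n)" and v: "(LINT x|M. f n x) = v n" for n
    using assms(1) by (auto simp: has_bochner_integral_iff)
  have ae: "AE x in M. summable (\<lambda>n. norm (f n x))" using assms(2) by simp
  show "has_bochner_integral M (\<lambda>x. \<Sum>n. f n x) (\<Sum>n. v n)"
    unfolding has_bochner_integral_iff
    using integrable_suminf[OF int ae assms(3)] integral_suminf[OF int ae assms(3)] by (simp add: v)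
  show "summable v"
    using sums_integral[OF int ae assms(3)] by (simp add: v sums_iff)
qed

text \<open>Pfaff's transformation turns the integrand into a series of Beta integrands with parameters
  \<open>g + n\<close> and \<open>s + a\<close>. The integrals of the absolute values are of the order of
  \<open>n^(- Re (s + b) - 1)\<close>, so they are summable, and the sum of the values is a Gauss series at 1.\<close>
theorem gauss_2F1_Mellin_ray:
  assumes "Re g > 0" "Re (s + a) > 0" "Re (s + b) > 0" "x > 0"
  shows "has_bochner_integral lborel
           (\<lambda>t. indicator {x<..} t *\<^sub>R (of_real (t - x) powr (g - 1) * of_real t powr (- g - s)
                   * gauss_2F1 a b g (1 - of_real (t / x))))
           (of_real x powr (- s) * (Gamma g * Gamma (s + a) * Gamma (s + b) * rGamma (s + g) * rGamma (s + a + b)))"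
proof -
  have g: "g \<notin> \<int>\<^sub>\<le>\<^sub>0" using assms(1) by (rule Re_pos_not_nonpos_Int)
  define h where "h n = gauss_coeff a (g - b) g n" for n
  define k where "k n t = indicator {x<..} t *\<^sub>R (of_real (t - x) powr (g + of_nat n - 1) * complex_of_real t powr (- (g + of_nat n) - (s + a)))" for n t
  define v where "v n = of_real x powr a * h n * (of_real x powr (- (s + a)) * (Gamma (g + of_nat n) * Gamma (s + a) * rGamma (g + of_nat n + (s + a))))" for n
  define f where "f n t = of_real x powr a * h n * k n t" for n t
  have fv: "has_bochner_integral lborel (f n) (v n)" for n
    unfolding f_def k_def v_def
    by (intro has_bochner_integral_mult_right Beta_integral_ray) (use assms in auto)
  have kt: "k n t = k 0 t * (1 - of_real (x / t)) ^ n" for n t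
  proof (cases "t > x")
    case True
    hence t: "t > 0" using assms by simp
    have "of_real (t - x) powr (g + of_nat n - 1) = of_real (t - x) powr (g - 1) * complex_of_real (t - x) ^ n"
    proof -
      have "g + of_nat n - 1 = (g - 1) + of_nat n" by simp
      thus ?thesis using True by (simp only: powr_add) (simp add: powr_nat')
    qed
    moreover have "complex_of_real t powr (- (g + of_nat n) - (s + a)) = of_real t powr (- g - (s + a)) / of_real t ^ n"
    proof -
      have "- (g + of_nat n) - (s + a) = (- g - (s + a)) - of_nat n" by simp
      thus ?thesis using t by (simp only: powr_diff) (simp add: powr_nat')
    qed
    moreover have "(1 - of_real (x / t)) ^ n = complex_of_real (t - x) ^ n / of_real t ^ n"
      using t by (simp flip: power_divide add: diff_divide_distrib)
    ultimately have "of_real (t - x) powr (g + of_nat n - 1) * complex_of_real t powr (- (g + of_nat n) - (s + a)) =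
        of_real (t - x) powr (g - 1) * complex_of_real t powr (- g - (s + a)) * (1 - of_real (x / t)) ^ n"
      by (simp only:) (simp only: times_divide_eq_left times_divide_eq_right mult_ac)
    moreover have "k n t = of_real (t - x) powr (g + of_nat n - 1) * complex_of_real t powr (- (g + of_nat n) - (s + a))"
      unfolding k_def using True by simp
    moreover have "k 0 t = of_real (t - x) powr (g - 1) * complex_of_real t powr (- g - (s + a))"
      unfolding k_def using True by simp
    ultimately show ?thesis by (simp only:)
  qed (auto simp: k_def)
  have q: "0 \<le> 1 - x / t" "1 - x / t < 1" "1 - complex_of_real (x / t) = of_real (1 - x / t)" if "t > x" for t
    using that assms by auto
  have summable_pt: "summable (\<lambda>n. norm (f n t))" for t
  proof (cases "t > x")
    case True
    have "summable (\<lambda>n. norm (fps_nth (gauss_fps a (g - b) g) n * of_real (1 - x / t) ^ n))"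
      using q[OF True] by (intro norm_summable_fps less_le_trans[OF _ gauss_fps_conv_radius[OF g]])
        (simp only: norm_of_real, simp)
    hence "summable (\<lambda>n. norm (of_real x powr a * k 0 t) * norm (fps_nth (gauss_fps a (g - b) g) n * of_real (1 - x / t) ^ n))"
      by (rule summable_mult)
    also have "(\<lambda>n. norm (of_real x powr a * k 0 t) * norm (fps_nth (gauss_fps a (g - b) g) n * of_real (1 - x / t) ^ n)) = (\<lambda>n. norm (f n t))"
    proof (rule ext)
      fix n
      show "norm (of_real x powr a * k 0 t) * norm (fps_nth (gauss_fps a (g - b) g) n * of_real (1 - x / t) ^ n) = norm (f n t)"
        by (simp only: f_def kt[of n t] q(3)[OF True] gauss_fps_def fps_nth_Abs_fps h_def norm_mult mult_ac)
    qed
    finally show ?thesis .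
  qed (simp add: f_def k_def)
  have summable_int: "summable (\<lambda>n. LINT t|lborel. norm (f n t))"
  proof -
    let ?rg = "complex_of_real (Re g)" and ?rA = "complex_of_real (Re (s + a))"
    have rgA: "?rg + ?rA \<notin> \<int>\<^sub>\<le>\<^sub>0" and rg: "?rg \<notin> \<int>\<^sub>\<le>\<^sub>0" using assms by (auto intro!: Re_pos_not_nonpos_Int)
    obtain C1 where C1: "C1 > 0" "\<And>n. norm (h n) \<le> C1 * (real n + 1) powr (Re (a + (g - b) - g) - 1)"
      using gauss_coeff_bound[OF g] unfolding h_def by blast
    obtain C2 where C2: "C2 > 0" "\<And>n. norm (gauss_coeff ?rg 1 (?rg + ?rA) n) \<le> C2 * (real n + 1) powr (Re (?rg + 1 - (?rg + ?rA)) - 1)"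
      using gauss_coeff_bound[OF rgA] by blast
    define K where "K = norm (of_real x powr a) * x powr (- Re (s + a)) * norm (Gamma ?rg * Gamma ?rA * rGamma (?rg + ?rA))"
    have int: "(LINT t|lborel. norm (f n t)) = K * (norm (h n) * norm (gauss_coeff ?rg 1 (?rg + ?rA) n))" for n
    proof -
      have "(LINT t|lborel. norm (f n t)) = norm (of_real x powr a * h n) * (LINT t|lborel. norm (k n t))"
        by (simp add: f_def norm_mult)
      also have "(LINT t|lborel. norm (k n t)) = x powr (- Re (s + a)) * norm (Gamma (of_real (Re (g + of_nat n))) * Gamma ?rA * rGamma (complex_of_real (Re (g + of_nat n) + Re (s + a))))"
        unfolding k_def by (rule has_bochner_integral_integral_eq[OF Beta_integral_ray_norm]) (use assms in auto)
      also have "complex_of_real (Re (g + of_nat n)) = ?rg + of_nat n" by simp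
      also have "complex_of_real (Re (g + of_nat n) + Re (s + a)) = (?rg + ?rA) + of_nat n" by simp
      also have "rGamma ((?rg + ?rA) + of_nat n) = rGamma (?rg + ?rA) / pochhammer (?rg + ?rA) n"
        by (rule rGamma_add_of_nat[OF rgA])
      also have "Gamma (?rg + of_nat n) = Gamma ?rg * pochhammer ?rg n"
        using rg by (simp add: pochhammer_Gamma Gamma_eq_zero_iff)
      finally show ?thesis
        by (simp add: K_def norm_mult norm_divide pochhammer_fact [symmetric])
    qed
    have le: "norm (LINT t|lborel. norm (f n t)) \<le> K * (C1 * C2) * (real n + 1) powr (- Re (s + b) - 1)" for n
    proof -
      have "norm (h n) * norm (gauss_coeff ?rg 1 (?rg + ?rA) n) \<le>
         (C1 * (real n + 1) powr (Re (a + (g - b) - g) - 1)) * (C2 * (real n + 1) powr (Re (?rg + 1 - (?rg + ?rA)) - 1))"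
        by (intro mult_mono C1 C2) (use C1 in auto)
      also have "\<dots> = C1 * C2 * ((real n + 1) powr (Re (a + (g - b) - g) - 1) * (real n + 1) powr (Re (?rg + 1 - (?rg + ?rA)) - 1))"
        by (simp add: mult_ac)
      also have "(real n + 1) powr (Re (a + (g - b) - g) - 1) * (real n + 1) powr (Re (?rg + 1 - (?rg + ?rA)) - 1)
         = (real n + 1) powr (- Re (s + b) - 1)"
        by (subst powr_add [symmetric], rule arg_cong[where f = "\<lambda>u. (real n + 1) powr u"]) simp
      finally have "K * (norm (h n) * norm (gauss_coeff ?rg 1 (?rg + ?rA) n)) \<le> K * (C1 * C2 * (real n + 1) powr (- Re (s + b) - 1))"
        by (rule mult_left_mono) (simp add: K_def)
      moreover have "K * (norm (h n) * norm (gauss_coeff ?rg 1 (?rg + ?rA) n)) \<ge> 0"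
        by (intro mult_nonneg_nonneg) (auto simp: K_def)
      ultimately show ?thesis unfolding int real_norm_def by (simp only: abs_of_nonneg mult.assoc)
    qed
    have "summable (\<lambda>n. K * (C1 * C2) * (real n + 1) powr (- Re (s + b) - 1))"
      using assms by (intro summable_mult summable_Suc_powr) auto
    thus ?thesis by (rule summable_comparison_test'[where N = 0]) (rule le)
  qed
  note sum = has_bochner_integral_suminf[OF fv summable_pt summable_int]
  have "(\<Sum>n. v n) = of_real x powr (- s) * (Gamma g * Gamma (s + a) * Gamma (s + b) * rGamma (s + g) * rGamma (s + a + b))"
  proof -
    have v: "v n = (of_real x powr (- s) * Gamma (s + a) * Gamma g) * regularized_gauss_term a (g - b) (s + a + g) n" for n
    proof -
      have nz: "pochhammer g n \<noteq> 0" using g pochhammer_eq_0_imp_nonpos_Int by blast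
      have "Gamma (g + of_nat n) = Gamma g * pochhammer g n"
        using g by (simp add: pochhammer_Gamma Gamma_eq_zero_iff)
      moreover have "of_real x powr a * of_real x powr (- (s + a)) = complex_of_real x powr (- s)"
        by (simp flip: powr_add)
      moreover have "g + of_nat n + (s + a) = s + a + g + of_nat n" by simp
      ultimately show ?thesis using nz
        unfolding v_def h_def regularized_gauss_term_def by (simp add: field_simps)
    qed
    have "regularized_gauss_term a (g - b) (s + a + g) sums
       (Gamma (s + a + g - a - (g - b)) * rGamma (s + a + g - a) * rGamma (s + a + g - (g - b)))"
      by (rule regularized_gauss_sum) (use assms in auto)
    hence "regularized_gauss_term a (g - b) (s + a + g) sums (Gamma (s + b) * rGamma (s + g) * rGamma (s + a + b))"
      by (simp add: algebra_simps)
    from sums_unique[OF sums_mult[OF this, of "of_real x powr (- s) * Gamma (s + a) * Gamma g"]]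
    show ?thesis unfolding v by (simp add: mult_ac)
  qed
  moreover have "(\<Sum>n. f n t) = indicator {x<..} t *\<^sub>R (of_real (t - x) powr (g - 1) * of_real t powr (- g - s)
                   * gauss_2F1 a b g (1 - of_real (t / x)))" for t
  proof (cases "t > x")
    case True
    hence t: "t > 0" using assms by simp
    have "(\<Sum>n. f n t) = of_real x powr a * k 0 t * eval_fps (gauss_fps a (g - b) g) (of_real (1 - x / t))"
    proof -
      have "summable (\<lambda>n. fps_nth (gauss_fps a (g - b) g) n * of_real (1 - x / t) ^ n)"
        using q[OF True] by (intro summable_fps less_le_trans[OF _ gauss_fps_conv_radius[OF g]])
          (simp only: norm_of_real, simp)
      moreover have "f n t = of_real x powr a * k 0 t * (fps_nth (gauss_fps a (g - b) g) n * of_real (1 - x / t) ^ n)" for n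
        by (simp only: f_def kt[of n t] q(3)[OF True] gauss_fps_def fps_nth_Abs_fps h_def mult_ac)
      ultimately show ?thesis unfolding eval_fps_def by (simp only: suminf_mult)
    qed
    also have "of_real x powr a * k 0 t = of_real (t - x) powr (g - 1) * of_real t powr (- g - s) * of_real (t / x) powr (- a)"
    proof -
      have "complex_of_real (t / x) powr (- a) = of_real x powr a * of_real t powr (- a)"
        using t assms by (simp add: powr_def Ln_of_real ln_div exp_add [symmetric] algebra_simps del: of_real_divide)
      moreover have "complex_of_real t powr (- g - s) * of_real t powr (- a) = of_real t powr (- g - (s + a))"
        by (subst powr_add [symmetric], rule arg_cong[where f = "\<lambda>u. of_real t powr u"]) simp
      ultimately show ?thesis using True by (simp add: k_def mult_ac del: of_real_divide)
    qed
    also have "of_real (t / x) powr (- a) = (1 - (1 - complex_of_real (t / x))) powr (- a)" by simp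
    also have "complex_of_real (1 - x / t) = (1 - of_real (t / x)) / ((1 - of_real (t / x)) - 1)"
      using t assms by (simp add: field_simps)
    finally show ?thesis
      using True assms by (subst Pfaff_transformation[OF g]) (simp_all add: mult.assoc)
  qed (simp add: f_def k_def)
  ultimately show ?thesis using sum(1) by simp
qed

text \<open>The power of \<open>t\<close> is parametrised by \<open>s\<close> so that, in the variable \<open>w = x / t\<close>, the integral is the Mellin
  transform at \<open>s\<close> of \<open>(1 - w)^(\<gamma> - 1) F\<^sub>3\<close>, up to the factor \<open>x^(- s)\<close>.\<close>
theorem appell_F3_Mellin_ray:
  fixes \<alpha> \<alpha>' \<beta> \<beta>' \<gamma> s :: complex and x :: real
  assumes "Re \<gamma> > 0" "x > 0"
    and "Re (s + \<alpha>') > 0" "Re (s + \<beta>') > 0" "Re (s + \<gamma> - \<alpha> - \<beta>) > 0"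
  shows "has_bochner_integral lborel
           (\<lambda>t. indicator {x<..} t *\<^sub>R (of_real (t - x) powr (\<gamma> - 1) * of_real t powr (- \<gamma> - s)
              * appell_F3 \<alpha> \<alpha>' \<beta> \<beta>' \<gamma> (of_real (1 - x / t)) (of_real (1 - t / x))))
           (of_real x powr (- s) * (Gamma \<gamma> * Gamma (s + \<alpha>') * Gamma (s + \<beta>') * Gamma (s + \<gamma> - \<alpha> - \<beta>)
              * rGamma (s + \<alpha>' + \<beta>') * rGamma (s + \<gamma> - \<alpha>) * rGamma (s + \<gamma> - \<beta>)))"
proof -
  have g: "\<gamma> \<notin> \<int>\<^sub>\<le>\<^sub>0" using assms(1) by (rule Re_pos_not_nonpos_Int)
  let ?c = "gauss_coeff \<alpha> \<beta> \<gamma>"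
  let ?F = "\<lambda>m. gauss_2F1 \<alpha>' \<beta>' (\<gamma> + of_nat m)"
  define k where "k t = of_real (t - x) powr (\<gamma> - 1) * complex_of_real t powr (- \<gamma> - s)" for t
  define f where "f m t = ?c m * (indicator {x<..} t *\<^sub>R (of_real (t - x) powr (\<gamma> + of_nat m - 1)
        * of_real t powr (- (\<gamma> + of_nat m) - s) * ?F m (1 - of_real (t / x))))" for m t
  define v where "v m = ?c m * (of_real x powr (- s) * (Gamma (\<gamma> + of_nat m) * Gamma (s + \<alpha>') * Gamma (s + \<beta>')
        * rGamma (s + (\<gamma> + of_nat m)) * rGamma (s + \<alpha>' + \<beta>')))" for m
  have fv: "has_bochner_integral lborel (f m) (v m)" for m
    unfolding f_def v_def
    by (intro has_bochner_integral_mult_right gauss_2F1_Mellin_ray) (use assms in auto)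
  have f_eq: "f m t = k t * (?c m * of_real (1 - x / t) ^ m * ?F m (1 - of_real (t / x)))" if "t > x" for m t
  proof -
    have t: "t > 0" using that assms by simp
    have "of_real (t - x) powr (\<gamma> + of_nat m - 1) = of_real (t - x) powr (\<gamma> - 1) * complex_of_real (t - x) ^ m"
    proof -
      have "\<gamma> + of_nat m - 1 = (\<gamma> - 1) + of_nat m" by simp
      thus ?thesis using that by (simp only: powr_add) (simp add: powr_nat')
    qed
    moreover have "complex_of_real t powr (- (\<gamma> + of_nat m) - s) = of_real t powr (- \<gamma> - s) / of_real t ^ m"
    proof -
      have "- (\<gamma> + of_nat m) - s = (- \<gamma> - s) - of_nat m" by simp
      thus ?thesis using t by (simp only: powr_diff) (simp add: powr_nat')
    qed
    moreover have "complex_of_real (1 - x / t) ^ m = complex_of_real (t - x) ^ m / of_real t ^ m"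
      using t by (simp flip: power_divide add: diff_divide_distrib)
    ultimately have "of_real (t - x) powr (\<gamma> + of_nat m - 1) * complex_of_real t powr (- (\<gamma> + of_nat m) - s) =
        k t * complex_of_real (1 - x / t) ^ m"
      by (simp only: k_def times_divide_eq_left times_divide_eq_right mult_ac)
    moreover have "f m t = ?c m * ((of_real (t - x) powr (\<gamma> + of_nat m - 1) * complex_of_real t powr (- (\<gamma> + of_nat m) - s)) * ?F m (1 - of_real (t / x)))"
      unfolding f_def using that by simp
    ultimately show ?thesis by (simp only: mult_ac)
  qed
  (* The first inequality makes the majorant H integrable, the others admit the bound C w^e. *)
  obtain e where e: "- Re s < e" "e < Re \<alpha>'" "e < Re \<beta>'" "e < Re (\<gamma> - \<alpha> - \<beta>)"
  proof -
    have "- Re s < Min {Re \<alpha>', Re \<beta>', Re (\<gamma> - \<alpha> - \<beta>)}" using assms by auto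
    then obtain e where "- Re s < e" "e < Min {Re \<alpha>', Re \<beta>', Re (\<gamma> - \<alpha> - \<beta>)}" using dense by blast
    thus ?thesis by (intro that[of e]) auto
  qed
  obtain C where C: "C > 0" "\<And>w M. 0 < w \<Longrightarrow> w \<le> 1 \<Longrightarrow>
     (\<Sum>m<M. norm (?c m) * (1 - w) ^ m * norm (?F m (1 - of_real (1 / w)))) \<le> C * w powr e"
    using appell_F3_abs_partial_sum_bound[OF assms(1) e(2-4)] by blast
  define H where "H t = C * x powr e * norm (indicator {x<..} t *\<^sub>R
       (of_real (t - x) powr (\<gamma> - 1) * complex_of_real t powr (- \<gamma> - (s + of_real e))))" for t
  have H: "integrable lborel H"
    unfolding H_def using Beta_integral_ray_norm[of \<gamma> "s + of_real e" x] assms(1,2) e(1)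
    by (intro integrable_mult_right) (auto simp: has_bochner_integral_iff)
  have bound: "(\<Sum>m<M. norm (f m t)) \<le> H t" for M t
  proof (cases "t > x")
    case True
    define w where "w = x / t"
    have w: "0 < w" "w \<le> 1" "1 / w = t / x" using True assms by (auto simp: w_def)
    have "(\<Sum>m<M. norm (f m t)) = norm (k t) * (\<Sum>m<M. norm (?c m) * (1 - w) ^ m * norm (?F m (1 - of_real (1 / w))))"
      unfolding sum_distrib_left
    proof (intro sum.cong refl)
      fix m
      have "norm (complex_of_real (1 - x / t) ^ m) = (1 - w) ^ m"
        using w(2) unfolding norm_power norm_of_real w_def by simp
      thus "norm (f m t) = norm (k t) * (norm (?c m) * (1 - w) ^ m * norm (?F m (1 - of_real (1 / w))))"
        unfolding f_eq[OF True] w(3) norm_mult by simp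
    qed
    also have "\<dots> \<le> norm (k t) * (C * w powr e)"
      by (intro mult_left_mono C w) auto
    also have "\<dots> = H t"
    proof -
      have "(- \<gamma> - (s + of_real e)) = (- \<gamma> - s) + (- of_real e)" by simp
      hence "complex_of_real t powr (- \<gamma> - (s + of_real e)) = of_real t powr (- \<gamma> - s) * of_real t powr (- of_real e)"
        by (simp only: powr_add)
      moreover have "norm (complex_of_real t powr (- of_real e)) = t powr (- e)"
        using norm_powr_real_powr[of t "- of_real e"] True assms by simp
      moreover have "w powr e = x powr e * t powr (- e)"
        by (simp add: w_def powr_divide powr_minus_divide)
      ultimately show ?thesis using True by (simp add: H_def k_def norm_mult del: of_real_diff)
    qed
    finally show ?thesis .
  next
    case False
    thus ?thesis using C(1) by (simp add: f_def H_def)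
  qed
  have summable_pt: "summable (\<lambda>m. norm (f m t))" for t
    by (rule summableI_nonneg_bounded[OF _ bound]) auto
  have summable_int: "summable (\<lambda>m. LINT t|lborel. norm (f m t))"
  proof (rule summableI_nonneg_bounded)
    fix M
    have int: "integrable lborel (\<lambda>t. norm (f m t))" for m
      using fv by (intro integrable_norm) (auto simp: has_bochner_integral_iff)
    have "(\<Sum>m<M. LINT t|lborel. norm (f m t)) = (LINT t|lborel. (\<Sum>m<M. norm (f m t)))"
      by (rule Bochner_Integration.integral_sum [symmetric]) (rule int)
    also have "\<dots> \<le> (LINT t|lborel. H t)"
      by (intro integral_mono bound H Bochner_Integration.integrable_sum int)
    finally show "(\<Sum>m<M. LINT t|lborel. norm (f m t)) \<le> (LINT t|lborel. H t)" .
  qed auto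
  note sum = has_bochner_integral_suminf[OF fv summable_pt summable_int]
  have "(\<Sum>m. v m) = of_real x powr (- s) * (Gamma \<gamma> * Gamma (s + \<alpha>') * Gamma (s + \<beta>') * Gamma (s + \<gamma> - \<alpha> - \<beta>)
              * rGamma (s + \<alpha>' + \<beta>') * rGamma (s + \<gamma> - \<alpha>) * rGamma (s + \<gamma> - \<beta>))"
  proof -
    let ?K = "of_real x powr (- s) * Gamma \<gamma> * Gamma (s + \<alpha>') * Gamma (s + \<beta>') * rGamma (s + \<alpha>' + \<beta>')"
    have v: "v m = ?K * regularized_gauss_term \<alpha> \<beta> (s + \<gamma>) m" for m
    proof -
      have nz: "pochhammer \<gamma> m \<noteq> 0" using g pochhammer_eq_0_imp_nonpos_Int by blast
      have "Gamma (\<gamma> + of_nat m) = Gamma \<gamma> * pochhammer \<gamma> m"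
        using g by (simp add: pochhammer_Gamma Gamma_eq_zero_iff)
      thus ?thesis using nz
        unfolding v_def regularized_gauss_term_def by (simp add: add.assoc)
    qed
    have "regularized_gauss_term \<alpha> \<beta> (s + \<gamma>) sums
            (Gamma (s + \<gamma> - \<alpha> - \<beta>) * rGamma (s + \<gamma> - \<alpha>) * rGamma (s + \<gamma> - \<beta>))"
      using assms(5) by (rule regularized_gauss_sum)
    from sums_unique[OF sums_mult[OF this, of ?K]] show ?thesis unfolding v by (simp add: mult_ac)
  qed
  moreover have "(\<Sum>m. f m t) = indicator {x<..} t *\<^sub>R (of_real (t - x) powr (\<gamma> - 1) * of_real t powr (- \<gamma> - s)
              * appell_F3 \<alpha> \<alpha>' \<beta> \<beta>' \<gamma> (of_real (1 - x / t)) (of_real (1 - t / x)))" for t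
  proof (cases "t > x")
    case True
    define u where "u m = ?c m * of_real (1 - x / t) ^ m * ?F m (1 - of_real (t / x))" for m
    have fu: "f m t = k t * u m" for m unfolding u_def by (rule f_eq[OF True])
    have "k t \<noteq> 0" using True assms(2) by (auto simp: k_def powr_def)
    moreover have "summable (\<lambda>m. k t * u m)"
      using summable_norm_cancel[OF summable_pt[of t]] unfolding fu .
    ultimately have "summable u" by (simp add: summable_cmult_iff)
    hence "(\<Sum>m. f m t) = k t * (\<Sum>m. u m)" unfolding fu by (rule suminf_mult)
    also have "(\<Sum>m. u m) = appell_F3 \<alpha> \<alpha>' \<beta> \<beta>' \<gamma> (of_real (1 - x / t)) (of_real (1 - t / x))"
      by (simp add: appell_F3_def u_def)
    finally show ?thesis using True by (simp add: k_def)
  qed (simp add: f_def)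
  ultimately show ?thesis using sum(1) by simp
qed

section \<open>The Bessel series under the integral\<close>

text \<open>Already the factor \<open>1 / k!\<close> forces convergence: by \<open>rGamma_add_of_nat_bound_exists\<close> the
  reciprocal Gamma factor is at most a power of \<open>k + 1\<close>.\<close>
lemma summable_bessel_coeff:
  fixes \<kappa> c z :: complex
  shows "summable (\<lambda>k. norm ((- 1) ^ k * c ^ k / (Gamma (\<kappa> + of_nat k) * fact k) * z ^ k))"
proof -
  obtain C where C: "C > 0" "\<And>k. norm (rGamma (\<kappa> + of_nat k)) \<le> C * (real k + 1) powr (1 - Re \<kappa>) / fact k"
    using rGamma_add_of_nat_bound_exists[of \<kappa>] by blast
  define q where "q = 1 - Re \<kappa>"
  define R where "R = norm (c * z) + 1"
  have R: "R > 0" by (simp add: R_def add_nonneg_pos)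
  have "(\<lambda>k. (real k + 1) powr q * (R ^ k / fact k)) \<in> O(\<lambda>k. 2 ^ k * (R ^ k / fact k))"
    by (intro landau_o.big.mult landau_o.big_refl) real_asymp
  moreover have "summable (\<lambda>k. norm (2 ^ k * (R ^ k / fact k)))"
    using summable_exp[of "2 * R"] R by (simp add: power_mult_distrib divide_inverse mult_ac abs_mult)
  ultimately have "summable (\<lambda>k. (real k + 1) powr q * (R ^ k / fact k))"
    by (rule summable_comparison_test_bigo[rotated])
  hence "summable (\<lambda>k. (real k + 1) powr q * R ^ k / fact k)" by simp
  hence "summable (\<lambda>k. C * ((real k + 1) powr q * R ^ k / fact k))" by (rule summable_mult)
  thus ?thesis
  proof (rule summable_comparison_test'[where N = 0])
    fix k
    have "norm ((- 1) ^ k * c ^ k / (Gamma (\<kappa> + of_nat k) * fact k) * z ^ k) =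
          norm (rGamma (\<kappa> + of_nat k)) * norm (c * z) ^ k * (1 / fact k)"
      by (simp add: norm_mult norm_divide norm_power rGamma_inverse_Gamma divide_inverse norm_inverse power_mult_distrib mult_ac)
    also have "\<dots> \<le> (C * (real k + 1) powr q / fact k) * R ^ k * 1"
      using C R unfolding q_def by (intro mult_mono power_mono C) (auto simp: R_def fact_ge_1)
    finally show "norm (norm ((- 1) ^ k * c ^ k / (Gamma (\<kappa> + of_nat k) * fact k) * z ^ k)) \<le> C * ((real k + 1) powr q * R ^ k / fact k)"
      by simp
  qed
qed

lemma Gamma_add_double:
  fixes z :: complex
  assumes "z \<notin> \<int>\<^sub>\<le>\<^sub>0"
  shows "Gamma (z + 2 * of_nat k) = Gamma z * (4 ^ k * pochhammer (z / 2) k * pochhammer ((z + 1) / 2) k)"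
proof -
  have "Gamma (z + of_nat (2 * k)) = Gamma z * pochhammer z (2 * k)"
    using assms by (simp add: pochhammer_Gamma Gamma_eq_zero_iff del: of_nat_mult)
  also have "pochhammer z (2 * k) = 4 ^ k * pochhammer (z / 2) k * pochhammer ((z + 1) / 2) k"
    using pochhammer_double[of "z / 2" k] by (simp add: power_mult add_divide_distrib)
  finally show ?thesis by simp
qed

lemma gen_bessel_W_series:
  assumes "t > 0"
  shows "(\<lambda>k. (- 1) ^ k * c ^ k / (Gamma (p + (b + 1) / 2 + of_nat k) * fact k) * (1 / 4) ^ k *
            (2 powr (- p) * complex_of_real t powr (- p) * of_real (1 / t ^ 2) ^ k))
         sums gen_bessel_W p b c (of_real (1 / t))"
proof -
  let ?u = "\<lambda>k. (- 1) ^ k * c ^ k / (Gamma (p + (b + 1) / 2 + of_nat k) * fact k)"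
  have pw: "(of_real (1 / t) / 2) powr (2 * of_nat k + p) =
     (1 / 4) ^ k * (2 powr (- p) * complex_of_real t powr (- p) * of_real (1 / t ^ 2) ^ k)" for k
  proof -
    have h: "complex_of_real (1 / t) / 2 = of_real (1 / (2 * t))" by simp
    have "complex_of_real (1 / (2 * t)) powr (2 * of_nat k + p) = of_real (1 / (2 * t)) ^ (2 * k) * of_real (1 / (2 * t)) powr p"
    proof -
      have "complex_of_real (1 / (2 * t)) powr (of_nat (2 * k)) = of_real (1 / (2 * t)) ^ (2 * k)"
        using assms by (intro powr_nat'[THEN trans]) auto
      thus ?thesis by (simp add: powr_add)
    qed
    moreover have "complex_of_real (1 / (2 * t)) powr p = 2 powr (- p) * of_real t powr (- p)"
      using assms powr_of_real[of 2]
      by (simp add: powr_def Ln_of_real ln_div ln_mult exp_add [symmetric] algebra_simps Ln_of_real[of 2, simplified] del: of_real_divide)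
    moreover have "complex_of_real (1 / (2 * t)) ^ (2 * k) = (1 / 4) ^ k * of_real (1 / t ^ 2) ^ k"
      by (simp add: power_mult power2_eq_square power_mult_distrib [symmetric])
    ultimately show ?thesis unfolding h by (simp add: mult_ac)
  qed
  have "summable (\<lambda>k. (2 powr (- p) * complex_of_real t powr (- p)) * (?u k * (of_real (1 / (4 * t ^ 2))) ^ k))"
    by (intro summable_mult summable_norm_cancel[OF summable_bessel_coeff])
  also have "(\<lambda>k. (2 powr (- p) * complex_of_real t powr (- p)) * (?u k * (of_real (1 / (4 * t ^ 2))) ^ k)) =
     (\<lambda>k. ?u k * (of_real (1 / t) / 2) powr (2 * of_nat k + p))"
  proof (rule ext)
    fix k
    have "complex_of_real (1 / (4 * t ^ 2)) ^ k = (1 / 4) ^ k * of_real (1 / t ^ 2) ^ k"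
      by (simp add: power_mult_distrib [symmetric])
    thus "(2 powr (- p) * complex_of_real t powr (- p)) * (?u k * (of_real (1 / (4 * t ^ 2))) ^ k) =
       ?u k * (of_real (1 / t) / 2) powr (2 * of_nat k + p)" unfolding pw by (simp only: mult_ac)
  qed
  finally have "(\<lambda>k. ?u k * (of_real (1 / t) / 2) powr (2 * of_nat k + p)) sums gen_bessel_W p b c (of_real (1 / t))"
    unfolding gen_bessel_W_def by (rule summable_sums)
  thus ?thesis unfolding pw by (simp only: mult.assoc)
qed

theorem theorem3p2:
  fixes \<alpha> \<alpha>' \<beta> \<beta>' \<gamma> \<rho> p b c :: complex and x :: real
  assumes "p + (b + 1) / 2 \<notin> \<int>\<^sub>\<le>\<^sub>0"
    and "Re \<gamma> > 0"
    and "Re (\<rho> - p) < 1 + Min {Re (- \<beta>), Re (\<alpha> + \<alpha>' - \<gamma>), Re (\<alpha> + \<beta>' - \<gamma>)}"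
    and "p - \<rho> + 1 \<notin> \<int>\<^sub>\<le>\<^sub>0"
    and "\<alpha> + \<alpha>' + \<beta>' + p - \<gamma> - \<rho> + 1 \<notin> \<int>\<^sub>\<le>\<^sub>0"
    and "\<alpha> - \<beta> + p - \<rho> + 1 \<notin> \<int>\<^sub>\<le>\<^sub>0"
    and "x > 0"
  defines "f \<equiv> (\<lambda>t::real. of_real t powr (\<rho> - 1) * gen_bessel_W p b c (of_real (1 / t)))"
  shows "set_integrable lborel {x<..} (saigo_maeda_integrand \<alpha> \<alpha>' \<beta> \<beta>' \<gamma> f x)
    \<and> saigo_maeda_minus \<alpha> \<alpha>' \<beta> \<beta>' \<gamma> f x =
      of_real x powr (\<rho> - p - \<alpha> - \<alpha>' + \<gamma> - 1) / 2 powr p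
      * (Gamma (\<alpha> + \<alpha>' + p - \<gamma> - \<rho> + 1) * Gamma (\<alpha> + \<beta>' - \<gamma> + p - \<rho> + 1) * Gamma (- \<beta> + p - \<rho> + 1)
         / (Gamma (p - \<rho> + 1) * Gamma (p + (b + 1) / 2)
            * Gamma (\<alpha> + \<alpha>' + \<beta>' + p - \<gamma> - \<rho> + 1) * Gamma (\<alpha> - \<beta> + p - \<rho> + 1)))
      * hypergeo
          [(\<alpha> + \<alpha>' + p - \<gamma> - \<rho> + 1) / 2, (\<alpha> + \<alpha>' + p - \<gamma> - \<rho> + 2) / 2,
           (\<alpha> + \<beta>' + p - \<gamma> - \<rho> + 1) / 2, (\<alpha> + \<beta>' + p - \<gamma> - \<rho> + 2) / 2,
           (- \<beta> + p - \<rho> + 1) / 2, (- \<beta> + p - \<rho> + 2) / 2]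
          [p + (b + 1) / 2,
           (p - \<rho> + 1) / 2, (p - \<rho> + 2) / 2,
           (\<alpha> + \<alpha>' + \<beta>' + p - \<gamma> - \<rho> + 1) / 2, (\<alpha> + \<alpha>' + \<beta>' + p - \<gamma> - \<rho> + 2) / 2,
           (\<alpha> - \<beta> + p - \<rho> + 1) / 2, (\<alpha> - \<beta> + p - \<rho> + 2) / 2]
          (- c / (4 * of_real x ^ 2))"
proof -
  define \<kappa> where "\<kappa> = p + (b + 1) / 2"
  (* The k-th Bessel term is integrated by appell_F3_Mellin_ray at s + 2k. Its three numerator
     Gamma functions then have the arguments A + 2k, B + 2k, C + 2k, and the denominators have
     E + 2k, D + 2k, G + 2k. *)
  define s where "s = 1 + \<alpha> - \<gamma> - \<rho> + p"
  define A where "A = \<alpha> + \<alpha>' + p - \<gamma> - \<rho> + 1"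
  define B where "B = \<alpha> + \<beta>' + p - \<gamma> - \<rho> + 1"
  define C where "C = - \<beta> + p - \<rho> + 1"
  define D where "D = p - \<rho> + 1"
  define E where "E = \<alpha> + \<alpha>' + \<beta>' + p - \<gamma> - \<rho> + 1"
  define G where "G = \<alpha> - \<beta> + p - \<rho> + 1"
  define F3 where "F3 t = appell_F3 \<alpha> \<alpha>' \<beta> \<beta>' \<gamma> (of_real (1 - x / t)) (of_real (1 - t / x))" for t
  define I where "I k t = indicator {x<..} t *\<^sub>R (of_real (t - x) powr (\<gamma> - 1)
      * complex_of_real t powr (- \<gamma> - (s + 2 * of_nat k)) * F3 t)" for k t
  define V where "V k = of_real x powr (- (s + 2 * of_nat k)) * (Gamma \<gamma> * Gamma (A + 2 * of_nat k) * Gamma (B + 2 * of_nat k)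
      * Gamma (C + 2 * of_nat k) * rGamma (E + 2 * of_nat k) * rGamma (D + 2 * of_nat k) * rGamma (G + 2 * of_nat k))" for k
  define d where "d k = 2 powr (- p) * ((- 1) ^ k * c ^ k / (Gamma (\<kappa> + of_nat k) * fact k) * (1 / 4) ^ k)" for k
  have pos: "Re A > 0" "Re B > 0" "Re C > 0"
    using assms(3) by (auto simp: A_def B_def C_def)
  have \<kappa>: "\<kappa> \<notin> \<int>\<^sub>\<le>\<^sub>0" and D: "D \<notin> \<int>\<^sub>\<le>\<^sub>0" and E: "E \<notin> \<int>\<^sub>\<le>\<^sub>0" and G: "G \<notin> \<int>\<^sub>\<le>\<^sub>0"
    using assms by (simp_all add: \<kappa>_def D_def E_def G_def)
  have ABC: "A \<notin> \<int>\<^sub>\<le>\<^sub>0" "B \<notin> \<int>\<^sub>\<le>\<^sub>0" "C \<notin> \<int>\<^sub>\<le>\<^sub>0" "\<gamma> \<notin> \<int>\<^sub>\<le>\<^sub>0"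
    using pos assms(2) by (simp_all add: Re_pos_not_nonpos_Int)
  have eqs: "s + 2 * of_nat k + \<alpha>' = A + 2 * of_nat k" "s + 2 * of_nat k + \<beta>' = B + 2 * of_nat k"
     "s + 2 * of_nat k + \<gamma> - \<alpha> - \<beta> = C + 2 * of_nat k" "A + 2 * of_nat k + \<beta>' = E + 2 * of_nat k"
     "s + 2 * of_nat k + \<gamma> - \<alpha> = D + 2 * of_nat k" "s + 2 * of_nat k + \<gamma> - \<beta> = G + 2 * of_nat k" for k :: nat
    by (simp_all add: s_def A_def B_def C_def D_def E_def G_def)
  have IV: "has_bochner_integral lborel (I k) (V k)" for k
  proof -
    have "has_bochner_integral lborel (I k)
       (of_real x powr (- (s + 2 * of_nat k)) * (Gamma \<gamma> * Gamma (s + 2 * of_nat k + \<alpha>') * Gamma (s + 2 * of_nat k + \<beta>')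
          * Gamma (s + 2 * of_nat k + \<gamma> - \<alpha> - \<beta>) * rGamma (s + 2 * of_nat k + \<alpha>' + \<beta>')
          * rGamma (s + 2 * of_nat k + \<gamma> - \<alpha>) * rGamma (s + 2 * of_nat k + \<gamma> - \<beta>)))"
      unfolding I_def F3_def
      by (rule appell_F3_Mellin_ray[OF assms(2,7)]) (unfold eqs(1-3), use pos in auto)
    thus ?thesis unfolding eqs(3) unfolding eqs(1,2,4-6) V_def .
  qed
  have I_shift: "I k t = I 0 t * of_real (1 / t ^ 2) ^ k" for k t
  proof (cases "t > x")
    case True
    hence t: "t > 0" using assms(7) by simp
    have "- \<gamma> - (s + 2 * of_nat k) = (- \<gamma> - s) - of_nat (2 * k)" by simp
    hence "complex_of_real t powr (- \<gamma> - (s + 2 * of_nat k)) = of_real t powr (- \<gamma> - s) / of_real t powr (of_nat (2 * k))"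
      by (simp only: powr_diff)
    also have "complex_of_real t powr (of_nat (2 * k)) = (of_real t ^ 2) ^ k"
      using t by (subst powr_nat') (auto simp: power_mult)
    finally show ?thesis using True by (simp add: I_def power_divide power_one_over)
  qed (simp add: I_def)
  have I_norm: "norm (I k t) \<le> norm (I 0 t) * (1 / x ^ 2) ^ k" for k t
  proof (cases "t > x")
    case True
    have "norm (complex_of_real (1 / t ^ 2) ^ k) \<le> (1 / x ^ 2) ^ k"
      unfolding norm_power norm_of_real
      using True assms(7) by (intro power_mono) (auto intro!: divide_left_mono power_mono)
    thus ?thesis unfolding I_shift[of k t] norm_mult by (intro mult_left_mono) auto
  qed (simp add: I_def)
  have sum_d: "summable (\<lambda>k. norm (d k) * (1 / x ^ 2) ^ k)"
  proof -
    have "summable (\<lambda>k. norm (2 powr (- p)) * norm ((- 1) ^ k * c ^ k / (Gamma (\<kappa> + of_nat k) * fact k) * of_real (1 / (4 * x ^ 2)) ^ k))"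
      by (intro summable_mult summable_bessel_coeff)
    also have "(\<lambda>k. norm (2 powr (- p)) * norm ((- 1) ^ k * c ^ k / (Gamma (\<kappa> + of_nat k) * fact k) * of_real (1 / (4 * x ^ 2)) ^ k))
       = (\<lambda>k. norm (d k) * (1 / x ^ 2) ^ k)"
    proof (rule ext)
      fix k
      have "norm (complex_of_real (1 / (4 * x ^ 2)) ^ k) = norm ((1 / 4 :: complex) ^ k) * (1 / x ^ 2) ^ k"
        by (simp add: norm_power norm_mult norm_divide power_mult_distrib [symmetric])
      thus "norm (2 powr (- p)) * norm ((- 1) ^ k * c ^ k / (Gamma (\<kappa> + of_nat k) * fact k) * of_real (1 / (4 * x ^ 2)) ^ k) =
            norm (d k) * (1 / x ^ 2) ^ k"
        unfolding d_def norm_mult by (simp only: mult_ac)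
    qed
    finally show ?thesis .
  qed
  have I0: "integrable lborel (I 0)" using IV by (auto simp: has_bochner_integral_iff)
  have dI: "norm (d k * I k t) \<le> norm (d k) * (1 / x ^ 2) ^ k * norm (I 0 t)" for k t
    using mult_left_mono[OF I_norm[of k t], of "norm (d k)"] by (simp add: norm_mult mult_ac)
  have series: "has_bochner_integral lborel (\<lambda>t. \<Sum>k. d k * I k t) (\<Sum>k. d k * V k)" "summable (\<lambda>k. d k * V k)"
  proof -
    have fv: "has_bochner_integral lborel (\<lambda>t. d k * I k t) (d k * V k)" for k
      by (intro has_bochner_integral_mult_right IV)
    have pt: "summable (\<lambda>k. norm (d k * I k t))" for t
      by (rule summable_comparison_test'[OF summable_mult2[OF sum_d], where N = 0]) (use dI in simp)
    have int: "summable (\<lambda>k. LINT t|lborel. norm (d k * I k t))"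
    proof (rule summable_comparison_test'[OF summable_mult2[OF sum_d], where N = 0])
      fix k
      have "(LINT t|lborel. norm (d k * I k t)) \<le> (LINT t|lborel. norm (d k) * (1 / x ^ 2) ^ k * norm (I 0 t))"
        using IV[of k]
        by (intro integral_mono dI integrable_norm integrable_mult_right I0) (simp add: has_bochner_integral_iff)
      thus "norm (LINT t|lborel. norm (d k * I k t)) \<le> norm (d k) * (1 / x ^ 2) ^ k * (LINT t|lborel. norm (I 0 t))"
        by simp
    qed
    show "has_bochner_integral lborel (\<lambda>t. \<Sum>k. d k * I k t) (\<Sum>k. d k * V k)" "summable (\<lambda>k. d k * V k)"
      using has_bochner_integral_suminf[OF fv pt int] by auto
  qed
  have integrand: "(\<Sum>k. d k * I k t) = indicator {x<..} t *\<^sub>R saigo_maeda_integrand \<alpha> \<alpha>' \<beta> \<beta>' \<gamma> f x t" for t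
  proof (cases "t > x")
    case True
    hence t: "t > 0" using assms(7) by simp
    let ?K = "of_real (t - x) powr (\<gamma> - 1) * of_real t powr (- \<alpha>) * F3 t * of_real t powr (\<rho> - 1)"
    have "(\<lambda>k. ?K * ((- 1) ^ k * c ^ k / (Gamma (p + (b + 1) / 2 + of_nat k) * fact k) * (1 / 4) ^ k *
            (2 powr (- p) * complex_of_real t powr (- p) * of_real (1 / t ^ 2) ^ k)))
         sums (?K * gen_bessel_W p b c (of_real (1 / t)))"
      by (rule sums_mult[OF gen_bessel_W_series[OF t]])
    also have "(\<lambda>k. ?K * ((- 1) ^ k * c ^ k / (Gamma (p + (b + 1) / 2 + of_nat k) * fact k) * (1 / 4) ^ k *
            (2 powr (- p) * complex_of_real t powr (- p) * of_real (1 / t ^ 2) ^ k))) = (\<lambda>k. d k * I k t)"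
    proof (rule ext)
      fix k
      have "- \<gamma> - s = - \<alpha> + (\<rho> - 1) + - p" by (simp add: s_def)
      hence "complex_of_real t powr (- \<gamma> - s) = of_real t powr (- \<alpha>) * of_real t powr (\<rho> - 1) * of_real t powr (- p)"
        by (simp only: powr_add)
      hence I0: "I 0 t = of_real (t - x) powr (\<gamma> - 1) * (of_real t powr (- \<alpha>) * of_real t powr (\<rho> - 1) * of_real t powr (- p)) * F3 t"
        using True by (simp add: I_def)
      show "?K * ((- 1) ^ k * c ^ k / (Gamma (p + (b + 1) / 2 + of_nat k) * fact k) * (1 / 4) ^ k *
            (2 powr (- p) * complex_of_real t powr (- p) * of_real (1 / t ^ 2) ^ k)) = d k * I k t"
        unfolding I_shift[of k t] I0 d_def \<kappa>_def by (simp only: mult_ac)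
    qed
    finally show ?thesis using True
      by (simp add: sums_iff saigo_maeda_integrand_def F3_def f_def mult_ac)
  qed (simp add: I_def)
  have integral: "has_bochner_integral lborel (\<lambda>t. indicator {x<..} t *\<^sub>R saigo_maeda_integrand \<alpha> \<alpha>' \<beta> \<beta>' \<gamma> f x t) (\<Sum>k. d k * V k)"
    using series(1) unfolding integrand .
  define P where "P = of_real x powr (\<rho> - p - \<alpha> - \<alpha>' + \<gamma> - 1) / 2 powr p * (Gamma A * Gamma B * Gamma C / (Gamma D * Gamma \<kappa> * Gamma E * Gamma G))"
  define z where "z = - c / (4 * complex_of_real x ^ 2)"
  define T where "T k = pochhammer (A / 2) k * pochhammer ((A + 1) / 2) k * pochhammer (B / 2) k * pochhammer ((B + 1) / 2) k
      * pochhammer (C / 2) k * pochhammer ((C + 1) / 2) k / (pochhammer \<kappa> k * pochhammer (D / 2) k * pochhammer ((D + 1) / 2) k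
      * pochhammer (E / 2) k * pochhammer ((E + 1) / 2) k * pochhammer (G / 2) k * pochhammer ((G + 1) / 2) k * fact k) * z ^ k" for k
  have P0: "P \<noteq> 0" using ABC D E G \<kappa> assms(7) by (simp add: P_def Gamma_eq_zero_iff)
  have PT: "of_real x powr (- \<alpha>') / Gamma \<gamma> * (d k * V k) = P * T k" for k
  proof -
    let ?q = "(4 :: complex) ^ k"
    let ?h = "\<lambda>z. pochhammer (z / 2) k * pochhammer ((z + 1) / 2) k :: complex"
    have up: "Gamma (z + 2 * of_nat k) = Gamma z * (?q * ?h z)" if "z \<notin> \<int>\<^sub>\<le>\<^sub>0" for z
      unfolding Gamma_add_double[OF that] by (simp only: mult.assoc)
    have down: "rGamma (z + 2 * of_nat k) = 1 / (Gamma z * (?q * ?h z))" if "z \<notin> \<int>\<^sub>\<le>\<^sub>0" for z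
      unfolding rGamma_inverse_Gamma up[OF that] by (rule inverse_eq_divide)
    have \<kappa>k: "Gamma (\<kappa> + of_nat k) = Gamma \<kappa> * pochhammer \<kappa> k"
      using \<kappa> by (simp add: pochhammer_Gamma Gamma_eq_zero_iff)
    have xpow: "of_real x powr (- \<alpha>') * of_real x powr (- (s + 2 * of_nat k)) =
            of_real x powr (\<rho> - p - \<alpha> - \<alpha>' + \<gamma> - 1) * (1 / complex_of_real x ^ 2) ^ k"
    proof -
      have "- \<alpha>' + - (s + 2 * of_nat k) = (\<rho> - p - \<alpha> - \<alpha>' + \<gamma> - 1) - of_nat (2 * k)"
        by (simp add: s_def)
      hence "of_real x powr (- \<alpha>') * of_real x powr (- (s + 2 * of_nat k)) =
          complex_of_real x powr (\<rho> - p - \<alpha> - \<alpha>' + \<gamma> - 1) / of_real x powr (of_nat (2 * k))"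
        by (simp only: powr_add [symmetric] powr_diff)
      also have "complex_of_real x powr (of_nat (2 * k)) = (of_real x ^ 2) ^ k"
        using assms(7) by (subst powr_nat') (auto simp: power_mult)
      finally show ?thesis by (simp only: power_one_over times_divide_eq_right mult_1_right)
    qed
    have "z = (- 1) * c * (1 / 4) * (1 / complex_of_real x ^ 2)" by (simp add: z_def)
    hence zk: "z ^ k = (- 1) ^ k * c ^ k * (1 / 4) ^ k * (1 / complex_of_real x ^ 2) ^ k"
      by (simp only: power_mult_distrib)
    have nz: "Gamma \<gamma> \<noteq> 0" "?q \<noteq> 0" using ABC by (simp_all add: Gamma_eq_zero_iff)
    (* The three factors 4^k of the numerator cancel those of the denominator. *)
    have cancel: "X * Y * inverse W * m / (gk * pk * fk) *
        (gA * (q * hA) * (gB * (q * hB)) * (gC * (q * hC)) * (1 / (gE * (q * hE))) * (1 / (gD * (q * hD))) * (1 / (gG * (q * hG))))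
      = X / W * (m * Y) / (gk * pk * fk) * (gA * hA * (gB * hB) * (gC * hC) / (gE * hE * (gD * hD) * (gG * hG)))"
      if q: "q \<noteq> 0" for X Y W m gk pk fk gA gB gC gD gE gG hA hB hC hD hE hG q :: complex
    proof -
      have "X * Y * inverse W * m / (gk * pk * fk) *
        (gA * (q * hA) * (gB * (q * hB)) * (gC * (q * hC)) * (1 / (gE * (q * hE))) * (1 / (gD * (q * hD))) * (1 / (gG * (q * hG))))
      = X / W * (m * Y) / (gk * pk * fk) * (gA * hA * (gB * hB) * (gC * hC) / (gE * hE * (gD * hD) * (gG * hG)))
        * ((q * inverse q) * (q * inverse q) * (q * inverse q))"
        by (simp only: divide_inverse inverse_mult_distrib mult_ac mult_1_left mult_1_right)
      thus ?thesis using q by simp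
    qed
    have "of_real x powr (- \<alpha>') / Gamma \<gamma> * (d k * V k) =
      (of_real x powr (- \<alpha>') * of_real x powr (- (s + 2 * of_nat k))) * 2 powr (- p) *
      ((- 1) ^ k * c ^ k * (1 / 4) ^ k) / (Gamma (\<kappa> + of_nat k) * fact k) *
      (Gamma (A + 2 * of_nat k) * Gamma (B + 2 * of_nat k)
      * Gamma (C + 2 * of_nat k) * rGamma (E + 2 * of_nat k) * rGamma (D + 2 * of_nat k) * rGamma (G + 2 * of_nat k))"
    proof -
      have "X / g * (t * (m / e * u) * (Y * (g * a1 * a2 * a3 * a4 * a5 * a6))) = (X * Y) * t * (m * u) / e * (a1 * a2 * a3 * a4 * a5 * a6)"
        if "g \<noteq> 0" for X g t m e u Y a1 a2 a3 a4 a5 a6 :: complex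
        using that by (simp add: mult_ac)
      from this[OF nz(1)] show ?thesis unfolding d_def V_def .
    qed
    also have "\<dots> = of_real x powr (\<rho> - p - \<alpha> - \<alpha>' + \<gamma> - 1) / 2 powr p * z ^ k / (Gamma \<kappa> * pochhammer \<kappa> k * fact k) *
      (Gamma A * ?h A * (Gamma B * ?h B) * (Gamma C * ?h C) / (Gamma E * ?h E * (Gamma D * ?h D) * (Gamma G * ?h G)))"
      unfolding xpow \<kappa>k up[OF ABC(1)] up[OF ABC(2)] up[OF ABC(3)] down[OF D] down[OF E] down[OF G] zk powr_minus[of 2 p]
      by (rule cancel[OF nz(2)])
    also have "\<dots> = P * T k"
      unfolding P_def T_def by (simp only: divide_inverse inverse_mult_distrib mult_ac)
    finally show ?thesis .
  qed
  have "summable (\<lambda>k. P * T k)"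
    unfolding PT [symmetric] by (rule summable_mult[OF series(2)])
  hence sT: "summable T" using P0 by (simp add: summable_cmult_iff)
  have "saigo_maeda_minus \<alpha> \<alpha>' \<beta> \<beta>' \<gamma> f x = of_real x powr (- \<alpha>') / Gamma \<gamma> * (\<Sum>k. d k * V k)"
    using integral by (simp add: saigo_maeda_minus_def set_lebesgue_integral_def has_bochner_integral_iff)
  also have "\<dots> = (\<Sum>k. P * T k)"
    unfolding PT [symmetric] by (rule suminf_mult [symmetric, OF series(2)])
  also have "\<dots> = P * (\<Sum>k. T k)" by (rule suminf_mult[OF sT])
  also have "(\<Sum>k. T k) = hypergeo [A / 2, (A + 1) / 2, B / 2, (B + 1) / 2, C / 2, (C + 1) / 2]
      [\<kappa>, D / 2, (D + 1) / 2, E / 2, (E + 1) / 2, G / 2, (G + 1) / 2] z"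
    by (simp add: hypergeo_def eval_fps_def T_def)
  finally have "saigo_maeda_minus \<alpha> \<alpha>' \<beta> \<beta>' \<gamma> f x = P * hypergeo [A / 2, (A + 1) / 2, B / 2, (B + 1) / 2, C / 2, (C + 1) / 2]
      [\<kappa>, D / 2, (D + 1) / 2, E / 2, (E + 1) / 2, G / 2, (G + 1) / 2] z" .
  moreover have "A + 1 = \<alpha> + \<alpha>' + p - \<gamma> - \<rho> + 2" "B + 1 = \<alpha> + \<beta>' + p - \<gamma> - \<rho> + 2" "C + 1 = - \<beta> + p - \<rho> + 2"
    "D + 1 = p - \<rho> + 2" "E + 1 = \<alpha> + \<alpha>' + \<beta>' + p - \<gamma> - \<rho> + 2" "G + 1 = \<alpha> - \<beta> + p - \<rho> + 2"
    "\<alpha> + \<beta>' - \<gamma> + p - \<rho> + 1 = B"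
    by (simp_all add: A_def B_def C_def D_def E_def G_def)
  ultimately show ?thesis using integral
    unfolding set_integrable_def has_bochner_integral_iff
    unfolding P_def A_def [symmetric] B_def [symmetric] C_def [symmetric] D_def [symmetric] E_def [symmetric]
      G_def [symmetric] \<kappa>_def [symmetric] z_def [symmetric]
    by (simp only:)
qed

end
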